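(* Let $N\ge3$ and suppose $V$ satisfies (V1)–(V3). Let $\mu_n\to\infty$ and let $\{v_n\}\subset X$ satisfy $\|v_n\|_{\mu_n}\le c_0$ for all $n$, for some $c_0>0$. Then there exist a subsequence (still denoted $\{v_n\}$) and $v_0\in H^1_0(\Omega)$ (extended by zero to $\mathbb{R}^N$) such that $v_n\rightharpoonup v_0$ weakly in $X$ and $v_n\to v_0$ strongly in $L^r(\mathbb{R}^N)$ for all $2\le r<2^*$.
   Context: $2^*=2N/(N-2)$. (V1) $V$ is nonnegative and continuous on $\mathbb{R}^N$; (V2) there is $c>0$ such that $\{V<c\}$ is nonempty and has finite Lebesgue measure; (V3) $\Omega=\mathrm{int}\{V=0\}$ is a nonempty bounded domain with smooth boundary and $\overline\Omega=\{V=0\}$. $X=\{u\in H^1(\mathbb{R}^N):\int Vu^2dx<\infty\}$ with the norm $\|u\|^2=\int(|\nabla u|^2+Vu^2)dx$, and for $\mu>0$, $\|u\|_\mu^2=\int(|\nabla u|^2+\mu Vu^2)dx$. *)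

theory Defs
  imports "HOL-Analysis.Analysis"
begin

definition partial :: "'n::finite \<Rightarrow> (real^'n \<Rightarrow> real) \<Rightarrow> real^'n \<Rightarrow> real" where
  "partial i f x = frechet_derivative f (at x) (axis i 1)"

fun Ck_on :: "nat \<Rightarrow> (real^'n::finite \<Rightarrow> real) \<Rightarrow> (real^'n) set \<Rightarrow> bool" where
  "Ck_on 0 f U = continuous_on U f"
| "Ck_on (Suc k) f U = ((\<forall>x\<in>U. f differentiable (at x)) \<and> continuous_on U f \<and>
      (\<forall>i. Ck_on k (partial i f) U))"

definition smooth_on :: "(real^'n::finite \<Rightarrow> real) \<Rightarrow> (real^'n) set \<Rightarrow> bool" where
  "smooth_on f U = (\<forall>k. Ck_on k f U)"

definition test_fn :: "(real^'n::finite \<Rightarrow> real) \<Rightarrow> (real^'n) set \<Rightarrow> bool" where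
  "test_fn \<phi> U = (smooth_on \<phi> UNIV \<and> compact (closure {x. \<phi> x \<noteq> 0}) \<and>
                    closure {x. \<phi> x \<noteq> 0} \<subseteq> U)"

definition weak_gradient :: "(real^'n::finite \<Rightarrow> real) \<Rightarrow> (real^'n \<Rightarrow> real^'n) \<Rightarrow> bool" where
  "weak_gradient u g = (g \<in> borel_measurable lborel \<and>
     (\<forall>\<phi> i. test_fn \<phi> UNIV \<longrightarrow>
        integrable lborel (\<lambda>x. u x * partial i \<phi> x) \<and>
        integrable lborel (\<lambda>x. g x $ i * \<phi> x) \<and>
        (\<integral>x. u x * partial i \<phi> x \<partial>lborel) = - (\<integral>x. g x $ i * \<phi> x \<partial>lborel)))"

definition H1 :: "(real^'n::finite \<Rightarrow> real) \<Rightarrow> bool" where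
  "H1 u = (u \<in> borel_measurable lborel \<and> integrable lborel (\<lambda>x. (u x)\<^sup>2) \<and>
           (\<exists>g. weak_gradient u g \<and> integrable lborel (\<lambda>x. (norm (g x))\<^sup>2)))"

(* the (a.e. unique) weak gradient of an H^1 function *)
definition wgrad :: "(real^'n::finite \<Rightarrow> real) \<Rightarrow> real^'n \<Rightarrow> real^'n" where
  "wgrad u = (SOME g. weak_gradient u g \<and> integrable lborel (\<lambda>x. (norm (g x))\<^sup>2))"

definition H1_norm :: "(real^'n::finite \<Rightarrow> real) \<Rightarrow> real" where
  "H1_norm u = sqrt (\<integral>x. (norm (wgrad u x))\<^sup>2 + (u x)\<^sup>2 \<partial>lborel)"

definition Xsp :: "(real^'n::finite \<Rightarrow> real) \<Rightarrow> (real^'n \<Rightarrow> real) \<Rightarrow> bool" where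
  "Xsp V u = (H1 u \<and> integrable lborel (\<lambda>x. V x * (u x)\<^sup>2))"

definition mu_norm :: "real \<Rightarrow> (real^'n::finite \<Rightarrow> real) \<Rightarrow> (real^'n \<Rightarrow> real) \<Rightarrow> real" where
  "mu_norm \<mu> V u = sqrt (\<integral>x. (norm (wgrad u x))\<^sup>2 + \<mu> * V x * (u x)\<^sup>2 \<partial>lborel)"

definition X_norm :: "(real^'n::finite \<Rightarrow> real) \<Rightarrow> (real^'n \<Rightarrow> real) \<Rightarrow> real" where
  "X_norm V u = mu_norm 1 V u"

definition X_dual :: "(real^'n::finite \<Rightarrow> real) \<Rightarrow> ((real^'n \<Rightarrow> real) \<Rightarrow> real) \<Rightarrow> bool" where
  "X_dual V f = ((\<forall>u w a b. Xsp V u \<longrightarrow> Xsp V w \<longrightarrow>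
                    f (\<lambda>x. a * u x + b * w x) = a * f u + b * f w) \<and>
                 (\<exists>C. \<forall>u. Xsp V u \<longrightarrow> \<bar>f u\<bar> \<le> C * X_norm V u))"

definition weak_conv_X :: "(real^'n::finite \<Rightarrow> real) \<Rightarrow> (nat \<Rightarrow> real^'n \<Rightarrow> real) \<Rightarrow> (real^'n \<Rightarrow> real) \<Rightarrow> bool" where
  "weak_conv_X V v v0 = ((\<forall>n. Xsp V (v n)) \<and> Xsp V v0 \<and>
      (\<forall>f. X_dual V f \<longrightarrow> (\<lambda>n. f (v n)) \<longlonglongrightarrow> f v0))"

definition Lr_conv :: "real \<Rightarrow> (nat \<Rightarrow> real^'n::finite \<Rightarrow> real) \<Rightarrow> (real^'n \<Rightarrow> real) \<Rightarrow> bool" where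
  "Lr_conv r v v0 = ((\<forall>n. v n \<in> borel_measurable lborel) \<and> v0 \<in> borel_measurable lborel \<and>
      (\<lambda>n. \<integral>\<^sup>+x. ennreal (\<bar>v n x - v0 x\<bar> powr r) \<partial>lborel) \<longlonglongrightarrow> 0)"

(* H^1_0(\<Omega>) extended by zero to R^N: H^1(R^N)-limits of C_c^\<infinity>(\<Omega>) functions *)
definition H10_ext :: "(real^'n::finite) set \<Rightarrow> (real^'n \<Rightarrow> real) \<Rightarrow> bool" where
  "H10_ext \<Omega> u = (H1 u \<and> (\<exists>\<phi>. (\<forall>k. test_fn (\<phi> k) \<Omega>) \<and>
       (\<lambda>k. H1_norm (\<lambda>x. \<phi> k x - u x)) \<longlonglongrightarrow> 0))"

definition smooth_boundary :: "(real^'n::finite) set \<Rightarrow> bool" where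
  "smooth_boundary \<Omega> = (\<forall>x\<in>frontier \<Omega>. \<exists>U \<rho>. open U \<and> x \<in> U \<and> smooth_on \<rho> U \<and>
      (\<forall>y\<in>U. \<exists>i. partial i \<rho> y \<noteq> 0) \<and> \<Omega> \<inter> U = {y\<in>U. \<rho> y < 0})"

definition V_hyps :: "(real^'n::finite \<Rightarrow> real) \<Rightarrow> bool" where
  "V_hyps V = ((\<forall>x. V x \<ge> 0) \<and> continuous_on UNIV V \<and>
     (\<exists>c>0. {x. V x < c} \<noteq> {} \<and> emeasure lborel {x. V x < c} < \<infinity>) \<and>
     (let \<Omega> = interior {x. V x = 0} in
        \<Omega> \<noteq> {} \<and> bounded \<Omega> \<and> connected \<Omega> \<and> smooth_boundary \<Omega> \<and>
        closure \<Omega> = {x. V x = 0}))"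

end

theory Submission
  imports Defs "HOL-Complex_Analysis.Great_Picard"
begin

text \<open>The bound forces the potential energy of the sequence to 0, so its L2 mass escapes from the
  set where V is at least c. For h-translates one has |u(h + .) - u| = O(|h|) in L2 with constant
  given by the gradient; comparing u with its averages over balls of radius R therefore yields, with
  suitable choices of R, a Poincare inequality on sets of finite measure (hence L2-boundedness and
  tightness), the subcritical Sobolev embedding (by bootstrapping a level-set estimate), and local
  compactness (ball averages are equi-Lipschitz). So a subsequence converges in L2, and in Lr by
  interpolation. The limit vanishes where V is positive, and pushing it slightly into the domain
  near each boundary point and mollifying shows that it lies in the closure of the test functions.
  Weak convergence in X needs neither reflexivity nor Riesz: if a functional stayed away from its
  limit value along a subsequence, it would do so on all iterated midpoints of that subsequence, but
  energy-minimizing midpoints of the tails converge strongly by the parallelogram identity.\<close>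

section \<open>Smooth functions and mollifiers\<close>

text \<open>The sublevel set {V < c} has finite measure but may be unbounded, so neither the L2
  bound nor compactness can come from an argument on bounded sets; both rest on an estimate in which
  only the measure of a set enters. \<open>wgrad\<close> is chosen by \<open>SOME\<close>, hence
  linear only almost everywhere; the arguments therefore carry a function together with one explicit
  weak gradient, and a.e. uniqueness recovers the chosen one when norms are evaluated. L2 distances
  stay squared, so the triangle inequality costs factors 2; the numerical constants record nothing
  deeper. The critical exponent appears only as a fixed point: the level-set estimate upgrades an
  L^p bound to L^r for every r < 2 + 2p/N, and p = 2 + 2p/N is solved by 2N/(N-2). For arbitrary
  domains, vanishing a.e. outside the closure of Omega does not imply membership in H^1_0; the
  defining function in \<open>smooth_boundary\<close> puts Omega locally on one side of its
  boundary, which makes an inward push possible. Finally, the mu_n-norm dominates the X-norm once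
  mu_n >= 1, so finitely many initial indices are dropped before anything is extracted.\<close>

lemma partial_eqI: "(f has_derivative D) (at x) \<Longrightarrow> partial i f x = D (axis i 1)"
  unfolding partial_def by (metis frechet_derivative_at)

lemma has_derivative_partial:
  fixes f :: "real^'n \<Rightarrow> real"
  assumes "f differentiable at x"
  shows "(f has_derivative (\<lambda>k. \<Sum>i\<in>UNIV. partial i f x * k $ i)) (at x)"
proof -
  let ?D = "frechet_derivative f (at x)"
  have D: "(f has_derivative ?D) (at x)" using assms frechet_derivative_works by blast
  then have lin: "linear ?D" by (rule has_derivative_linear)
  have "?D k = (\<Sum>i\<in>UNIV. partial i f x * k $ i)" for k
  proof -
    have "?D k = ?D (\<Sum>i\<in>UNIV. k$i *\<^sub>R axis i 1)"
      using basis_expansion[of k] by (simp add: scalar_mult_eq_scaleR)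
    also have "\<dots> = (\<Sum>i\<in>UNIV. k$i *\<^sub>R ?D (axis i 1))"
      using lin by (simp add: linear_sum linear_scale)
    finally show ?thesis by (simp add: partial_def mult.commute)
  qed
  then show ?thesis using D by (metis (no_types, lifting) ext)
qed

lemma Ck_on_Suc_imp: "Ck_on (Suc k) f U \<Longrightarrow> Ck_on k f U"
  by (induction k arbitrary: f) auto

lemma Ck_on_const: "Ck_on k (\<lambda>x. c) UNIV"
proof (induction k arbitrary: c)
  case (Suc k)
  have "partial i (\<lambda>x. c) = (\<lambda>x. 0)" for i :: 'a
    by (rule ext, rule partial_eqI) (rule has_derivative_const)
  then show ?case using Suc[of 0] by simp
qed simp

lemma partial_add:
  assumes "f differentiable at x" "g differentiable at x"
  shows "partial i (\<lambda>x. f x + g x) x = partial i f x + partial i g x"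
  unfolding partial_def
  by (metis assms frechet_derivative_at frechet_derivative_works has_derivative_add)

lemma partial_mult:
  assumes "f differentiable at x" "g differentiable at x"
  shows "partial i (\<lambda>x. f x * g x) x = f x * partial i g x + partial i f x * g x"
proof -
  have "((\<lambda>x. f x * g x) has_derivative
     (\<lambda>h. f x * frechet_derivative g (at x) h + frechet_derivative f (at x) h * g x)) (at x)"
    using assms by (intro has_derivative_mult) (auto simp: frechet_derivative_works[symmetric])
  from partial_eqI[OF this] show ?thesis by (simp add: partial_def)
qed

lemma Ck_on_add: "Ck_on k f UNIV \<Longrightarrow> Ck_on k g UNIV \<Longrightarrow> Ck_on k (\<lambda>x. f x + g x) UNIV"
proof (induction k arbitrary: f g)
  case 0 then show ?case by (auto intro: continuous_on_add)
next
  case (Suc k)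
  have "partial i (\<lambda>x. f x + g x) = (\<lambda>x. partial i f x + partial i g x)" for i
    using Suc.prems by (intro ext partial_add) auto
  then show ?case using Suc by (auto intro!: continuous_on_add differentiable_add)
qed

lemma Ck_on_mult: "Ck_on k f UNIV \<Longrightarrow> Ck_on k g UNIV \<Longrightarrow> Ck_on k (\<lambda>x. f x * g x) UNIV"
proof (induction k arbitrary: f g)
  case 0 then show ?case by (auto intro: continuous_on_mult)
next
  case (Suc k)
  have *: "partial i (\<lambda>x. f x * g x) = (\<lambda>x. f x * partial i g x + partial i f x * g x)" for i
    using Suc.prems by (intro ext partial_mult) auto
  have "Ck_on k f UNIV" "Ck_on k g UNIV" using Suc.prems by (auto intro: Ck_on_Suc_imp)
  then have "Ck_on k (partial i (\<lambda>x. f x * g x)) UNIV" for i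
    unfolding * using Suc by (intro Ck_on_add Suc.IH) auto
  then show ?case using Suc.prems by (auto intro!: continuous_on_mult differentiable_mult)
qed

text \<open>\<open>Ck_on\<close> speaks about functions on \<open>real^'n\<close> only, so
  smoothness of the outer function of one real variable is encoded by the sequence \<open>F\<close>
  of its successive derivatives. The induction runs over all \<open>j\<close> because
  differentiation passes from \<open>F j\<close> to \<open>F (Suc j)\<close>.\<close>

lemma Ck_on_compose_real:
  assumes F: "\<And>k x. (F k has_real_derivative F (Suc k) x) (at x)"
    and q: "smooth_on q UNIV"
  shows "Ck_on k (\<lambda>x. F j (q x)) UNIV"
proof (induction k arbitrary: j)
  case 0
  have "continuous_on UNIV q" using q unfolding smooth_on_def by (metis Ck_on.simps(1))
  moreover have "continuous_on UNIV (F j)"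
    by (meson F DERIV_continuous_on UNIV_I has_field_derivative_at_within)
  ultimately show ?case by (auto intro: continuous_on_compose2)
next
  case (Suc k)
  have q1: "Ck_on (Suc k) q UNIV" using q by (auto simp: smooth_on_def)
  then have dq: "q differentiable at x" for x by auto
  have hd: "((\<lambda>x. F j (q x)) has_derivative (\<lambda>h. frechet_derivative q (at x) h * F (Suc j) (q x))) (at x)" for x
    using has_derivative_compose[OF dq[unfolded frechet_derivative_works] F[of j "q x", unfolded has_field_derivative_def]]
    by (simp add: mult.commute)
  have *: "partial i (\<lambda>x. F j (q x)) = (\<lambda>x. partial i q x * F (Suc j) (q x))" for i
    by (rule ext, subst partial_eqI[OF hd]) (simp add: partial_def)
  have "Ck_on k (partial i (\<lambda>x. F j (q x))) UNIV" for i
    unfolding * using q1 by (intro Ck_on_mult Suc.IH) auto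
  moreover have d: "(\<lambda>x. F j (q x)) differentiable (at x)" for x
    using hd differentiable_def by blast
  moreover have "continuous_on UNIV (\<lambda>x. F j (q x))"
    using d differentiable_imp_continuous_within continuous_at_imp_continuous_on by blast
  ultimately show ?case by simp
qed

lemma partial_affine:
  assumes "f differentiable at (x + c *\<^sub>R y)"
  shows "partial i (\<lambda>y. f (x + c *\<^sub>R y)) y = c * partial i f (x + c *\<^sub>R y)"
    and "(\<lambda>y. f (x + c *\<^sub>R y)) differentiable at y"
proof -
  let ?D = "frechet_derivative f (at (x + c *\<^sub>R y))"
  have D: "(f has_derivative ?D) (at (x + c *\<^sub>R y))"
    using assms frechet_derivative_works by blast
  have "((\<lambda>y. x + c *\<^sub>R y) has_derivative (\<lambda>h. c *\<^sub>R h)) (at y)"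
    by (auto intro!: derivative_eq_intros)
  from has_derivative_compose[OF this D] have h: "((\<lambda>y. f (x + c *\<^sub>R y)) has_derivative (\<lambda>h. ?D (c *\<^sub>R h))) (at y)" .
  then show "(\<lambda>y. f (x + c *\<^sub>R y)) differentiable at y" using differentiable_def by blast
  show "partial i (\<lambda>y. f (x + c *\<^sub>R y)) y = c * partial i f (x + c *\<^sub>R y)"
    using partial_eqI[OF h] has_derivative_linear[OF D] by (simp add: partial_def linear_scale)
qed

text \<open>With c = 1 this covers translations, with c = -1 the reflections y -> x - y that occur
  inside convolutions.\<close>

lemma Ck_on_affine: "Ck_on k f UNIV \<Longrightarrow> Ck_on k (\<lambda>y. f (x + c *\<^sub>R y)) UNIV"
proof (induction k arbitrary: f)
  case 0 then show ?case by (auto intro!: continuous_on_compose2[of UNIV f] continuous_intros)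
next
  case (Suc k)
  have "partial i (\<lambda>y. f (x + c *\<^sub>R y)) = (\<lambda>y. c * partial i f (x + c *\<^sub>R y))" for i
    using Suc.prems by (intro ext partial_affine) auto
  then show ?case using Suc
    by (auto intro!: Ck_on_mult Ck_on_const partial_affine continuous_on_compose2[of UNIV f] continuous_intros)
qed

lemma smooth_on_continuous: "smooth_on f UNIV \<Longrightarrow> continuous_on UNIV f"
  unfolding smooth_on_def by (metis Ck_on.simps(1))

lemma smooth_on_differentiable: "smooth_on f UNIV \<Longrightarrow> f differentiable at x"
  unfolding smooth_on_def by (metis Ck_on.simps(2) UNIV_I)

lemma smooth_on_partial: "smooth_on f UNIV \<Longrightarrow> smooth_on (partial i f) UNIV"
  unfolding smooth_on_def by (metis Ck_on.simps(2))

lemma smooth_on_const: "smooth_on (\<lambda>x. c) UNIV"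
  by (simp add: smooth_on_def Ck_on_const)

lemma smooth_on_mult: "smooth_on f UNIV \<Longrightarrow> smooth_on g UNIV \<Longrightarrow> smooth_on (\<lambda>x. f x * g x) UNIV"
  by (simp add: smooth_on_def Ck_on_mult)

lemma smooth_on_add: "smooth_on f UNIV \<Longrightarrow> smooth_on g UNIV \<Longrightarrow> smooth_on (\<lambda>x. f x + g x) UNIV"
  by (simp add: smooth_on_def Ck_on_add)

lemma smooth_on_affine: "smooth_on f UNIV \<Longrightarrow> smooth_on (\<lambda>y. f (x + c *\<^sub>R y)) UNIV"
  by (simp add: smooth_on_def Ck_on_affine)

lemma smooth_on_component: "smooth_on (\<lambda>x. x $ j) UNIV"
  unfolding smooth_on_def
proof
  fix k
  have hd: "((\<lambda>x::real^'a. x $ j) has_derivative (\<lambda>h. h $ j)) (at x)" for x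
    by (intro bounded_linear.has_derivative[OF bounded_linear_vec_nth]) auto
  have p: "partial i (\<lambda>x::real^'a. x $ j) = (\<lambda>x. axis i 1 $ j)" for i
    by (rule ext, rule partial_eqI[OF hd])
  show "Ck_on k (\<lambda>x::real^'a. x $ j) UNIV"
  proof (cases k)
    case (Suc m)
    show ?thesis unfolding Suc
      using hd by (auto simp: p Ck_on_const differentiable_def intro!: continuous_intros)
  qed (auto intro!: continuous_intros)
qed

lemma smooth_on_sum: "(\<And>i. i \<in> I \<Longrightarrow> smooth_on (f i) UNIV) \<Longrightarrow> smooth_on (\<lambda>x. \<Sum>i\<in>I. f i x) UNIV"
  by (induction I rule: infinite_finite_induct) (auto intro: smooth_on_const smooth_on_add)

text \<open>The functions P(1/t) exp(-1/t), extended by 0. The polynomial factor makes the class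
  closed under differentiation: with s = 1/t one has ds/dt = -s^2, so the derivative belongs to the
  polynomial s^2 (P - P'), which is the double \<open>pCons\<close> in
  \<open>flat_has_derivative\<close>.\<close>

definition flat :: "real poly \<Rightarrow> real \<Rightarrow> real" where
  "flat P t = (if t > 0 then poly P (1/t) * exp (-1/t) else 0)"

lemma poly_exp_tendsto_0: "((\<lambda>s::real. poly P s * exp (-s)) \<longlongrightarrow> 0) at_top"
proof -
  have "((\<lambda>s::real. \<Sum>i\<le>degree P. coeff P i * (s ^ i / exp s)) \<longlongrightarrow> (\<Sum>i\<le>degree P. coeff P i * 0)) at_top"
    by (intro tendsto_intros tendsto_power_div_exp_0)
  then show ?thesis
    by (simp add: poly_altdef exp_minus sum_distrib_right divide_inverse mult.assoc)
qed

lemma flat_has_derivative: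
  "(flat P has_real_derivative flat (pCons 0 (pCons 0 (P - pderiv P))) x) (at x)"
proof -
  let ?Q = "pCons 0 (pCons 0 (P - pderiv P))"
  consider "x > 0" | "x < 0" | "x = 0" by linarith
  then show ?thesis
  proof cases
    case 1
    have "((\<lambda>t. poly P (1/t) * exp (-1/t)) has_real_derivative flat ?Q x) (at x)"
      using 1 by (auto intro!: derivative_eq_intros DERIV_chain2[OF poly_DERIV] simp: flat_def field_simps power2_eq_square)
    then show ?thesis
      by (rule DERIV_cong_ev[THEN iffD1, rotated 3, OF _ ]) (use 1 in \<open>auto simp: flat_def eventually_nhds intro!: exI[of _ "{0<..}"]\<close>)
  next
    case 2
    have "((\<lambda>t. 0) has_real_derivative flat ?Q x) (at x)" using 2 by (simp add: flat_def)
    then show ?thesis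
      by (rule DERIV_cong_ev[THEN iffD1, rotated 3, OF _ ]) (use 2 in \<open>auto simp: flat_def eventually_nhds intro!: exI[of _ "{..<0}"]\<close>)
  next
    case 3
    have "((\<lambda>h. flat P h / h) \<longlongrightarrow> 0) (at 0)"
    proof (rule filterlim_split_at)
      have "eventually (\<lambda>h::real. flat P h / h = 0) (at_left 0)"
        using eventually_at_left_real[of "-1" 0] by (auto simp: flat_def elim!: eventually_mono)
      then show "((\<lambda>h. flat P h / h) \<longlongrightarrow> 0) (at_left 0)" by (rule tendsto_eventually)
      \<comment> \<open>Substituting h = 1/s turns the difference quotient at 0 into s P(s) exp(-s),
        which tends to 0 at infinity; \<open>pCons 0\<close> is the extra factor s.\<close>
      have "eventually (\<lambda>s::real. poly (pCons 0 P) s * exp (-s) = flat P (inverse s) / inverse s) at_top"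
        using eventually_gt_at_top[of 0] by eventually_elim (auto simp: flat_def field_simps)
      then show "((\<lambda>h. flat P h / h) \<longlongrightarrow> 0) (at_right 0)"
        unfolding filterlim_at_right_to_top
        by (rule Lim_transform_eventually[OF poly_exp_tendsto_0])
    qed
    then show ?thesis using 3 by (simp add: has_field_derivative_iff flat_def)
  qed
qed

lemma smooth_on_flat:
  assumes "smooth_on q UNIV" shows "smooth_on (\<lambda>x. flat P (q x)) UNIV"
proof -
  define F where "F k = flat (((\<lambda>P. pCons 0 (pCons 0 (P - pderiv P))) ^^ k) P)" for k
  have "(F k has_real_derivative F (Suc k) x) (at x)" for k x
    unfolding F_def by (simp del: funpow.simps add: funpow.simps(2) flat_has_derivative)
  from Ck_on_compose_real[where F=F and j=0, OF this assms] show ?thesis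
    by (simp add: smooth_on_def F_def)
qed

section \<open>Test functions and their supports\<close>

lemma test_fnI:
  assumes "smooth_on f UNIV" "compact K" "K \<subseteq> U" "\<And>x. x \<notin> K \<Longrightarrow> f x = 0"
  shows "test_fn f U"
proof -
  have "closure {x. f x \<noteq> 0} \<subseteq> K"
    using assms by (intro closure_minimal) (auto intro: compact_imp_closed)
  moreover from this have "compact (closure {x. f x \<noteq> 0})"
    using compact_Int_closed[OF assms(2) closed_closure] by (metis Int_absorb1)
  ultimately show ?thesis unfolding test_fn_def using assms(1,3) by auto
qed

lemma test_fn_smooth: "test_fn f U \<Longrightarrow> smooth_on f UNIV"
  by (simp add: test_fn_def)

lemma test_fn_support:
  assumes "test_fn f U" shows "\<exists>K. compact K \<and> K \<subseteq> U \<and> (\<forall>x. x \<notin> K \<longrightarrow> f x = 0)"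
proof (intro exI conjI allI impI)
  show "f x = 0" if "x \<notin> closure {x. f x \<noteq> 0}" for x
    using that closure_subset[of "{x. f x \<noteq> 0}"] by auto
qed (use assms in \<open>auto simp: test_fn_def\<close>)

lemma test_fn_mult:
  assumes "test_fn f U" "smooth_on g UNIV" shows "test_fn (\<lambda>x. f x * g x) U"
proof -
  obtain K where "compact K" "K \<subseteq> U" "\<And>x. x \<notin> K \<Longrightarrow> f x = 0" using test_fn_support[OF assms(1)] by blast
  then have "f x * g x = 0" if "x \<notin> K" for x using that by simp
  then show ?thesis using \<open>compact K\<close> \<open>K \<subseteq> U\<close>
    by (intro test_fnI[where K=K] smooth_on_mult test_fn_smooth[OF assms(1)] assms(2))
qed

lemma partial_eq_0_outside:
  assumes "closed K" "\<And>x. x \<notin> K \<Longrightarrow> f x = 0" "x \<notin> K" shows "partial i f x = 0"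
proof -
  have "((\<lambda>x. 0) has_derivative (\<lambda>h. 0)) (at x)" by simp
  then have "(f has_derivative (\<lambda>h. 0)) (at x)"
    by (rule has_derivative_transform_within_open[of _ _ _ _ "- K"]) (use assms in auto)
  then show ?thesis using partial_eqI by blast
qed

lemma test_fn_partial:
  assumes "test_fn f U" shows "test_fn (partial i f) U"
proof -
  obtain K where K: "compact K" "K \<subseteq> U" "\<And>x. x \<notin> K \<Longrightarrow> f x = 0"
    using test_fn_support[OF assms] by blast
  show ?thesis
    using partial_eq_0_outside[OF compact_imp_closed[OF K(1)] K(3)]
    by (intro test_fnI[OF _ K(1,2)] smooth_on_partial test_fn_smooth[OF assms])
qed

lemma test_fn_affine:
  assumes f: "test_fn f UNIV" and c: "c \<noteq> 0"
  shows "test_fn (\<lambda>y. f (x + c *\<^sub>R y)) UNIV"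
proof -
  obtain K where K: "compact K" "\<And>x. x \<notin> K \<Longrightarrow> f x = 0"
    using test_fn_support[OF f] by blast
  have "compact ((\<lambda>z. (1/c) *\<^sub>R (z - x)) ` K)"
    by (intro compact_continuous_image K continuous_intros)
  moreover have "f (x + c *\<^sub>R y) = 0" if "y \<notin> (\<lambda>z. (1/c) *\<^sub>R (z - x)) ` K" for y
  proof (rule K(2), rule notI)
    assume "x + c *\<^sub>R y \<in> K"
    then have "(1/c) *\<^sub>R (x + c *\<^sub>R y - x) \<in> (\<lambda>z. (1/c) *\<^sub>R (z - x)) ` K" by blast
    then show False using that c by simp
  qed
  ultimately show ?thesis
    by (intro test_fnI[of _ "(\<lambda>z. (1/c) *\<^sub>R (z - x)) ` K"] smooth_on_affine test_fn_smooth[OF f]) auto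
qed

lemma compact_support_bounded:
  fixes f :: "'a::euclidean_space \<Rightarrow> real"
  assumes "continuous_on UNIV f" "compact K" "\<And>x. x \<notin> K \<Longrightarrow> f x = 0"
  obtains B where "B > 0" "\<And>x. \<bar>f x\<bar> \<le> B"
proof -
  have "compact (f ` K)" using assms by (metis compact_continuous_image continuous_on_subset subset_UNIV)
  then obtain B where B: "B > 0" "\<forall>y\<in>f ` K. norm y \<le> B"
    using compact_imp_bounded bounded_pos by blast
  have "\<bar>f x\<bar> \<le> B" for x using B assms(3)[of x] by (cases "x \<in> K") auto
  then show ?thesis using that[of B] B(1) by blast
qed

lemma compact_support_integrable:
  fixes f :: "'a::euclidean_space \<Rightarrow> real"
  assumes "continuous_on UNIV f" "compact K" "\<And>x. x \<notin> K \<Longrightarrow> f x = 0"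
  shows "integrable lborel f"
proof -
  have "integrable lborel (\<lambda>x. indicator K x *\<^sub>R f x)"
    using borel_integrable_compact[OF assms(2), of f] assms(1) continuous_on_subset by (auto simp: set_integrable_def)
  moreover have "(\<lambda>x. indicator K x *\<^sub>R f x) = f" using assms(3) by (intro ext) (auto simp: indicator_def)
  ultimately show ?thesis by simp
qed

lemma test_fn_bounded:
  assumes "test_fn f U" obtains B where "B > 0" "\<And>x. \<bar>f x\<bar> \<le> B"
proof -
  obtain K where K: "compact K" "\<And>x. x \<notin> K \<Longrightarrow> f x = 0" using test_fn_support[OF assms] by blast
  show ?thesis by (rule compact_support_bounded[OF smooth_on_continuous[OF test_fn_smooth[OF assms]] K that])
qed

lemma test_fn_integrable:
  assumes "test_fn f U" shows "integrable lborel f"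
proof -
  obtain K where K: "compact K" "\<And>x. x \<notin> K \<Longrightarrow> f x = 0" using test_fn_support[OF assms] by blast
  show ?thesis by (rule compact_support_integrable[OF smooth_on_continuous[OF test_fn_smooth[OF assms]] K])
qed

text \<open>\<open>flat 1\<close> composed with eps^2 - |x|^2 is a smooth bump that is positive
  exactly on the open ball of radius eps; it is then divided by its integral.\<close>

lemma exists_mollifier:
  fixes \<epsilon> :: real assumes "\<epsilon> > 0"
  obtains \<eta> :: "real^'n \<Rightarrow> real" where "test_fn \<eta> UNIV" "\<And>x. \<eta> x \<ge> 0"
    "\<And>x. norm x > \<epsilon> \<Longrightarrow> \<eta> x = 0" "(\<integral>x. \<eta> x \<partial>lborel) = 1"
proof -
  \<comment> \<open>Squares are written as products under a sum so that the closure rules for smooth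
    functions apply; \<open>sq\<close> identifies the expression afterwards.\<close>
  define b :: "real^'n \<Rightarrow> real" where "b x = flat 1 (\<epsilon>\<^sup>2 + (\<Sum>i\<in>UNIV. (- 1) * (x $ i * x $ i)))" for x
  have sq: "(\<Sum>i\<in>UNIV. (- 1) * (x $ i * x $ i)) = - (norm x)\<^sup>2" for x :: "real^'n"
    by (simp add: power2_norm_eq_inner inner_vec_def sum_negf)
  have b: "smooth_on b UNIV" unfolding b_def
    by (intro smooth_on_flat smooth_on_add smooth_on_const smooth_on_sum smooth_on_mult smooth_on_component)
  have pos: "b x > 0 \<longleftrightarrow> norm x < \<epsilon>" for x
  proof -
    have "(norm x)\<^sup>2 < \<epsilon>\<^sup>2 \<longleftrightarrow> norm x < \<epsilon>"
      using assms power_strict_mono[of "norm x" \<epsilon> 2] power2_less_imp_less[of "norm x" \<epsilon>] by auto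
    then show ?thesis unfolding b_def sq flat_def by auto
  qed
  have nn: "b x \<ge> 0" for x unfolding b_def flat_def by auto
  have z: "x \<notin> cball 0 \<epsilon> \<Longrightarrow> b x = 0" for x using pos[of x] nn[of x] by simp
  have tb: "test_fn b UNIV" by (rule test_fnI[where K="cball 0 \<epsilon>"]) (use b z in auto)
  have ib: "integrable lborel b" by (rule test_fn_integrable[OF tb])
  \<comment> \<open>A vanishing integral would make b zero a.e. and hence the ball on which b is
    positive a null set.\<close>
  have "(\<integral>x. b x \<partial>lborel) \<noteq> 0"
  proof
    assume "(\<integral>x. b x \<partial>lborel) = 0"
    then have "AE x in lborel. b x = 0" using integral_nonneg_eq_0_iff_AE[OF ib] nn by auto
    then have "AE x in lborel. x \<notin> ball (0::real^'n) \<epsilon>" 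
      by (rule AE_mp) (use pos in force)
    then have "emeasure lborel (ball (0::real^'n) \<epsilon>) = 0"
      by (subst (asm) AE_iff_measurable[OF _ refl]) (auto simp: ball_def)
    then show False using assms content_ball_pos[of \<epsilon> "0::real^'n"] by (simp add: measure_def)
  qed
  moreover have "(\<integral>x. b x \<partial>lborel) \<ge> 0" using nn by simp
  ultimately have I: "(\<integral>x. b x \<partial>lborel) > 0" by linarith
  show ?thesis
  proof (rule that[of "\<lambda>x. b x * (1 / (\<integral>x. b x \<partial>lborel))"])
    show "test_fn (\<lambda>x. b x * (1 / (\<integral>x. b x \<partial>lborel))) UNIV"
      by (intro test_fn_mult[OF tb] smooth_on_const)
  qed (use nn z I in auto)
qed

section \<open>Lebesgue measure under translation and reflection\<close>

lemma lborel_integral_shift: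
  fixes f :: "'a::euclidean_space \<Rightarrow> 'b::{banach, second_countable_topology}"
  shows "(\<integral>x. f (c + x) \<partial>lborel) = (\<integral>x. f x \<partial>lborel)"
    and "integrable lborel (\<lambda>x. f (c + x)) \<longleftrightarrow> integrable lborel f"
proof -
  have d: "distr lborel lborel ((+) c) = lborel"
    using lborel_distr_plus[of c] by (metis distr_cong sets_lborel)
  have m: "(+) c \<in> lborel \<rightarrow>\<^sub>M lborel" by simp
  have imp: "integrable lborel (\<lambda>x. f (c + x))" if "integrable lborel f" for c :: 'a and f :: "'a \<Rightarrow> 'b"
  proof -
    have d: "distr lborel lborel ((+) c) = lborel"
      using lborel_distr_plus[of c] by (metis distr_cong sets_lborel)
    show ?thesis using integrable_distr[of "(+) c" lborel lborel f] that d by simp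
  qed
  \<comment> \<open>The converse direction translates the translated function back by -c, which
    works for an arbitrary f.\<close>
  then show i: "integrable lborel (\<lambda>x. f (c + x)) \<longleftrightarrow> integrable lborel f"
    using imp[of "\<lambda>x. f (c + x)" "-c"] by (auto simp: add.assoc[symmetric])
  show "(\<integral>x. f (c + x) \<partial>lborel) = (\<integral>x. f x \<partial>lborel)"
  proof (cases "integrable lborel f")
    case True
    then have "f \<in> borel_measurable lborel" by simp
    from integral_distr[OF m this] show ?thesis using d by simp
  next
    \<comment> \<open>Integrability fails for both functions together, and then both integrals take
      the default value 0.\<close>
    case False
    then show ?thesis using i not_integrable_integral_eq by metis
  qed
qed

lemma lborel_integral_reflect:
  fixes f :: "'a::euclidean_space \<Rightarrow> 'b::{banach, second_countable_topology}"
  assumes "f \<in> borel_measurable lborel"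
  shows "(\<integral>x. f (c - x) \<partial>lborel) = (\<integral>x. f x \<partial>lborel)"
    and "integrable lborel (\<lambda>x. f (c - x)) \<longleftrightarrow> integrable lborel f"
proof -
  have "lborel = density (distr lborel borel (\<lambda>x::'a. c + (-1) *\<^sub>R x)) (\<lambda>_. 1)"
    using lborel_affine[of "-1::real" c] by simp
  then have "distr lborel borel (\<lambda>x::'a. c - x) = lborel" by (simp add: density_1)
  then have d: "distr lborel lborel (\<lambda>x::'a. c - x) = lborel" by (metis distr_cong sets_lborel)
  have m: "(\<lambda>x. c - x) \<in> lborel \<rightarrow>\<^sub>M lborel" by simp
  show "(\<integral>x. f (c - x) \<partial>lborel) = (\<integral>x. f x \<partial>lborel)"
    using integral_distr[OF m assms] d by simp
  show "integrable lborel (\<lambda>x. f (c - x)) \<longleftrightarrow> integrable lborel f"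
    using integrable_distr_eq[OF m assms] d by simp
qed

lemma lborel_AE_shift:
  fixes c :: "'a::euclidean_space"
  assumes "AE x in lborel. P x" shows "AE x in lborel. P (c + x)"
proof -
  have d: "distr lborel lborel ((+) c) = lborel"
    using lborel_distr_plus[of c] by (metis distr_cong sets_lborel)
  have m: "(+) c \<in> lborel \<rightarrow>\<^sub>M lborel" by simp
  show ?thesis by (rule AE_distrD[OF m]) (unfold d, rule assms)
qed

text \<open>Bounding the derivative by the sum over its coordinates costs the factor
  \<open>CARD('n)\<close>. What matters later is the linear dependence on B and on the
  distance.\<close>

lemma smooth_mvt_bound:
  fixes f :: "real^'n \<Rightarrow> real"
  assumes f: "\<And>x. f differentiable at x" and B: "\<And>z i. z \<in> closed_segment x y \<Longrightarrow> \<bar>partial i f z\<bar> \<le> B"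
  shows "\<bar>f y - f x\<bar> \<le> B * CARD('n) * norm (y - x)"
proof -
  have "norm (f (x + (y - x)) - f x) \<le> norm (y - x) * (B * CARD('n))"
  proof (rule differentiable_bound_segment[where G=UNIV and f'="\<lambda>z k. \<Sum>i\<in>UNIV. partial i f z * k $ i"])
    fix t :: real assume "t \<in> {0..1}"
    then have z: "x + t *\<^sub>R (y - x) \<in> closed_segment x y"
      by (auto simp: in_segment algebra_simps)
    show "onorm (\<lambda>k. \<Sum>i\<in>UNIV. partial i f (x + t *\<^sub>R (y - x)) * k $ i) \<le> B * real CARD('n)"
    proof (rule onorm_le)
      fix k :: "real^'n"
      have "norm (\<Sum>i\<in>UNIV. partial i f (x + t *\<^sub>R (y - x)) * k $ i) \<le> (\<Sum>i\<in>(UNIV::'n set). B * norm k)"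
        using B[OF z] by (intro sum_norm_le) (auto simp: abs_mult component_le_norm_cart intro!: mult_mono order_trans[OF abs_ge_zero B[OF z]])
      then show "norm (\<Sum>i\<in>UNIV. partial i f (x + t *\<^sub>R (y - x)) * k $ i) \<le> B * real CARD('n) * norm k"
        by (simp add: mult_ac)
    qed
  qed (use has_derivative_partial[OF f] in auto)
  then show ?thesis by (simp add: mult_ac)
qed

lemma partial_diffquot_tendsto:
  assumes "f differentiable at x"
  shows "((\<lambda>t. (f (x + t *\<^sub>R axis i 1) - f x) / t) \<longlongrightarrow> partial i f x) (at 0)"
proof -
  let ?D = "frechet_derivative f (at x)"
  have D: "(f has_derivative ?D) (at (x + 0 *\<^sub>R axis i 1))"
    using assms frechet_derivative_works by auto
  have "((\<lambda>t. x + t *\<^sub>R axis i 1) has_derivative (\<lambda>t. t *\<^sub>R axis i (1::real))) (at 0)"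
    by (auto intro!: derivative_eq_intros)
  from has_derivative_compose[OF this D]
  have "((\<lambda>t. f (x + t *\<^sub>R axis i 1)) has_derivative (\<lambda>t. ?D (t *\<^sub>R axis i 1))) (at 0)" .
  moreover have "(\<lambda>t. ?D (t *\<^sub>R axis i 1)) = (\<lambda>t. partial i f x * t)"
    using has_derivative_linear[OF D] by (auto simp: linear_scale partial_def)
  ultimately have "((\<lambda>t. f (x + t *\<^sub>R axis i 1)) has_real_derivative partial i f x) (at 0)"
    by (simp add: has_field_derivative_def)
  then show ?thesis by (simp add: has_field_derivative_iff)
qed

text \<open>By translation invariance every difference quotient has integral 0; no Fubini is needed.\<close>

lemma integral_partial_test_fn:
  fixes f :: "real^'n \<Rightarrow> real"
  assumes f: "test_fn f UNIV" shows "(\<integral>x. partial i f x \<partial>lborel) = 0"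
proof -
  obtain K where K: "compact K" "\<And>x. x \<notin> K \<Longrightarrow> f x = 0"
    using test_fn_support[OF f] by blast
  have df: "f differentiable at x" for x by (rule smooth_on_differentiable[OF test_fn_smooth[OF f]])
  have "\<exists>B>0. \<forall>x. \<bar>partial j f x\<bar> \<le> B" for j by (rule test_fn_bounded[OF test_fn_partial[OF f]]) blast
  then obtain B where B: "\<And>j. B j > 0" "\<And>j x. \<bar>partial j f x\<bar> \<le> B j" by metis
  define C where "C = Max (range B)"
  have C: "\<bar>partial j f x\<bar> \<le> C" for j x
    unfolding C_def by (rule order_trans[OF B(2) Max_ge]) auto
  obtain R where R: "\<And>x. x \<in> K \<Longrightarrow> norm x \<le> R" using compact_imp_bounded[OF K(1)] unfolding bounded_iff by blast
  define t :: "nat \<Rightarrow> real" where "t n = 1 / Suc n" for n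
  have t0: "t n \<noteq> 0" "\<bar>t n\<bar> \<le> 1" for n by (auto simp: t_def)
  have tt: "filterlim t (at 0) sequentially"
    using LIMSEQ_inverse_real_of_nat unfolding filterlim_at t_def by (simp add: inverse_eq_divide)
  define s where "s n x = (f (x + t n *\<^sub>R axis i 1) - f x) / t n" for n x
  have cf: "continuous_on UNIV f" by (rule smooth_on_continuous[OF test_fn_smooth[OF f]])
  have mf[measurable]: "f \<in> borel_measurable borel" using cf by (rule borel_measurable_continuous_onI)
  have sl: "(\<lambda>n. s n x) \<longlonglongrightarrow> partial i f x" for x
    unfolding s_def by (rule filterlim_compose[OF partial_diffquot_tendsto[OF df] tt])
  have "(\<lambda>n. \<integral>x. s n x \<partial>lborel) \<longlonglongrightarrow> (\<integral>x. partial i f x \<partial>lborel)"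
  \<comment> \<open>The increments satisfy |t n| <= 1, so all difference quotients vanish outside
    the ball of radius R + 1; inside it the mean value bound provides a constant majorant.\<close>
  proof (rule integral_dominated_convergence[where w = "\<lambda>x. indicator (cball 0 (R + 1)) x *\<^sub>R (C * CARD('n))"])
    show "partial i f \<in> borel_measurable lborel" using test_fn_integrable[OF test_fn_partial[OF f]] by auto
    show "s n \<in> borel_measurable lborel" for n unfolding s_def by measurable
    show "integrable lborel (\<lambda>x::real^'n. indicator (cball 0 (R + 1)) x *\<^sub>R (C * CARD('n)))"
      by (intro integrable_scaleR_left) (use emeasure_bounded_finite[OF bounded_cball] in \<open>auto simp: integrable_indicator_iff\<close>)
    show "AE x in lborel. (\<lambda>n. s n x) \<longlonglongrightarrow> partial i f x" using sl by simp
    have "norm (s n x) \<le> indicator (cball 0 (R + 1)) x *\<^sub>R (C * CARD('n))" for n x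
    proof (cases "x \<in> cball 0 (R+1)")
      case True
      have "\<bar>f (x + t n *\<^sub>R axis i 1) - f x\<bar> \<le> C * CARD('n) * norm ((x + t n *\<^sub>R axis i 1) - x)"
        by (rule smooth_mvt_bound[OF df C])
      then show ?thesis using True t0[of n] by (simp add: s_def divide_le_eq abs_mult)
    next
      case False
      have "norm x \<le> norm (x + t n *\<^sub>R axis i 1) + norm (t n *\<^sub>R axis i (1::real) :: real^'n)"
        by (metis add_diff_cancel_right' norm_triangle_ineq4)
      then have "norm (x + t n *\<^sub>R axis i 1) > R" using False t0(2)[of n] by auto
      moreover have "norm x > R" using False by auto
      ultimately have "x \<notin> K" "x + t n *\<^sub>R axis i 1 \<notin> K" using R by force+
      then show ?thesis using False K(2) by (simp add: s_def)
    qed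
    then show "AE x in lborel. norm (s n x) \<le> indicator (cball 0 (R + 1)) x *\<^sub>R (C * CARD('n))" for n by simp
  qed
  moreover have "(\<integral>x. s n x \<partial>lborel) = 0" for n
  proof -
    have i: "integrable lborel f" by (rule test_fn_integrable[OF f])
    then have "integrable lborel (\<lambda>x. f (t n *\<^sub>R axis i 1 + x))" by (simp add: lborel_integral_shift(2))
    then show ?thesis using i lborel_integral_shift(1)[of f "t n *\<^sub>R axis i 1"]
      by (simp add: s_def add.commute)
  qed
  ultimately show ?thesis by (simp add: LIMSEQ_const_iff)
qed

section \<open>Square integrable functions\<close>

definition L2 :: "('a::euclidean_space \<Rightarrow> 'b::euclidean_space) \<Rightarrow> bool" where
  "L2 f \<longleftrightarrow> f \<in> borel_measurable lborel \<and> integrable lborel (\<lambda>x. (norm (f x))\<^sup>2)"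

text \<open>The square of the L2 norm. Without square roots, estimates combine by linear arithmetic,
  with |a + b|^2 <= 2|a|^2 + 2|b|^2 in place of the triangle inequality; most powers of 2 in later
  constants originate here.\<close>

definition En :: "('a::euclidean_space \<Rightarrow> 'b::euclidean_space) \<Rightarrow> real" where
  "En f = (\<integral>x. (norm (f x))\<^sup>2 \<partial>lborel)"

lemma L2_measurable[measurable_dest]: "L2 f \<Longrightarrow> f \<in> borel_measurable borel"
  by (simp add: L2_def)

lemma En_nonneg: "En f \<ge> 0"
  by (simp add: En_def)

lemma nn_integral_En: "L2 f \<Longrightarrow> (\<integral>\<^sup>+x. ennreal ((norm (f x))\<^sup>2) \<partial>lborel) = ennreal (En f)"
  unfolding L2_def En_def by (intro nn_integral_eq_integral) auto

text \<open>Tonelli and Fatou deliver bounds on nonnegative integrals; such a bound is converted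
  here into square integrability and a real inequality at once.\<close>

lemma L2_nnI:
  assumes "f \<in> borel_measurable lborel" "(\<integral>\<^sup>+x. ennreal ((norm (f x))\<^sup>2) \<partial>lborel) \<le> ennreal C" "C \<ge> 0"
  shows "L2 f" "En f \<le> C"
proof -
  have "integrable lborel (\<lambda>x. (norm (f x))\<^sup>2)"
  proof (rule integrableI_bounded)
    show "(\<lambda>x. (norm (f x))\<^sup>2) \<in> borel_measurable lborel" using assms(1) by measurable
    show "(\<integral>\<^sup>+ x. ennreal (norm ((norm (f x))\<^sup>2)) \<partial>lborel) < \<infinity>"
      using assms(2) by (simp add: order_le_less_trans[OF _ ennreal_less_top])
  qed
  then show l: "L2 f" using assms by (simp add: L2_def)
  show "En f \<le> C" using nn_integral_En[OF l] assms by simp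
qed

lemma norm_parallelogram:
  "(norm (a + b))\<^sup>2 + (norm (a - b))\<^sup>2 = 2 * (norm a)\<^sup>2 + 2 * (norm (b::'b::real_inner))\<^sup>2"
  by (simp add: power2_norm_eq_inner inner_add inner_diff inner_commute)

lemma norm_add_sq_le: "(norm (a + b))\<^sup>2 \<le> 2 * (norm a)\<^sup>2 + 2 * (norm (b::'b::real_inner))\<^sup>2"
  using norm_parallelogram[of a b] zero_le_power2[of "norm (a - b)"] by linarith

lemma L2_add: assumes "L2 f" "L2 g" shows "L2 (\<lambda>x. f x + g x)"
  unfolding L2_def
proof
  show "(\<lambda>x. f x + g x) \<in> borel_measurable lborel" using assms by (auto simp: L2_def)
  have i: "integrable lborel (\<lambda>x. 2 * (norm (f x))\<^sup>2 + 2 * (norm (g x))\<^sup>2)"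
    using assms by (auto simp: L2_def)
  show "integrable lborel (\<lambda>x. (norm (f x + g x))\<^sup>2)"
    by (rule Bochner_Integration.integrable_bound[OF i])
       (use assms norm_add_sq_le in \<open>auto simp: L2_def\<close>)
qed

lemma L2_scaleR: "L2 f \<Longrightarrow> L2 (\<lambda>x. c *\<^sub>R f x)"
  by (auto simp: L2_def power_mult_distrib)

lemma L2_cmult: "L2 f \<Longrightarrow> L2 (\<lambda>x. c * f x :: real)"
  using L2_scaleR[of f c] by simp

lemma L2_diff: assumes "L2 f" "L2 g" shows "L2 (\<lambda>x. f x - g x)"
  using L2_add[OF assms(1) L2_scaleR[OF assms(2), of "-1"]] by simp

lemma En_scaleR: "En (\<lambda>x. c *\<^sub>R f x) = c\<^sup>2 * En f"
  by (simp add: En_def power_mult_distrib)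

lemma En_cmult: "En (\<lambda>x. c * f x :: real) = c\<^sup>2 * En f"
  using En_scaleR[of c f] by simp

lemma En_minus_commute: "En (\<lambda>x. f x - g x) = En (\<lambda>x. g x - f x)"
  by (simp add: En_def norm_minus_commute)

lemma En_parallelogram:
  assumes "L2 f" "L2 g"
  shows "En (\<lambda>x. f x + g x) + En (\<lambda>x. f x - g x) = 2 * En f + 2 * En g"
proof -
  have "integrable lborel (\<lambda>x. (norm (f x + g x))\<^sup>2)" "integrable lborel (\<lambda>x. (norm (f x - g x))\<^sup>2)"
    using L2_add[OF assms] L2_diff[OF assms] by (auto simp: L2_def)
  then have "En (\<lambda>x. f x + g x) + En (\<lambda>x. f x - g x)
     = (\<integral>x. (norm (f x + g x))\<^sup>2 + (norm (f x - g x))\<^sup>2 \<partial>lborel)"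
    by (simp add: En_def)
  also have "\<dots> = (\<integral>x. 2 * (norm (f x))\<^sup>2 + 2 * (norm (g x))\<^sup>2 \<partial>lborel)"
    by (simp add: norm_parallelogram)
  also have "\<dots> = 2 * En f + 2 * En g"
    using assms by (simp add: En_def L2_def)
  finally show ?thesis .
qed

lemma En_add_le: "L2 f \<Longrightarrow> L2 g \<Longrightarrow> En (\<lambda>x. f x + g x) \<le> 2 * En f + 2 * En g"
  using En_parallelogram[of f g] En_nonneg[of "\<lambda>x. f x - g x"] by simp

lemma En_diff_le: "L2 f \<Longrightarrow> L2 g \<Longrightarrow> En (\<lambda>x. f x - g x) \<le> 2 * En f + 2 * En g"
  using En_parallelogram[of f g] En_nonneg[of "\<lambda>x. f x + g x"] by simp

lemma En_triangle:
  "L2 f \<Longrightarrow> L2 g \<Longrightarrow> L2 h \<Longrightarrow> En (\<lambda>x. f x - h x) \<le> 2 * En (\<lambda>x. f x - g x) + 2 * En (\<lambda>x. g x - h x)"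
  using En_add_le[OF L2_diff[of f g] L2_diff[of g h]] by simp

text \<open>The factor 1/4 from halving exactly cancels the factors 2 of the parallelogram bound, so
  L2 balls are closed under midpoints without loss of radius. This is how L2 convergence survives
  the passage to iterated midpoints of tails.\<close>

lemma En_midpoint_diff_le:
  assumes "L2 f" "L2 g" "L2 h" "En (\<lambda>x. f x - h x) \<le> C" "En (\<lambda>x. g x - h x) \<le> C"
  shows "En (\<lambda>x. (1/2) *\<^sub>R f x + (1/2) *\<^sub>R g x - h x) \<le> C"
proof -
  have "(\<lambda>x. (1/2) *\<^sub>R f x + (1/2) *\<^sub>R g x - h x) = (\<lambda>x. (1/2) *\<^sub>R ((f x - h x) + (g x - h x)))"
    by (auto simp: algebra_simps fun_eq_iff simp flip: scaleR_add_left)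
  then show ?thesis
    using En_add_le[OF L2_diff[OF assms(1,3)] L2_diff[OF assms(2,3)]] assms(4,5)
    by (simp only: En_scaleR) (simp add: power2_eq_square)
qed

lemma En_eq_0_AE: assumes "L2 f" "En f = 0" shows "AE x in lborel. f x = 0"
  using assms integral_nonneg_eq_0_iff_AE[of lborel "\<lambda>x. (norm (f x))\<^sup>2"]
  by (auto simp: L2_def En_def)

lemma En_cong_AE:
  assumes "AE x in lborel. f x = g x" "f \<in> borel_measurable lborel" "g \<in> borel_measurable lborel"
  shows "En f = En g"
  unfolding En_def by (rule integral_cong_AE) (use assms in auto)

lemma L2_cong_AE:
  assumes "AE x in lborel. f x = g x" "g \<in> borel_measurable lborel" "L2 f"
  shows "L2 g"
proof -
  have "integrable lborel (\<lambda>x. (norm (f x))\<^sup>2) \<longleftrightarrow> integrable lborel (\<lambda>x. (norm (g x))\<^sup>2)"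
    by (rule integrable_cong_AE) (use assms in \<open>auto simp: L2_def\<close>)
  then show ?thesis using assms by (auto simp: L2_def)
qed

lemma L2_shift: assumes "L2 f" shows "L2 (\<lambda>x. f (c + x))"
proof -
  have "(\<lambda>x. f (c + x)) \<in> borel_measurable lborel" using L2_measurable[OF assms] by simp
  then show ?thesis using assms lborel_integral_shift(2)[of "\<lambda>x. (norm (f x))\<^sup>2" c] by (simp add: L2_def)
qed

lemma En_shift: "En (\<lambda>x. f (c + x)) = En f"
  unfolding En_def by (rule lborel_integral_shift(1))

section \<open>The L2 pairing\<close>

lemma L2_mult_integrable:
  fixes f g :: "'a::euclidean_space \<Rightarrow> real"
  assumes "L2 f" "L2 g" shows "integrable lborel (\<lambda>x. f x * g x)"
proof -
  have i: "integrable lborel (\<lambda>x. (norm (f x))\<^sup>2 + (norm (g x))\<^sup>2)" using assms by (auto simp: L2_def)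
  have b: "\<bar>a * b\<bar> \<le> a\<^sup>2 + b\<^sup>2" for a b :: real
    by (rule abs_leI) (sos+)
  show ?thesis
    by (rule Bochner_Integration.integrable_bound[OF i]) (use assms b in \<open>auto simp: L2_def\<close>)
qed

lemma L2_Cauchy_Schwarz:
  fixes f g :: "'a::euclidean_space \<Rightarrow> real"
  assumes "L2 f" "L2 g" shows "(\<integral>x. f x * g x \<partial>lborel)\<^sup>2 \<le> En f * En g"
proof -
  let ?I = "\<integral>x. f x * g x \<partial>lborel"
  have i: "integrable lborel (\<lambda>x. f x * g x)" "integrable lborel (\<lambda>x. (f x)\<^sup>2)" "integrable lborel (\<lambda>x. (g x)\<^sup>2)"
    using assms L2_mult_integrable by (auto simp: L2_def)
  have q: "0 \<le> En f * s\<^sup>2 - 2 * s * ?I + En g" for s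
  proof -
    have "En (\<lambda>x. s * f x - g x) = (\<integral>x. s\<^sup>2 * (f x)\<^sup>2 - 2 * s * (f x * g x) + (g x)\<^sup>2 \<partial>lborel)"
      unfolding En_def by (rule Bochner_Integration.integral_cong) (auto simp: power2_diff power_mult_distrib)
    also have "\<dots> = s\<^sup>2 * En f - 2 * s * ?I + En g" using i by (simp add: En_def)
    finally show ?thesis using En_nonneg[of "\<lambda>x. s * f x - g x"] by (simp add: mult.commute)
  qed
  show ?thesis
  proof (cases "En f = 0")
    case True
    \<comment> \<open>The quadratic in s degenerates to an affine function that is nonnegative on
      the whole line, so its slope must vanish; otherwise the value of s inserted below would make
      it equal to -1.\<close>
    then have "0 \<le> En g - 2 * s * ?I" for s using q[of s] by simp
    then have le: "2 * s * ?I \<le> En g" for s by (simp add: mult.assoc)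
    have "?I = 0"
    proof (rule ccontr)
      assume "?I \<noteq> 0"
      then have "2 * ((En g + 1) / (2 * ?I)) * ?I = En g + 1" by simp
      then show False using le[of "(En g + 1) / (2 * ?I)"] by linarith
    qed
    then show ?thesis using True by simp
  next
    case False
    then have p: "En f > 0" using En_nonneg[of f] by simp
    \<comment> \<open>The value inserted for s is the minimiser of the quadratic.\<close>
    have "0 \<le> En f * (?I / En f)\<^sup>2 - 2 * (?I / En f) * ?I + En g" by (rule q)
    also have "\<dots> = En g - ?I\<^sup>2 / En f" using p by (simp add: power2_eq_square field_simps)
    finally show ?thesis using p by (simp add: field_simps)
  qed
qed

section \<open>Vector-valued L2 functions through their components\<close>

lemma L2_component: fixes g :: "'a::euclidean_space \<Rightarrow> real^'n" assumes "L2 g" shows "L2 (\<lambda>x. g x $ i)"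
  unfolding L2_def
proof
  have m[measurable]: "g \<in> borel_measurable borel" using assms by (rule L2_measurable)
  have c: "(\<lambda>v::real^'n. v $ i) \<in> borel_measurable borel"
    by (intro borel_measurable_continuous_onI continuous_intros)
  show ms: "(\<lambda>x. g x $ i) \<in> borel_measurable lborel"
    using measurable_compose[OF m c] by simp
  have i: "integrable lborel (\<lambda>x. (norm (g x))\<^sup>2)" using assms by (auto simp: L2_def)
  show "integrable lborel (\<lambda>x. (norm (g x $ i))\<^sup>2)"
    by (rule Bochner_Integration.integrable_bound[OF i])
       (use ms component_le_norm_cart in \<open>auto intro!: power_mono simp: abs_le_square_iff[symmetric]\<close>)
qed

lemma norm_vec_sq: "(norm (v::real^'n))\<^sup>2 = (\<Sum>i\<in>UNIV. (v $ i)\<^sup>2)"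
  unfolding power2_norm_eq_inner inner_vec_def by (simp add: power2_eq_square)

lemma vec_measurable:
  fixes g :: "'a \<Rightarrow> real^'n"
  assumes "\<And>i. (\<lambda>x. g x $ i) \<in> borel_measurable M" shows "g \<in> borel_measurable M"
proof (subst borel_measurable_euclidean_space, intro ballI)
  fix b :: "real^'n" assume "b \<in> Basis"
  then obtain i where "b = axis i 1" by (auto simp: Basis_vec_def)
  then show "(\<lambda>x. g x \<bullet> b) \<in> borel_measurable M" using assms by (simp add: inner_axis)
qed

lemma L2_vecI:
  fixes g :: "'a::euclidean_space \<Rightarrow> real^'n"
  assumes "\<And>i. L2 (\<lambda>x. g x $ i)" shows "L2 g"
  unfolding L2_def
proof
  show "g \<in> borel_measurable lborel" by (rule vec_measurable) (use assms in \<open>auto simp: L2_def\<close>)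
  show "integrable lborel (\<lambda>x. (norm (g x))\<^sup>2)"
    unfolding norm_vec_sq by (rule Bochner_Integration.integrable_sum) (use assms in \<open>auto simp: L2_def\<close>)
qed

lemma En_vec:
  fixes g :: "'a::euclidean_space \<Rightarrow> real^'n"
  assumes "L2 g" shows "En g = (\<Sum>i\<in>UNIV. En (\<lambda>x. g x $ i))"
  unfolding En_def norm_vec_sq using L2_component[OF assms]
  by (subst Bochner_Integration.integral_sum) (auto simp: L2_def)

lemma L2_bounded_mult:
  fixes f :: "'a::euclidean_space \<Rightarrow> real"
  assumes f: "f \<in> borel_measurable lborel" and B: "\<And>x. \<bar>f x\<bar> \<le> B" and g: "L2 g"
  shows "L2 (\<lambda>x. f x *\<^sub>R g x)" "En (\<lambda>x. f x *\<^sub>R g x) \<le> B\<^sup>2 * En g"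
proof -
  have m: "(\<lambda>x. f x *\<^sub>R g x) \<in> borel_measurable lborel" using f g by (auto simp: L2_def)
  have b: "(norm (f x *\<^sub>R g x))\<^sup>2 \<le> B\<^sup>2 * (norm (g x))\<^sup>2" for x
    using power_mono[OF B[of x], of 2] by (auto simp: power_mult_distrib intro!: mult_right_mono)
  have i: "integrable lborel (\<lambda>x. B\<^sup>2 * (norm (g x))\<^sup>2)" using g by (auto simp: L2_def)
  have i2: "integrable lborel (\<lambda>x. (norm (f x *\<^sub>R g x))\<^sup>2)"
    by (rule Bochner_Integration.integrable_bound[OF i]) (use m in measurable, use b in auto)
  then show "L2 (\<lambda>x. f x *\<^sub>R g x)" using m by (simp add: L2_def)
  have "En (\<lambda>x. f x *\<^sub>R g x) \<le> (\<integral>x. B\<^sup>2 * (norm (g x))\<^sup>2 \<partial>lborel)"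
    unfolding En_def by (rule integral_mono[OF i2 i b])
  then show "En (\<lambda>x. f x *\<^sub>R g x) \<le> B\<^sup>2 * En g" by (simp add: En_def)
qed

lemma compact_support_L2:
  fixes f :: "'a::euclidean_space \<Rightarrow> real"
  assumes "continuous_on UNIV f" "compact K" "\<And>x. x \<notin> K \<Longrightarrow> f x = 0" shows "L2 f"
proof -
  have "integrable lborel (\<lambda>x. (f x)\<^sup>2)"
    by (rule compact_support_integrable[OF _ assms(2)]) (use assms in \<open>auto intro!: continuous_intros\<close>)
  moreover have "f \<in> borel_measurable borel" using assms(1) by (rule borel_measurable_continuous_onI)
  ultimately show ?thesis by (simp add: L2_def)
qed

lemma test_fn_L2: assumes "test_fn f U" shows "L2 f"
proof -
  obtain K where K: "compact K" "\<And>x. x \<notin> K \<Longrightarrow> f x = 0" using test_fn_support[OF assms] by blast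
  show ?thesis by (rule compact_support_L2[OF smooth_on_continuous[OF test_fn_smooth[OF assms]] K])
qed

text \<open>Fatou's lemma applied to the squared norms. The bound is asked only from K onwards,
  since the lower limit ignores initial terms; square integrability of the limit is part of the
  conclusion.\<close>

lemma L2_fatou:
  fixes f :: "nat \<Rightarrow> 'a::euclidean_space \<Rightarrow> 'b::euclidean_space"
  assumes f: "\<And>k. L2 (f k)" and g: "g \<in> borel_measurable lborel"
    and lim: "AE x in lborel. (\<lambda>k. f k x) \<longlonglongrightarrow> g x"
    and C: "\<And>k. k \<ge> K \<Longrightarrow> En (f k) \<le> C"
  shows "L2 g" "En g \<le> C"
proof -
  have mf[measurable]: "f k \<in> borel_measurable borel" for k using f by (rule L2_measurable)
  have C0: "C \<ge> 0" using C[of K] En_nonneg[of "f K"] by simp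
  have "(\<integral>\<^sup>+x. ennreal ((norm (g x))\<^sup>2) \<partial>lborel) \<le> (\<integral>\<^sup>+x. liminf (\<lambda>k. ennreal ((norm (f k x))\<^sup>2)) \<partial>lborel)"
  proof (rule nn_integral_mono_AE, use lim in eventually_elim)
    fix x assume "(\<lambda>k. f k x) \<longlonglongrightarrow> g x"
    then have "(\<lambda>k. ennreal ((norm (f k x))\<^sup>2)) \<longlonglongrightarrow> ennreal ((norm (g x))\<^sup>2)"
      by (intro tendsto_intros)
    then show "ennreal ((norm (g x))\<^sup>2) \<le> liminf (\<lambda>k. ennreal ((norm (f k x))\<^sup>2))"
      by (subst lim_imp_Liminf[of sequentially]) auto
  qed
  also have "\<dots> \<le> liminf (\<lambda>k. \<integral>\<^sup>+x. ennreal ((norm (f k x))\<^sup>2) \<partial>lborel)"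
    by (rule nn_integral_liminf) measurable
  also have "\<dots> = liminf (\<lambda>k. ennreal (En (f k)))" using f by (simp add: nn_integral_En)
  also have "\<dots> \<le> limsup (\<lambda>k. ennreal (En (f k)))" by (rule Liminf_le_Limsup) simp
  also have "\<dots> \<le> ennreal C"
    by (rule Limsup_bounded) (auto simp: eventually_sequentially intro!: exI[of _ K] ennreal_leI C)
  finally show "L2 g" "En g \<le> C" using L2_nnI[OF g _ C0] by auto
qed

lemma L2_AE_subseq:
  fixes f :: "nat \<Rightarrow> 'a::euclidean_space \<Rightarrow> 'b::euclidean_space"
  assumes f: "\<And>k. L2 (f k)" and g: "L2 g" and lim: "(\<lambda>k. En (\<lambda>x. f k x - g x)) \<longlonglongrightarrow> 0"
  shows "\<exists>r::nat\<Rightarrow>nat. strict_mono r \<and> (AE x in lborel. (\<lambda>k. f (r k) x) \<longlonglongrightarrow> g x)"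
proof -
  have "\<exists>r::nat\<Rightarrow>nat. strict_mono r \<and> (AE x in lborel. (\<lambda>k. (norm (f (r k) x - g x))\<^sup>2) \<longlonglongrightarrow> 0)"
    by (rule tendsto_L1_AE_subseq[where u="\<lambda>k x. (norm (f k x - g x))\<^sup>2"])
       (use L2_diff[OF f g] lim in \<open>auto simp: L2_def En_def\<close>)
  then obtain r :: "nat \<Rightarrow> nat" where r: "strict_mono r"
    "AE x in lborel. (\<lambda>k. (norm (f (r k) x - g x))\<^sup>2) \<longlonglongrightarrow> 0" by blast
  from r(2) have "AE x in lborel. (\<lambda>k. f (r k) x) \<longlonglongrightarrow> g x"
  proof eventually_elim
    case (elim x)
    then have "(\<lambda>k. sqrt ((norm (f (r k) x - g x))\<^sup>2)) \<longlonglongrightarrow> sqrt 0" by (rule tendsto_real_sqrt)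
    then show ?case by (simp add: LIM_zero_iff tendsto_norm_zero_iff)
  qed
  then show ?thesis using r(1) by blast
qed

text \<open>Riesz-Fischer. The limit has to be built as an actual function, as the pointwise limit
  along a subsequence whose successive differences have energy below (1/4)^k.\<close>

lemma L2_complete:
  fixes f :: "nat \<Rightarrow> 'a::euclidean_space \<Rightarrow> 'b::euclidean_space"
  assumes f: "\<And>k. L2 (f k)"
    and C: "\<And>e. e > 0 \<Longrightarrow> \<exists>N. \<forall>m\<ge>N. \<forall>n\<ge>N. En (\<lambda>x. f m x - f n x) < e"
  obtains g where "L2 g" "(\<lambda>n. En (\<lambda>x. f n x - g x)) \<longlonglongrightarrow> 0"
proof -
  have "\<exists>N. \<forall>k. (\<forall>m\<ge>N k. \<forall>n\<ge>N k. En (\<lambda>x. f m x - f n x) < (1/4)^k) \<and> N k < N (Suc k)"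
  proof (rule dependent_nat_choice)
    show "\<exists>N. \<forall>m\<ge>N. \<forall>n\<ge>N. En (\<lambda>x. f m x - f n x) < (1/4)^0" using C[of 1] by simp
    fix N k
    obtain M where "\<forall>m\<ge>M. \<forall>n\<ge>M. En (\<lambda>x. f m x - f n x) < (1/4)^Suc k" using C[of "(1/4)^Suc k"] by auto
    then show "\<exists>M. (\<forall>m\<ge>M. \<forall>n\<ge>M. En (\<lambda>x. f m x - f n x) < (1/4)^Suc k) \<and> N < M"
      by (intro exI[of _ "max M (Suc N)"]) auto
  qed
  then obtain r where r: "\<And>k m n. m \<ge> r k \<Longrightarrow> n \<ge> r k \<Longrightarrow> En (\<lambda>x. f m x - f n x) < (1/4)^k"
    and rS: "\<And>k. r k < r (Suc k)" by blast
  have sm: "strict_mono r" using rS by (simp add: strict_mono_Suc_iff)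
  define h where "h k x = norm (f (r (Suc k)) x - f (r k) x)" for k x
  have mf[measurable]: "f k \<in> borel_measurable borel" for k using f by (rule L2_measurable)
  have mh[measurable]: "h k \<in> borel_measurable borel" for k unfolding h_def by measurable
  \<comment> \<open>The weight 2^k costs only half of the decay (1/4)^k: the weighted energies are
    still summable, and the weight is what yields summability of the differences themselves.\<close>
  have nn: "(\<integral>\<^sup>+x. ennreal (2^k * (h k x)\<^sup>2) \<partial>lborel) \<le> ennreal ((1/2)^k)" for k
  proof -
    have l: "L2 (\<lambda>x. f (r (Suc k)) x - f (r k) x)" by (intro L2_diff f)
    have "(\<integral>\<^sup>+x. ennreal (2^k * (h k x)\<^sup>2) \<partial>lborel) = ennreal (2^k) * (\<integral>\<^sup>+x. ennreal ((h k x)\<^sup>2) \<partial>lborel)"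
      by (subst nn_integral_cmult[symmetric]) (auto simp: ennreal_mult)
    also have "(\<integral>\<^sup>+x. ennreal ((h k x)\<^sup>2) \<partial>lborel) = ennreal (En (\<lambda>x. f (r (Suc k)) x - f (r k) x))"
      unfolding h_def by (rule nn_integral_En[OF l])
    also have "ennreal (2^k) * \<dots> \<le> ennreal (2^k) * ennreal ((1/4)^k)"
      using r[of k "r (Suc k)" "r k"] rS[of k] by (intro mult_left_mono ennreal_leI) auto
    also have "\<dots> = ennreal ((1/2)^k)"
      by (subst ennreal_mult[symmetric]) (auto simp flip: power_mult_distrib)
    finally show ?thesis .
  qed
  have "(\<integral>\<^sup>+x. (\<Sum>k. ennreal (2^k * (h k x)\<^sup>2)) \<partial>lborel) = (\<Sum>k. \<integral>\<^sup>+x. ennreal (2^k * (h k x)\<^sup>2) \<partial>lborel)"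
    by (rule nn_integral_suminf) auto
  also have "\<dots> \<le> (\<Sum>k. ennreal ((1/2)^k))" by (intro suminf_le nn) auto
  also have "\<dots> < \<infinity>" by (subst suminf_ennreal2) (auto intro: summable_geometric)
  finally have fin: "AE x in lborel. (\<Sum>k. ennreal (2^k * (h k x)\<^sup>2)) \<noteq> \<infinity>"
    by (intro nn_integral_noteq_infinite) auto
  define g where "g x = lim (\<lambda>k. f (r k) x)" for x
  have gm: "g \<in> borel_measurable lborel" unfolding g_def by (rule borel_measurable_lim_metric) simp
  have conv: "AE x in lborel. (\<lambda>k. f (r k) x) \<longlonglongrightarrow> g x"
    using fin
  proof eventually_elim
    case (elim x)
    then have s1: "summable (\<lambda>k. 2^k * (h k x)\<^sup>2)" by (intro summable_suminf_not_top) auto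
    have s2: "summable (\<lambda>k. (1/2)^k :: real)" by (rule summable_geometric) simp
    \<comment> \<open>Expanding 2^k (h - 2^(-k))^2 >= 0 bounds a first power by the weighted square
      plus a summable remainder, which gives absolute convergence of the telescoping series.\<close>
    have "h k x \<le> 2^k * (h k x)\<^sup>2 + (1/2)^k" for k
    proof -
      have "0 \<le> 2^k * (h k x - (1/2)^k)\<^sup>2" by simp
      also have "\<dots> = 2^k * (h k x)\<^sup>2 - 2 * h k x * (2^k * (1/2)^k) + (2^k * (1/2)^k) * (1/2)^k"
        by (simp add: power2_eq_square algebra_simps)
      also have "2^k * (1/2)^k = (1::real)" by (simp flip: power_mult_distrib)
      finally show ?thesis using norm_ge_zero[of "f (r (Suc k)) x - f (r k) x"]
        unfolding h_def by linarith
    qed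
    then have "summable (\<lambda>k. h k x)"
      by (intro summable_comparison_test'[OF summable_add[OF s1 s2]]) (auto simp: h_def)
    then have "summable (\<lambda>k. f (r (Suc k)) x - f (r k) x)"
      unfolding h_def by (rule summable_norm_cancel)
    then have "convergent (\<lambda>n. \<Sum>k<n. f (r (Suc k)) x - f (r k) x)"
      by (simp add: summable_iff_convergent)
    then have "convergent (\<lambda>n. f (r n) x - f (r 0) x)" 
      using sum_lessThan_telescope[of "\<lambda>n. f (r n) x"] by simp
    then have "convergent (\<lambda>n. f (r n) x)"
      using convergent_diff_const_right_iff by blast
    then show ?case by (simp add: g_def convergent_LIMSEQ_iff)
  qed
  \<comment> \<open>Fatou in the second index transfers the Cauchy estimate from the subsequence to
    its limit, for every n from \<open>r j\<close> on and not only for the indices of the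
    subsequence.\<close>
  have key: "L2 (\<lambda>x. f n x - g x) \<and> En (\<lambda>x. f n x - g x) \<le> (1/4)^j" if "n \<ge> r j" for n j
  proof -
    have a: "AE x in lborel. (\<lambda>k. f n x - f (r k) x) \<longlonglongrightarrow> f n x - g x"
      using conv by eventually_elim (intro tendsto_intros)
    have b: "En (\<lambda>x. f n x - f (r k) x) \<le> (1/4)^j" if "k \<ge> j" for k
      using r[of j n "r k"] \<open>n \<ge> r j\<close> that sm by (simp add: strict_mono_less_eq less_imp_le)
    show ?thesis
      using L2_fatou[where f="\<lambda>k x. f n x - f (r k) x" and g="\<lambda>x. f n x - g x", OF _ _ a b] L2_diff[OF f f] gm
      by auto
  qed
  have "L2 (\<lambda>x. f (r 0) x - (f (r 0) x - g x))" by (rule L2_diff[OF f]) (use key in blast)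
  then have "L2 g" by simp
  moreover have "(\<lambda>n. En (\<lambda>x. f n x - g x)) \<longlonglongrightarrow> 0"
  proof (rule LIMSEQ_I)
    fix e :: real assume "e > 0"
    then obtain j where j: "(1/4::real)^j < e" using real_arch_pow_inv[of e "1/4"] by auto
    show "\<exists>no. \<forall>n\<ge>no. norm (En (\<lambda>x. f n x - g x) - 0) < e"
    proof (intro exI allI impI)
      fix n assume "n \<ge> r j"
      then show "norm (En (\<lambda>x. f n x - g x) - 0) < e"
        using key[of j n] j En_nonneg[of "\<lambda>x. f n x - g x"] by simp
    qed
  qed
  ultimately show ?thesis by (rule that)
qed

text \<open>The function is first truncated in space by \<open>cut\<close> and in value by
  \<open>cl\<close>, at an error controlled by dominated convergence. A bounded function supported
  in a fixed ball is then approximated by continuous ones.\<close>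

lemma L2_approx_compact_support:
  fixes f :: "'a::euclidean_space \<Rightarrow> real"
  assumes f: "L2 f" and e: "e > 0"
  obtains g K where "continuous_on UNIV g" "compact K" "\<And>x. x \<notin> K \<Longrightarrow> g x = 0" "En (\<lambda>x. f x - g x) < e"
proof -
  have fm[measurable]: "f \<in> borel_measurable borel" using f by (rule L2_measurable)
  define cut where "cut m x = max 0 (min 1 (real m + 1 - norm x))" for m and x :: 'a
  define cl where "cl m y = max (- real m) (min (real m) y)" for m and y :: real
  have c01: "0 \<le> cut m x" "cut m x \<le> 1" for m x by (auto simp: cut_def)
  have cz: "cut m x = 0" if "x \<notin> cball 0 (real m + 1)" for m x using that by (auto simp: cut_def)
  have cm[measurable]: "cut m \<in> borel_measurable borel" for m
    unfolding cut_def by measurable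
  have clm[measurable]: "cl m \<in> borel_measurable borel" for m unfolding cl_def by measurable
  have clb: "\<bar>cl m y\<bar> \<le> \<bar>y\<bar>" "\<bar>cl m y\<bar> \<le> real m" "\<bar>y - cl m y\<bar> \<le> \<bar>y\<bar>" for m y by (auto simp: cl_def)
  define F where "F m x = cut m x * cl m (f x)" for m x
  have "(\<lambda>m. \<integral>x. (norm (f x - F m x))\<^sup>2 \<partial>lborel) \<longlonglongrightarrow> (\<integral>x. 0 \<partial>(lborel :: 'a measure))"
  proof (rule integral_dominated_convergence[where w="\<lambda>x. (norm (f x))\<^sup>2"])
    show "integrable lborel (\<lambda>x. (norm (f x))\<^sup>2)" using f by (simp add: L2_def)
    show "AE x in lborel. (\<lambda>m. (norm (f x - F m x))\<^sup>2) \<longlonglongrightarrow> 0"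
    proof (rule AE_I2)
      fix x
      obtain N where N: "real N \<ge> max (norm x) \<bar>f x\<bar>" using real_arch_simple by blast
      have "(norm (f x - F m x))\<^sup>2 = 0" if "m \<ge> N" for m
      proof -
        have "real m \<ge> norm x" "real m \<ge> \<bar>f x\<bar>" using N that by auto
        then show ?thesis by (simp add: F_def cut_def cl_def)
      qed
      then show "(\<lambda>m. (norm (f x - F m x))\<^sup>2) \<longlonglongrightarrow> 0"
        by (intro tendsto_eventually) (auto simp: eventually_sequentially)
    qed
    have "\<bar>f x - F m x\<bar> \<le> \<bar>f x\<bar>" for m x
    proof -
      have "\<bar>y - c * z\<bar> \<le> \<bar>y\<bar>" if "0 \<le> c" "c \<le> 1" "z = cl m y" for y z c :: real
      proof (cases "y \<ge> 0")
        case True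
        then have "0 \<le> z" "z \<le> y" using that by (auto simp: cl_def)
        then have "0 \<le> c * z" "c * z \<le> 1 * z" using mult_right_mono[OF that(2), of z] that(1) by auto
        then show ?thesis using \<open>z \<le> y\<close> by linarith
      next
        case False
        then have "z \<le> 0" "y \<le> z" using that by (auto simp: cl_def)
        then have "c * z \<le> 0" "1 * z \<le> c * z"
          using mult_right_mono_neg[OF that(2), of z] that(1) by (auto simp: mult_nonneg_nonpos)
        then show ?thesis using \<open>y \<le> z\<close> by linarith
      qed
      then show ?thesis unfolding F_def using c01 by blast
    qed
    then show "AE x in lborel. norm ((norm (f x - F m x))\<^sup>2) \<le> (norm (f x))\<^sup>2" for m
      by (auto simp: abs_le_square_iff)
  qed (auto simp: F_def)
  then have "(\<lambda>m. En (\<lambda>x. f x - F m x)) \<longlonglongrightarrow> 0" by (simp add: En_def)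
  then have "eventually (\<lambda>m. En (\<lambda>x. f x - F m x) < e/4) sequentially"
    using e by (intro order_tendstoD(2)) auto
  then obtain m where m: "En (\<lambda>x. f x - F m x) < e/4" by (auto simp: eventually_sequentially)
  have "f \<in> borel_measurable lebesgue" using fm by (simp add: measurable_completion)
  \<comment> \<open>Measurability in this sense supplies continuous functions converging to f off a
    negligible set, but without any bound on them.\<close>
  then have "f measurable_on UNIV" by (intro lebesgue_measurable_imp_measurable_on) auto
  then obtain N g where N: "negligible N" and g: "\<And>n. continuous_on UNIV (g n :: 'a \<Rightarrow> real)"
    and lim: "\<And>x. x \<notin> N \<Longrightarrow> (\<lambda>n. g n x) \<longlonglongrightarrow> f x"
    unfolding measurable_on_def by auto
  have gm[measurable]: "g n \<in> borel_measurable borel" for n using g by (rule borel_measurable_continuous_onI)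
  have "AE x in lebesgue. x \<notin> N" using N by (simp add: negligible_iff_null_sets AE_not_in)
  then have AEN: "AE x in lborel. x \<notin> N" by (simp add: AE_completion_iff)
  \<comment> \<open>Truncating the continuous approximants exactly as f was truncated keeps them
    continuous and makes them uniformly bounded with support in one ball, so dominated convergence
    applies.\<close>
  define G where "G n x = cut m x * cl m (g n x)" for n x
  have Gc: "continuous_on UNIV (G n)" for n
    unfolding G_def cut_def cl_def by (intro continuous_intros g)
  have Gz: "G n x = 0" if "x \<notin> cball 0 (real m + 1)" for n x using cz[OF that] by (simp add: G_def)
  have Fz: "F m x = 0" if "x \<notin> cball 0 (real m + 1)" for x using cz[OF that] by (simp add: F_def)
  have GL: "L2 (G n)" for n by (rule compact_support_L2[OF Gc compact_cball Gz])
  have Fm: "F m \<in> borel_measurable borel" unfolding F_def by measurable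
  have bnd: "\<bar>F m x - G n x\<bar> \<le> 2 * real m" for n x
  proof -
    have "\<bar>F m x\<bar> \<le> 1 * real m" "\<bar>G n x\<bar> \<le> 1 * real m"
      using mult_mono[OF c01(2)[of m x] clb(2)[of m]] c01[of m x] by (simp_all add: F_def G_def abs_mult)
    then show ?thesis by linarith
  qed
  have "(\<lambda>n. \<integral>x. (norm (F m x - G n x))\<^sup>2 \<partial>lborel) \<longlonglongrightarrow> (\<integral>x. 0 \<partial>(lborel :: 'a measure))"
  proof (rule integral_dominated_convergence[where w="\<lambda>x. (2 * real m)\<^sup>2 * indicator (cball 0 (real m + 1)) x"])
    show "integrable lborel (\<lambda>x::'a. (2 * real m)\<^sup>2 * indicator (cball 0 (real m + 1)) x :: real)"
      using emeasure_bounded_finite[OF bounded_cball, of "0::'a" "real m + 1"]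
      by (intro integrable_mult_right) (auto simp: integrable_indicator_iff)
    show "AE x in lborel. (\<lambda>n. (norm (F m x - G n x))\<^sup>2) \<longlonglongrightarrow> 0"
      using AEN
    proof eventually_elim
      case (elim x)
      have "isCont (cl m) y" for y unfolding cl_def
        by (intro continuous_intros)
      then have "(\<lambda>n. cl m (g n x)) \<longlonglongrightarrow> cl m (f x)" by (rule isCont_tendsto_compose[OF _ lim[OF elim]])
      then have "(\<lambda>n. (norm (F m x - G n x))\<^sup>2) \<longlonglongrightarrow> (norm (F m x - cut m x * cl m (f x)))\<^sup>2"
        unfolding G_def by (intro tendsto_intros)
      then show ?case by (simp add: F_def)
    qed
    have "norm ((norm (F m x - G n x))\<^sup>2) \<le> (2 * real m)\<^sup>2 * indicator (cball 0 (real m + 1)) x" for n x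
    proof (cases "x \<in> cball 0 (real m + 1)")
      case True
      then show ?thesis using power_mono[OF bnd[of x n], of 2] by simp
    qed (use Fz Gz in auto)
    then show "AE x in lborel. norm ((norm (F m x - G n x))\<^sup>2) \<le> (2 * real m)\<^sup>2 * indicator (cball 0 (real m + 1)) x" for n
      by simp
  qed (use Fm gm in \<open>auto simp: G_def\<close>)
  then have "(\<lambda>n. En (\<lambda>x. F m x - G n x)) \<longlonglongrightarrow> 0" by (simp add: En_def)
  then have "eventually (\<lambda>n. En (\<lambda>x. F m x - G n x) < e/4) sequentially"
    using e by (intro order_tendstoD(2)) auto
  then obtain n where n: "En (\<lambda>x. F m x - G n x) < e/4" by (auto simp: eventually_sequentially)
  have FL: "L2 (F m)"
  proof -
    have "\<bar>F m x\<bar> \<le> \<bar>f x\<bar>" for x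
      using mult_mono[OF c01(2)[of m x] clb(1)[of m "f x"]] c01 by (simp add: F_def abs_mult)
    then have le: "(F m x)\<^sup>2 \<le> (f x)\<^sup>2" for x by (simp add: abs_le_square_iff)
    have "integrable lborel (\<lambda>x. (f x)\<^sup>2)" using f by (simp add: L2_def)
    then have "integrable lborel (\<lambda>x. (F m x)\<^sup>2)"
      by (rule Bochner_Integration.integrable_bound) (use Fm le in auto)
    then show ?thesis using Fm by (simp add: L2_def)
  qed
  have "En (\<lambda>x. f x - G n x) \<le> 2 * En (\<lambda>x. f x - F m x) + 2 * En (\<lambda>x. F m x - G n x)"
    by (rule En_triangle[OF f FL GL])
  also have "\<dots> < e" using m n by simp
  finally have fin: "En (\<lambda>x. f x - G n x) < e" .
  show ?thesis by (rule that[OF Gc compact_cball _ fin]) (rule Gz)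
qed

lemma L2_shift_continuous:
  fixes f :: "'a::euclidean_space \<Rightarrow> real"
  assumes f: "L2 f" and e: "e > 0"
  obtains d where "d > 0" "\<And>h. norm h \<le> d \<Longrightarrow> En (\<lambda>x. f (h + x) - f x) < e"
proof -
  \<comment> \<open>Two triangle inequalities give 6 times the energy of f - g plus 4 times that of
    the shift error of g, which is less than 6 e/24 + 4 e/12 < e.\<close>
  obtain g K where gc: "continuous_on UNIV g" and K: "compact K" "\<And>x. x \<notin> K \<Longrightarrow> g x = 0"
    and gf: "En (\<lambda>x. f x - g x) < e/24" using L2_approx_compact_support[OF f, of "e/24"] e by auto
  have gL: "L2 g" by (rule compact_support_L2[OF gc K])
  obtain B where B: "B > 0" "\<And>x. \<bar>g x\<bar> \<le> B" using compact_support_bounded[OF gc K] by blast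
  obtain R where R: "\<And>x. x \<in> K \<Longrightarrow> norm x \<le> R" using compact_imp_bounded[OF K(1)] unfolding bounded_iff by blast
  have gm[measurable]: "g \<in> borel_measurable borel" using gL by (rule L2_measurable)
  have "\<exists>d>0. \<forall>h. norm h \<le> d \<longrightarrow> En (\<lambda>x. g (h + x) - g x) < e/12"
  \<comment> \<open>Negating the claim yields a sequence of shifts h n -> 0, the form in which
    dominated convergence can be used.\<close>
  proof (rule ccontr)
    assume "\<not> ?thesis"
    then have "\<forall>n. \<exists>h. norm h \<le> 1 / Suc n \<and> En (\<lambda>x. g (h + x) - g x) \<ge> e/12"
      by (metis not_less of_nat_0_less_iff zero_less_Suc zero_less_divide_1_iff)
    then obtain h where h: "\<And>n. norm (h n) \<le> 1 / Suc n" "\<And>n. En (\<lambda>x. g (h n + x) - g x) \<ge> e/12" by metis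
    have h1: "norm (h n) \<le> 1" for n using h(1)[of n] order_trans by fastforce
    have h0: "h \<longlonglongrightarrow> 0"
      by (rule Lim_null_comparison[OF _ LIMSEQ_inverse_real_of_nat]) (use h(1) in \<open>auto simp: inverse_eq_divide\<close>)
    have "(\<lambda>n. \<integral>x. (norm (g (h n + x) - g x))\<^sup>2 \<partial>lborel) \<longlonglongrightarrow> (\<integral>x. 0 \<partial>(lborel :: 'a measure))"
    proof (rule integral_dominated_convergence[where w="\<lambda>x. (2 * B)\<^sup>2 * indicator (cball 0 (R + 1)) x"])
      show "integrable lborel (\<lambda>x::'a. (2 * B)\<^sup>2 * indicator (cball 0 (R + 1)) x :: real)"
        using emeasure_bounded_finite[OF bounded_cball, of "0::'a" "R + 1"]
        by (intro integrable_mult_right) (auto simp: integrable_indicator_iff)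
      show "AE x in lborel. (\<lambda>n. (norm (g (h n + x) - g x))\<^sup>2) \<longlonglongrightarrow> 0"
      proof (rule AE_I2)
        fix x
        have "(\<lambda>n. h n + x) \<longlonglongrightarrow> 0 + x" by (intro tendsto_intros h0)
        moreover have "isCont g (0 + x)" using gc by (simp add: continuous_on_eq_continuous_at)
        ultimately have "(\<lambda>n. g (h n + x)) \<longlonglongrightarrow> g (0 + x)" using isCont_tendsto_compose by blast
        then have "(\<lambda>n. (norm (g (h n + x) - g x))\<^sup>2) \<longlonglongrightarrow> (norm (g (0 + x) - g x))\<^sup>2" by (intro tendsto_intros)
        then show "(\<lambda>n. (norm (g (h n + x) - g x))\<^sup>2) \<longlonglongrightarrow> 0" by simp
      qed
      have "norm ((norm (g (h n + x) - g x))\<^sup>2) \<le> (2 * B)\<^sup>2 * indicator (cball 0 (R + 1)) x" for n x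
      proof (cases "x \<in> cball 0 (R + 1)")
        case True
        have "\<bar>g (h n + x) - g x\<bar> \<le> 2 * B" using B(2)[of "h n + x"] B(2)[of x] by linarith
        from power_mono[OF this, of 2] show ?thesis using True by simp
      next
        case False
        then have "norm x > R + 1" by auto
        moreover have "norm x \<le> norm (h n + x) + norm (h n)" by (metis add_diff_cancel_left' norm_triangle_ineq4)
        ultimately have "x \<notin> K" "h n + x \<notin> K" using R[of x] R[of "h n + x"] h1[of n] by linarith+
        then show ?thesis using K(2) False by simp
      qed
      then show "AE x in lborel. norm ((norm (g (h n + x) - g x))\<^sup>2) \<le> (2 * B)\<^sup>2 * indicator (cball 0 (R + 1)) x" for n
        by simp
    qed auto
    then have "(\<lambda>n. En (\<lambda>x. g (h n + x) - g x)) \<longlonglongrightarrow> 0" by (simp add: En_def)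
    then have "eventually (\<lambda>n. En (\<lambda>x. g (h n + x) - g x) < e/12) sequentially"
      using e by (intro order_tendstoD(2)) auto
    then show False using h(2) by (auto simp: eventually_sequentially not_le[symmetric])
  qed
  then obtain d where d: "d > 0" "\<And>h. norm h \<le> d \<Longrightarrow> En (\<lambda>x. g (h + x) - g x) < e/12" by blast
  have "En (\<lambda>x. f (h + x) - f x) < e" if "norm h \<le> d" for h
  proof -
    have "En (\<lambda>x. f (h + x) - f x) \<le> 2 * En (\<lambda>x. f (h + x) - g (h + x)) + 2 * En (\<lambda>x. g (h + x) - f x)"
      by (rule En_triangle) (intro L2_shift f gL)+
    moreover have "En (\<lambda>x. f (h + x) - g (h + x)) = En (\<lambda>x. f x - g x)"
      using En_shift[where f="\<lambda>x. f x - g x"] .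
    moreover have "En (\<lambda>x. g (h + x) - f x) \<le> 2 * En (\<lambda>x. g (h + x) - g x) + 2 * En (\<lambda>x. g x - f x)"
      by (rule En_triangle) (intro L2_shift f gL)+
    moreover have "En (\<lambda>x. g x - f x) = En (\<lambda>x. f x - g x)" by (rule En_minus_commute)
    ultimately show ?thesis using gf d(2)[OF that] e by linarith
  qed
  then show ?thesis using that d(1) by blast
qed

section \<open>Convolution with a probability kernel\<close>

text \<open>One notion for smooth mollifiers and for ball averages. The two parameters separate the
  two effects of averaging: B controls the size of the average, R its L2 distance to the
  function.\<close>

definition kernel :: "('a::euclidean_space \<Rightarrow> real) \<Rightarrow> real \<Rightarrow> real \<Rightarrow> bool" where
  "kernel \<kappa> R B \<longleftrightarrow> \<kappa> \<in> borel_measurable borel \<and> (\<forall>h. 0 \<le> \<kappa> h \<and> \<kappa> h \<le> B) \<and>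
     (\<forall>h. norm h > R \<longrightarrow> \<kappa> h = 0) \<and> integrable lborel \<kappa> \<and> (\<integral>h. \<kappa> h \<partial>lborel) = 1"

definition conv :: "('a::euclidean_space \<Rightarrow> real) \<Rightarrow> ('a \<Rightarrow> real) \<Rightarrow> 'a \<Rightarrow> real" where
  "conv \<kappa> f x = (\<integral>h. \<kappa> h * f (x - h) \<partial>lborel)"

context
  fixes \<kappa> :: "'a::euclidean_space \<Rightarrow> real" and R B :: real and f :: "'a \<Rightarrow> real"
  assumes k: "kernel \<kappa> R B" and f: "L2 f"
begin

lemma kernel_measurable[measurable]: "\<kappa> \<in> borel_measurable borel" using k by (simp add: kernel_def)

lemma kernel_nonneg: "0 \<le> \<kappa> h" and kernel_le: "\<kappa> h \<le> B" and kernel_integrable: "integrable lborel \<kappa>"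
  and kernel_integral: "(\<integral>h. \<kappa> h \<partial>lborel) = 1" and kernel_support: "norm h > R \<Longrightarrow> \<kappa> h = 0"
  using k by (auto simp: kernel_def)

lemma L2_meas[measurable]: "f \<in> borel_measurable borel" using f by (rule L2_measurable)

lemma L2_reflect_integrable: "integrable lborel (\<lambda>h. (f (x - h))\<^sup>2)"
  using f lborel_integral_reflect(2)[of "\<lambda>h. (f h)\<^sup>2" x] by (simp add: L2_def)

lemma conv_sq_integrable: "integrable lborel (\<lambda>h. \<kappa> h * (f (x - h))\<^sup>2)"
proof (rule Bochner_Integration.integrable_bound)
  show "integrable lborel (\<lambda>h. B * (f (x - h))\<^sup>2)" using L2_reflect_integrable by simp
  show "(\<lambda>h. \<kappa> h * (f (x - h))\<^sup>2) \<in> borel_measurable lborel" by measurable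
  show "AE h in lborel. norm (\<kappa> h * (f (x - h))\<^sup>2) \<le> norm (B * (f (x - h))\<^sup>2)"
    using kernel_nonneg kernel_le order_trans[OF kernel_nonneg kernel_le]
    by (auto simp: abs_mult intro!: mult_right_mono)
qed

lemma conv_integrable: "integrable lborel (\<lambda>h. \<kappa> h * f (x - h))"
proof (rule Bochner_Integration.integrable_bound)
  show "integrable lborel (\<lambda>h. \<kappa> h + \<kappa> h * (f (x - h))\<^sup>2)" using conv_sq_integrable kernel_integrable by simp
  show "(\<lambda>h. \<kappa> h * f (x - h)) \<in> borel_measurable lborel" by measurable
  have "\<bar>y\<bar> \<le> 1 + y\<^sup>2" for y :: real
    by (rule abs_leI) (sos+)
  then have "\<kappa> h * \<bar>f (x - h)\<bar> \<le> \<kappa> h * (1 + (f (x - h))\<^sup>2)" for h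
    using kernel_nonneg by (intro mult_left_mono) auto
  then show "AE h in lborel. norm (\<kappa> h * f (x - h)) \<le> norm (\<kappa> h + \<kappa> h * (f (x - h))\<^sup>2)"
    using kernel_nonneg by (auto simp: abs_mult distrib_left)
qed

lemma conv_sq_expand: "integrable lborel (\<lambda>h. \<kappa> h * (f (x - h) - c)\<^sup>2)"
  "(\<integral>h. \<kappa> h * (f (x - h) - c)\<^sup>2 \<partial>lborel) = (\<integral>h. \<kappa> h * (f (x - h))\<^sup>2 \<partial>lborel) - 2 * c * conv \<kappa> f x + c\<^sup>2"
proof -
  have eq: "\<kappa> h * (f (x - h) - c)\<^sup>2 = \<kappa> h * (f (x - h))\<^sup>2 - 2 * c * (\<kappa> h * f (x - h)) + c\<^sup>2 * \<kappa> h" for h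
    by (simp add: power2_eq_square algebra_simps)
  show "integrable lborel (\<lambda>h. \<kappa> h * (f (x - h) - c)\<^sup>2)"
    unfolding eq using conv_sq_integrable conv_integrable kernel_integrable by simp
  show "(\<integral>h. \<kappa> h * (f (x - h) - c)\<^sup>2 \<partial>lborel) = (\<integral>h. \<kappa> h * (f (x - h))\<^sup>2 \<partial>lborel) - 2 * c * conv \<kappa> f x + c\<^sup>2"
    unfolding eq conv_def using conv_sq_integrable conv_integrable kernel_integrable kernel_integral by simp
qed

text \<open>Nonnegativity of the variance of f (x - h) under the probability density
  \<open>\<kappa>\<close>. The choice c = 0 gives the uniform bound \<open>conv_bound\<close>, the
  choice c = f x the L2 estimate \<open>conv_approx\<close>.\<close>

lemma conv_jensen: "(conv \<kappa> f x - c)\<^sup>2 \<le> (\<integral>h. \<kappa> h * (f (x - h) - c)\<^sup>2 \<partial>lborel)"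
proof -
  have "0 \<le> (\<integral>h. \<kappa> h * (f (x - h) - conv \<kappa> f x)\<^sup>2 \<partial>lborel)"
    using kernel_nonneg by (intro Bochner_Integration.integral_nonneg) auto
  then show ?thesis unfolding conv_sq_expand(2) by (simp add: power2_eq_square algebra_simps)
qed

lemma conv_bound: "(conv \<kappa> f x)\<^sup>2 \<le> B * En f"
proof -
  have "(conv \<kappa> f x)\<^sup>2 \<le> (\<integral>h. \<kappa> h * (f (x - h))\<^sup>2 \<partial>lborel)" using conv_jensen[of x 0] by simp
  also have "\<dots> \<le> (\<integral>h. B * (f (x - h))\<^sup>2 \<partial>lborel)"
    using conv_sq_integrable L2_reflect_integrable kernel_le by (intro integral_mono) (auto intro!: mult_right_mono)
  also have "\<dots> = B * En f"
    using lborel_integral_reflect(1)[of "\<lambda>h. (f h)\<^sup>2" x] by (simp add: En_def)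
  finally show ?thesis .
qed

lemma conv_measurable: "conv \<kappa> f \<in> borel_measurable borel"
proof -
  have "(\<lambda>x. \<integral>h. \<kappa> h * f (x - h) \<partial>lborel) \<in> borel_measurable lborel"
    by (rule lborel.borel_measurable_lebesgue_integral) simp
  then show ?thesis unfolding conv_def by simp
qed

text \<open>Integrating Jensen's inequality over x and exchanging the integrals leaves a
  \<open>\<kappa>\<close>-average of the translation errors, and only shifts of length at most R
  carry weight.\<close>

lemma conv_approx:
  assumes D: "\<And>h. norm h \<le> R \<Longrightarrow> En (\<lambda>x. f (h + x) - f x) \<le> D" and D0: "0 \<le> D"
  shows "L2 (\<lambda>x. conv \<kappa> f x - f x)" "En (\<lambda>x. conv \<kappa> f x - f x) \<le> D" "L2 (conv \<kappa> f)"
proof -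
  note conv_measurable[measurable]
  have Lh: "L2 (\<lambda>x. f (h + x) - f x)" for h by (intro L2_diff L2_shift f)
  have "(\<integral>\<^sup>+x. ennreal ((norm (conv \<kappa> f x - f x))\<^sup>2) \<partial>lborel)
     \<le> (\<integral>\<^sup>+x. \<integral>\<^sup>+h. ennreal (\<kappa> h * (f (x - h) - f x)\<^sup>2) \<partial>lborel \<partial>lborel)"
  proof (rule nn_integral_mono)
    fix x
    have "(\<integral>\<^sup>+h. ennreal (\<kappa> h * (f (x - h) - f x)\<^sup>2) \<partial>lborel) = ennreal (\<integral>h. \<kappa> h * (f (x - h) - f x)\<^sup>2 \<partial>lborel)"
      by (intro nn_integral_eq_integral conv_sq_expand) (use kernel_nonneg in auto)
    then show "ennreal ((norm (conv \<kappa> f x - f x))\<^sup>2) \<le> (\<integral>\<^sup>+h. ennreal (\<kappa> h * (f (x - h) - f x)\<^sup>2) \<partial>lborel)"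
      using conv_jensen[of x "f x"] by (simp add: ennreal_leI)
  qed
  also have "\<dots> = (\<integral>\<^sup>+h. \<integral>\<^sup>+x. ennreal (\<kappa> h * (f (x - h) - f x)\<^sup>2) \<partial>lborel \<partial>lborel)"
    by (rule lborel_pair.Fubini') simp
  also have "\<dots> \<le> (\<integral>\<^sup>+h. ennreal (\<kappa> h * D) \<partial>lborel)"
  proof (rule nn_integral_mono)
    fix h
    have "(\<integral>\<^sup>+x. ennreal (\<kappa> h * (f (x - h) - f x)\<^sup>2) \<partial>lborel) = ennreal (\<kappa> h) * (\<integral>\<^sup>+x. ennreal ((norm (f (- h + x) - f x))\<^sup>2) \<partial>lborel)"
      using kernel_nonneg by (subst nn_integral_cmult[symmetric]) (auto simp: ennreal_mult)
    also have "\<dots> = ennreal (\<kappa> h * En (\<lambda>x. f (- h + x) - f x))"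
      using nn_integral_En[OF Lh[of "- h"]] kernel_nonneg by (simp add: ennreal_mult En_nonneg)
    also have "\<dots> \<le> ennreal (\<kappa> h * D)"
      using D[of "-h"] kernel_support[of h] kernel_nonneg
      by (cases "norm h \<le> R") (auto intro!: ennreal_leI mult_left_mono)
    finally show "(\<integral>\<^sup>+x. ennreal (\<kappa> h * (f (x - h) - f x)\<^sup>2) \<partial>lborel) \<le> ennreal (\<kappa> h * D)" .
  qed
  also have "\<dots> = ennreal (\<integral>h. \<kappa> h * D \<partial>lborel)"
    by (rule nn_integral_eq_integral) (use kernel_integrable kernel_nonneg D0 in auto)
  also have "(\<integral>h. \<kappa> h * D \<partial>lborel) = D" using kernel_integral by simp
  finally have le: "(\<integral>\<^sup>+x. ennreal ((norm (conv \<kappa> f x - f x))\<^sup>2) \<partial>lborel) \<le> ennreal D" .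
  show 1: "L2 (\<lambda>x. conv \<kappa> f x - f x)" and "En (\<lambda>x. conv \<kappa> f x - f x) \<le> D"
    using L2_nnI[OF _ le D0] by simp_all
  show "L2 (conv \<kappa> f)" using L2_add[OF 1 f] by simp
qed

lemma conv_L2: "L2 (conv \<kappa> f)"
proof (rule conv_approx(3))
  show "En (\<lambda>x. f (h + x) - f x) \<le> 4 * En f" for h
    using En_diff_le[OF L2_shift[OF f] f, of h] by (simp add: En_shift)
qed (simp add: En_nonneg)

end

text \<open>The difference of two averages of f is one average of a translation error of f, so the
  uniform bound applies to it. Together with the translation estimate this yields Lipschitz
  continuity of averages of weakly differentiable functions.\<close>

lemma conv_diff_bound:
  fixes f :: "'a::euclidean_space \<Rightarrow> real"
  assumes k: "kernel \<kappa> R B" and f: "L2 f"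
  shows "(conv \<kappa> f x - conv \<kappa> f y)\<^sup>2 \<le> B * En (\<lambda>z. f ((x - y) + z) - f z)"
proof -
  let ?w = "\<lambda>z. f ((x - y) + z) - f z"
  have w: "L2 ?w" by (intro L2_diff L2_shift f)
  have "conv \<kappa> ?w y = (\<integral>h. \<kappa> h * f (x - h) - \<kappa> h * f (y - h) \<partial>lborel)"
    unfolding conv_def by (simp add: algebra_simps)
  also have "\<dots> = conv \<kappa> f x - conv \<kappa> f y"
    unfolding conv_def using conv_integrable[OF k f] by simp
  finally show ?thesis using conv_bound[OF k w, of y] by simp
qed

section \<open>Pairs of a function and its weak gradient\<close>

text \<open>The gradient is an explicit argument, so sums, limits and translates of pairs can be
  formed pointwise; \<open>sob_wgrad\<close> leads back to the chosen gradient.\<close>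

definition sob :: "(real^'n \<Rightarrow> real) \<Rightarrow> (real^'n \<Rightarrow> real^'n) \<Rightarrow> bool" where
  "sob u g \<longleftrightarrow> L2 u \<and> L2 g \<and> weak_gradient u g"

lemma sobI:
  assumes u: "L2 u" and g: "L2 g"
    and w: "\<And>\<phi> i. test_fn \<phi> UNIV \<Longrightarrow> (\<integral>x. u x * partial i \<phi> x \<partial>lborel) = - (\<integral>x. g x $ i * \<phi> x \<partial>lborel)"
  shows "sob u g"
proof -
  have "g \<in> borel_measurable lborel" using g by (simp add: L2_def)
  then have "weak_gradient u g" unfolding weak_gradient_def
  proof (intro conjI allI impI)
    fix \<phi> :: "real^'a \<Rightarrow> real" and i assume t: "test_fn \<phi> UNIV"
    show "integrable lborel (\<lambda>x. u x * partial i \<phi> x)"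
      by (rule L2_mult_integrable[OF u test_fn_L2[OF test_fn_partial[OF t]]])
    show "integrable lborel (\<lambda>x. g x $ i * \<phi> x)"
      by (rule L2_mult_integrable[OF L2_component[OF g] test_fn_L2[OF t]])
    show "(\<integral>x. u x * partial i \<phi> x \<partial>lborel) = - (\<integral>x. g x $ i * \<phi> x \<partial>lborel)" by (rule w[OF t])
  qed
  then show ?thesis using u g by (simp add: sob_def)
qed

lemma sob_L2: "sob u g \<Longrightarrow> L2 u" and sob_grad_L2: "sob u g \<Longrightarrow> L2 g"
  by (auto simp: sob_def)

lemma sob_by_parts:
  "sob u g \<Longrightarrow> test_fn \<phi> UNIV \<Longrightarrow> (\<integral>x. u x * partial i \<phi> x \<partial>lborel) = - (\<integral>x. g x $ i * \<phi> x \<partial>lborel)"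
  by (auto simp: sob_def weak_gradient_def)

lemma H1_iff_sob: "H1 u \<longleftrightarrow> (\<exists>g. sob u g)"
  by (auto simp: H1_def sob_def L2_def weak_gradient_def)

lemma En_component_le:
  fixes g :: "'a::euclidean_space \<Rightarrow> real^'n"
  assumes "L2 g" shows "En (\<lambda>x. g x $ i) \<le> En g"
  unfolding En_vec[OF assms] by (rule member_le_sum) (auto simp: En_nonneg)

lemma L2_integral_tendsto:
  fixes f :: "nat \<Rightarrow> 'a::euclidean_space \<Rightarrow> real"
  assumes f: "\<And>n. L2 (f n)" "L2 f0" and p: "L2 p" and lim: "(\<lambda>n. En (\<lambda>x. f n x - f0 x)) \<longlonglongrightarrow> 0"
  shows "(\<lambda>n. \<integral>x. f n x * p x \<partial>lborel) \<longlonglongrightarrow> (\<integral>x. f0 x * p x \<partial>lborel)"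
proof -
  have "((\<integral>x. f n x * p x \<partial>lborel) - (\<integral>x. f0 x * p x \<partial>lborel))\<^sup>2 \<le> En (\<lambda>x. f n x - f0 x) * En p" for n
    using L2_Cauchy_Schwarz[OF L2_diff[OF f(1)[of n] f(2)] p] L2_mult_integrable[OF f(1)[of n] p]
      L2_mult_integrable[OF f(2) p] by (simp add: left_diff_distrib)
  then have le: "\<bar>(\<integral>x. f n x * p x \<partial>lborel) - (\<integral>x. f0 x * p x \<partial>lborel)\<bar> \<le> sqrt (En (\<lambda>x. f n x - f0 x) * En p)" for n
    by (rule real_le_rsqrt[of "\<bar>_\<bar>", simplified])
  have lim2: "(\<lambda>n. sqrt (En (\<lambda>x. f n x - f0 x) * En p)) \<longlonglongrightarrow> sqrt (0 * En p)"
    by (intro tendsto_intros lim)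
  have "(\<lambda>n. (\<integral>x. f n x * p x \<partial>lborel) - (\<integral>x. f0 x * p x \<partial>lborel)) \<longlonglongrightarrow> 0"
    by (rule Lim_null_comparison[OF _ lim2[simplified]]) (use le in simp)
  then show ?thesis by (simp add: LIM_zero_iff)
qed

lemma sob_lincomb:
  assumes "sob u g" "sob w k"
  shows "sob (\<lambda>x. a * u x + b * w x) (\<lambda>x. a *\<^sub>R g x + b *\<^sub>R k x)"
proof (rule sobI)
  note L = sob_L2[OF assms(1)] sob_grad_L2[OF assms(1)] sob_L2[OF assms(2)] sob_grad_L2[OF assms(2)]
  show "L2 (\<lambda>x. a * u x + b * w x)" "L2 (\<lambda>x. a *\<^sub>R g x + b *\<^sub>R k x)"
    using L by (auto intro!: L2_add L2_cmult L2_scaleR)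
  fix \<phi> :: "real^'a \<Rightarrow> real" and i assume p: "test_fn \<phi> UNIV"
  note I = L2_mult_integrable[OF L(1) test_fn_L2[OF test_fn_partial[OF p]], of i]
    L2_mult_integrable[OF L(3) test_fn_L2[OF test_fn_partial[OF p]], of i]
    L2_mult_integrable[OF L2_component[OF L(2)] test_fn_L2[OF p], of i]
    L2_mult_integrable[OF L2_component[OF L(4)] test_fn_L2[OF p], of i]
  have "(\<integral>x. (a * u x + b * w x) * partial i \<phi> x \<partial>lborel)
      = a * (\<integral>x. u x * partial i \<phi> x \<partial>lborel) + b * (\<integral>x. w x * partial i \<phi> x \<partial>lborel)"
    using I by (simp add: distrib_right mult.assoc)
  also have "\<dots> = - (\<integral>x. (a *\<^sub>R g x + b *\<^sub>R k x) $ i * \<phi> x \<partial>lborel)"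
    using I sob_by_parts[OF assms(1) p, of i] sob_by_parts[OF assms(2) p, of i]
    by (simp add: distrib_right mult.assoc)
  finally show "(\<integral>x. (a * u x + b * w x) * partial i \<phi> x \<partial>lborel) = - (\<integral>x. (a *\<^sub>R g x + b *\<^sub>R k x) $ i * \<phi> x \<partial>lborel)" .
qed

lemma sob_diff:
  assumes "sob u g" "sob w k" shows "sob (\<lambda>x. u x - w x) (\<lambda>x. g x - k x)"
  using sob_lincomb[OF assms, of 1 "-1"] by simp

lemma sob_add:
  assumes "sob u g" "sob w k" shows "sob (\<lambda>x. u x + w x) (\<lambda>x. g x + k x)"
  using sob_lincomb[OF assms, of 1 1] by simp

text \<open>For a fixed test function both sides of the defining identity are continuous under L2
  convergence, so the graph of the weak gradient is closed.\<close>

lemma sob_limit: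
  assumes s: "\<And>n. sob (u n) (g n)" and u0: "L2 u0" and g0: "L2 g0"
    and ul: "(\<lambda>n. En (\<lambda>x. u n x - u0 x)) \<longlonglongrightarrow> 0" and gl: "(\<lambda>n. En (\<lambda>x. g n x - g0 x)) \<longlonglongrightarrow> 0"
  shows "sob u0 g0"
proof (rule sobI[OF u0 g0])
  fix \<phi> :: "real^'a \<Rightarrow> real" and i assume p: "test_fn \<phi> UNIV"
  note L = sob_L2[OF s] sob_grad_L2[OF s]
  have "(\<lambda>n. \<integral>x. u n x * partial i \<phi> x \<partial>lborel) \<longlonglongrightarrow> (\<integral>x. u0 x * partial i \<phi> x \<partial>lborel)"
    by (rule L2_integral_tendsto[OF L(1) u0 test_fn_L2[OF test_fn_partial[OF p]] ul])
  moreover have "(\<lambda>n. En (\<lambda>x. g n x $ i - g0 x $ i)) \<longlonglongrightarrow> 0"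
  proof (rule Lim_null_comparison[OF _ gl], intro always_eventually allI)
    show "norm (En (\<lambda>x. g n x $ i - g0 x $ i)) \<le> En (\<lambda>x. g n x - g0 x)" for n
      using En_component_le[OF L2_diff[OF L(2)[of n] g0], of i] En_nonneg[of "\<lambda>x. g n x $ i - g0 x $ i"] by simp
  qed
  then have "(\<lambda>n. - (\<integral>x. g n x $ i * \<phi> x \<partial>lborel)) \<longlonglongrightarrow> - (\<integral>x. g0 x $ i * \<phi> x \<partial>lborel)"
    by (intro tendsto_minus L2_integral_tendsto L2_component L g0 test_fn_L2[OF p])
  ultimately show "(\<integral>x. u0 x * partial i \<phi> x \<partial>lborel) = - (\<integral>x. g0 x $ i * \<phi> x \<partial>lborel)"
    using sob_by_parts[OF s p] LIMSEQ_unique by simp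
qed

lemma sob_shift:
  assumes "sob u g" shows "sob (\<lambda>x. u (c + x)) (\<lambda>x. g (c + x))"
proof (rule sobI)
  show "L2 (\<lambda>x. u (c + x))" "L2 (\<lambda>x. g (c + x))" using assms by (auto intro!: L2_shift simp: sob_def)
  fix \<phi> :: "real^'a \<Rightarrow> real" and i assume p: "test_fn \<phi> UNIV"
  define \<psi> where "\<psi> = (\<lambda>y. \<phi> (- c + 1 *\<^sub>R y))"
  have t: "test_fn \<psi> UNIV" unfolding \<psi>_def by (rule test_fn_affine[OF p]) simp
  have d: "partial i \<psi> y = partial i \<phi> (- c + y)" for y
    unfolding \<psi>_def
    using partial_affine(1)[OF smooth_on_differentiable[OF test_fn_smooth[OF p]], where x="- c" and c=1 and y=y and i=i]
    by simp
  have "(\<integral>x. u (c + x) * partial i \<phi> x \<partial>lborel) = (\<integral>x. u (c + x) * partial i \<psi> (c + x) \<partial>lborel)"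
    by (simp add: d)
  also have "\<dots> = (\<integral>x. u x * partial i \<psi> x \<partial>lborel)"
    by (rule lborel_integral_shift(1)[where f="\<lambda>x. u x * partial i \<psi> x"])
  also have "\<dots> = - (\<integral>x. g x $ i * \<psi> x \<partial>lborel)" by (rule sob_by_parts[OF assms t])
  also have "(\<integral>x. g x $ i * \<psi> x \<partial>lborel) = (\<integral>x. g (c + x) $ i * \<psi> (c + x) \<partial>lborel)"
    by (rule lborel_integral_shift(1)[where f="\<lambda>x. g x $ i * \<psi> x", symmetric])
  finally show "(\<integral>x. u (c + x) * partial i \<phi> x \<partial>lborel) = - (\<integral>x. g (c + x) $ i * \<phi> x \<partial>lborel)"
    by (simp add: \<psi>_def)
qed

text \<open>Multiplying w by a test function gives a test function, whose partial derivative
  integrates to 0; the product rule turns this into integration by parts.\<close>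

lemma sob_smooth:
  assumes w: "smooth_on w UNIV" "L2 w" and p: "\<And>i. L2 (partial i w)"
  shows "sob w (\<lambda>x. \<chi> i. partial i w x)"
proof (rule sobI[OF w(2)])
  show "L2 (\<lambda>x. \<chi> i. partial i w x)" by (rule L2_vecI) (simp add: p)
  fix \<phi> :: "real^'a \<Rightarrow> real" and i assume t: "test_fn \<phi> UNIV"
  have "(\<integral>x. partial i (\<lambda>x. \<phi> x * w x) x \<partial>lborel) = 0"
    by (rule integral_partial_test_fn[OF test_fn_mult[OF t w(1)]])
  moreover have "partial i (\<lambda>x. \<phi> x * w x) x = w x * partial i \<phi> x + partial i w x * \<phi> x" for x
    using partial_mult[OF smooth_on_differentiable[OF test_fn_smooth[OF t]] smooth_on_differentiable[OF w(1)]]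
    by (simp add: mult.commute)
  ultimately show "(\<integral>x. w x * partial i \<phi> x \<partial>lborel) = - (\<integral>x. (\<chi> i. partial i w x) $ i * \<phi> x \<partial>lborel)"
    using L2_mult_integrable[OF w(2) test_fn_L2[OF test_fn_partial[OF t, of i]]]
      L2_mult_integrable[OF p test_fn_L2[OF t]] by simp
qed

lemma sob_mult_test:
  assumes s: "sob u g" and e: "test_fn \<eta> UNIV"
  shows "sob (\<lambda>x. \<eta> x * u x) (\<lambda>x. \<eta> x *\<^sub>R g x + u x *\<^sub>R (\<chi> i. partial i \<eta> x))"
proof -
  note L = sob_L2[OF s] sob_grad_L2[OF s]
  obtain B where B: "B > 0" "\<And>x. \<bar>\<eta> x\<bar> \<le> B" using test_fn_bounded[OF e] by blast
  have meas: "\<phi> \<in> borel_measurable lborel" if "test_fn \<phi> UNIV" for \<phi> :: "real^'a \<Rightarrow> real"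
    using test_fn_L2[OF that] by (simp add: L2_def)
  have Lu: "L2 (\<lambda>x. \<phi> x * u x)" if t: "test_fn \<phi> UNIV" for \<phi>
  proof -
    obtain B where "B > 0" and B: "\<And>x. \<bar>\<phi> x\<bar> \<le> B" using test_fn_bounded[OF t] by blast
    show ?thesis using L2_bounded_mult(1)[OF meas[OF t] B L(1)] by simp
  qed
  have Lg: "L2 (\<lambda>x. \<eta> x *\<^sub>R g x)" by (rule L2_bounded_mult(1)[OF meas[OF e] B(2) L(2)])
  have Lp: "L2 (\<lambda>x. u x *\<^sub>R (\<chi> i. partial i \<eta> x))"
    by (rule L2_vecI) (use Lu[OF test_fn_partial[OF e]] in \<open>simp add: mult.commute\<close>)
  show ?thesis
  proof (rule sobI[OF Lu[OF e] L2_add[OF Lg Lp]])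
    fix \<phi> :: "real^'a \<Rightarrow> real" and i assume t: "test_fn \<phi> UNIV"
    \<comment> \<open>The weak gradient of u is tested against the product of the cutoff with the
      given test function; the product rule then moves the derivative of the cutoff into the new
      gradient.\<close>
    have t2: "test_fn (\<lambda>x. \<eta> x * \<phi> x) UNIV" by (rule test_fn_mult[OF e test_fn_smooth[OF t]])
    have pm: "partial i (\<lambda>x. \<eta> x * \<phi> x) x = \<eta> x * partial i \<phi> x + partial i \<eta> x * \<phi> x" for x
      by (rule partial_mult) (intro smooth_on_differentiable test_fn_smooth[OF e] test_fn_smooth[OF t])+
    have I: "integrable lborel (\<lambda>x. u x * partial i (\<lambda>x. \<eta> x * \<phi> x) x)"
      "integrable lborel (\<lambda>x. (partial i \<eta> x * u x) * \<phi> x)"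
      "integrable lborel (\<lambda>x. (\<eta> x *\<^sub>R g x) $ i * \<phi> x)"
      by (intro L2_mult_integrable L Lu test_fn_L2[OF t] test_fn_L2[OF test_fn_partial[OF t2]] test_fn_partial[OF e]
          L2_component[OF Lg])+
    have "(\<integral>x. \<eta> x * u x * partial i \<phi> x \<partial>lborel)
       = (\<integral>x. u x * partial i (\<lambda>x. \<eta> x * \<phi> x) x - (partial i \<eta> x * u x) * \<phi> x \<partial>lborel)"
      by (rule Bochner_Integration.integral_cong) (auto simp: pm algebra_simps)
    also have "\<dots> = - (\<integral>x. g x $ i * (\<eta> x * \<phi> x) \<partial>lborel) - (\<integral>x. (partial i \<eta> x * u x) * \<phi> x \<partial>lborel)"
      using I by (simp add: sob_by_parts[OF s t2])
    also have "\<dots> = - (\<integral>x. (\<eta> x *\<^sub>R g x) $ i * \<phi> x + (partial i \<eta> x * u x) * \<phi> x \<partial>lborel)"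
      using I(2,3) by (simp add: mult_ac)
    finally show "(\<integral>x. \<eta> x * u x * partial i \<phi> x \<partial>lborel)
      = - (\<integral>x. (\<eta> x *\<^sub>R g x + u x *\<^sub>R (\<chi> i. partial i \<eta> x)) $ i * \<phi> x \<partial>lborel)"
      by (simp add: algebra_simps)
  qed
qed

section \<open>Mollification\<close>

lemma indicator_sq: "(indicator A x :: real)\<^sup>2 = indicator A x"
  by (simp add: indicator_def)

text \<open>Reflection moves x into the argument of the kernel, where it can be
  differentiated.\<close>

lemma conv_alt:
  assumes k: "test_fn \<kappa> UNIV" and u: "L2 u"
  shows "conv \<kappa> u x = (\<integral>y. u y * \<kappa> (x - y) \<partial>lborel)" "integrable lborel (\<lambda>y. u y * \<kappa> (x - y))"
proof -
  have km[measurable]: "\<kappa> \<in> borel_measurable borel" using test_fn_L2[OF k] by (rule L2_measurable)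
  have um[measurable]: "u \<in> borel_measurable borel" using u by (rule L2_measurable)
  have "(\<lambda>y. u y * \<kappa> (x - y)) \<in> borel_measurable lborel" by measurable
  from lborel_integral_reflect(1)[OF this, of x]
  show "conv \<kappa> u x = (\<integral>y. u y * \<kappa> (x - y) \<partial>lborel)" by (simp add: conv_def mult.commute)
  have "test_fn (\<lambda>y. \<kappa> (x + (-1) *\<^sub>R y)) UNIV" by (rule test_fn_affine[OF k]) simp
  from L2_mult_integrable[OF u test_fn_L2[OF this]] show "integrable lborel (\<lambda>y. u y * \<kappa> (x - y))" by simp
qed

text \<open>The test function is the reflected kernel y -> \<open>\<kappa> (x - y)\<close>; the sign
  from the reflection cancels the sign in the definition of the weak gradient.\<close>

lemma conv_sob_partial:
  assumes k: "test_fn \<kappa> UNIV" and s: "sob u g"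
  shows "conv (partial i \<kappa>) u x = conv \<kappa> (\<lambda>y. g y $ i) x"
proof -
  define \<psi> where "\<psi> = (\<lambda>y. \<kappa> (x + (-1) *\<^sub>R y))"
  have t: "test_fn \<psi> UNIV" unfolding \<psi>_def by (rule test_fn_affine[OF k]) simp
  have d: "partial i \<psi> y = - partial i \<kappa> (x - y)" for y
    unfolding \<psi>_def using partial_affine(1)[OF smooth_on_differentiable[OF test_fn_smooth[OF k]], where c="-1"] by simp
  have "conv (partial i \<kappa>) u x = - (\<integral>y. u y * partial i \<psi> y \<partial>lborel)"
    by (simp add: conv_alt(1)[OF test_fn_partial[OF k] sob_L2[OF s]] d)
  also have "\<dots> = (\<integral>y. g y $ i * \<psi> y \<partial>lborel)" using sob_by_parts[OF s t] by simp
  also have "\<dots> = conv \<kappa> (\<lambda>y. g y $ i) x"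
    by (simp add: conv_alt(1)[OF k L2_component[OF sob_grad_L2[OF s]]] \<psi>_def)
  finally show ?thesis .
qed

lemma compact_support_uniformly_continuous:
  fixes f :: "'a::euclidean_space \<Rightarrow> real"
  assumes f: "continuous_on UNIV f" and R: "\<And>x. norm x > R \<Longrightarrow> f x = 0" and e: "e > 0"
  obtains d where "d > 0" "\<And>x y. norm (x - y) \<le> d \<Longrightarrow> \<bar>f x - f y\<bar> \<le> e"
proof -
  have "uniformly_continuous_on (cball 0 (R + 1)) f"
    by (rule compact_uniformly_continuous) (use f continuous_on_subset in auto)
  then obtain d where d: "d > 0" "\<And>x y. x \<in> cball 0 (R+1) \<Longrightarrow> y \<in> cball 0 (R+1) \<Longrightarrow> dist y x < d \<Longrightarrow> dist (f y) (f x) < e"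
    unfolding uniformly_continuous_on_def using e by metis
  have "\<bar>f x - f y\<bar> \<le> e" if n: "norm (x - y) \<le> min (d/2) 1" for x y
  proof (cases "norm x > R \<and> norm y > R")
    case True then show ?thesis using R e by simp
  next
    case False
    have "norm x \<le> norm y + norm (x - y)" "norm y \<le> norm x + norm (x - y)"
      using norm_triangle_sub[of x y] norm_triangle_sub[of y x] by (auto simp: norm_minus_commute)
    then have "x \<in> cball 0 (R+1)" "y \<in> cball 0 (R+1)" using False n by auto
    moreover have "dist x y < d" using n d(1) by (auto simp: dist_norm)
    ultimately show ?thesis using d(2)[of y x] by (simp add: dist_real_def)
  qed
  then show ?thesis using that[of "min (d/2) 1"] d(1) by simp
qed

text \<open>The first-order remainder of the kernel is small compared with |v| uniformly in its base
  point, because its partial derivatives are uniformly continuous. Integrating this remainder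
  against u gives the derivative directly.\<close>

lemma conv_has_derivative:
  fixes u :: "real^'n \<Rightarrow> real"
  assumes k: "test_fn \<kappa> UNIV" and u: "L2 u"
  shows "(conv \<kappa> u has_derivative (\<lambda>v. \<Sum>i\<in>UNIV. conv (partial i \<kappa>) u x * v $ i)) (at x)"
  unfolding has_derivative_at_alt
proof (intro conjI allI impI)
  show "bounded_linear (\<lambda>v. \<Sum>i\<in>UNIV. conv (partial i \<kappa>) u x * v $ i)"
    by (intro bounded_linear_sum bounded_linear_const_mult bounded_linear_vec_nth)
  fix e :: real assume e: "e > 0"
  obtain K where K: "compact K" "\<And>x. x \<notin> K \<Longrightarrow> \<kappa> x = 0" using test_fn_support[OF k] by blast
  obtain R where R: "\<And>x. x \<in> K \<Longrightarrow> norm x \<le> R" using compact_imp_bounded[OF K(1)] unfolding bounded_iff by blast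
  have kz: "\<kappa> x = 0" if "norm x > R" for x using R K(2) that by force
  have pz: "partial i \<kappa> x = 0" if "norm x > R" for i x
    by (rule partial_eq_0_outside[of "cball 0 R"]) (use kz that in auto)
  have kd: "\<kappa> differentiable at x" for x by (rule smooth_on_differentiable[OF test_fn_smooth[OF k]])
  \<comment> \<open>For |v| <= 1, the kernel and its derivatives at x - t as well as the kernel at x
    - t + v vanish once t leaves the ball of radius R + 1 about x, so only the mass of u on this
    ball matters.\<close>
  define M where "M = (\<integral>y. \<bar>u y\<bar> * indicator (cball x (R + 1)) y \<partial>lborel)"
  have um[measurable]: "u \<in> borel_measurable borel" using u by (rule L2_measurable)
  have Li: "L2 (\<lambda>y. indicator (cball x (R + 1)) y :: real)"
    using emeasure_bounded_finite[OF bounded_cball, of x "R + 1"]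
    by (auto simp: L2_def integrable_indicator_iff indicator_sq intro!: borel_measurable_indicator)
  have "L2 (\<lambda>y. \<bar>u y\<bar>)" using u by (auto simp: L2_def)
  from L2_mult_integrable[OF this Li] have Mi: "integrable lborel (\<lambda>y. \<bar>u y\<bar> * indicator (cball x (R + 1)) y)" .
  have M0: "M \<ge> 0" unfolding M_def by simp
  \<comment> \<open>The remainder is at most \<open>e' * CARD('n) * norm v * M\<close>; adding 1 to
    M avoids division by zero.\<close>
  define e' where "e' = e / (CARD('n) * (M + 1))"
  have e': "e' > 0" using e M0 by (simp add: e'_def)
  have "\<exists>d>0. \<forall>x y. norm (x - y) \<le> d \<longrightarrow> \<bar>partial i \<kappa> x - partial i \<kappa> y\<bar> \<le> e'" for i
    using compact_support_uniformly_continuous[OF smooth_on_continuous[OF test_fn_smooth[OF test_fn_partial[OF k]]] pz e'] by metis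
  then obtain d where d: "\<And>i. d i > 0" "\<And>i x y. norm (x - y) \<le> d i \<Longrightarrow> \<bar>partial i \<kappa> x - partial i \<kappa> y\<bar> \<le> e'"
    by metis
  define d0 where "d0 = min 1 (Min (range d))"
  have d0: "d0 > 0" using d(1) by (simp add: d0_def)
  have dd: "\<bar>partial i \<kappa> x - partial i \<kappa> y\<bar> \<le> e'" if "norm (x - y) \<le> d0" for i x y
  proof (rule d(2))
    have "Min (range d) \<le> d i" by (rule Min_le) auto
    then show "norm (x - y) \<le> d i" using that by (simp add: d0_def)
  qed
  have rem: "\<bar>\<kappa> (z + v) - \<kappa> z - (\<Sum>i\<in>UNIV. partial i \<kappa> z * v $ i)\<bar> \<le> e' * CARD('n) * norm v" if v: "norm v \<le> d0" for z v
  proof -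
    \<comment> \<open>With the linear part at z subtracted, the partial derivatives become
      differences of partial derivatives of the kernel, to which the mean value bound
      applies.\<close>
    let ?\<zeta> = "\<lambda>w. \<kappa> w - (\<Sum>i\<in>UNIV. partial i \<kappa> z * w $ i)"
    have D: "(?\<zeta> has_derivative (\<lambda>k. (\<Sum>i\<in>UNIV. partial i \<kappa> w * k $ i) - (\<Sum>i\<in>UNIV. partial i \<kappa> z * k $ i))) (at w)" for w
      by (intro has_derivative_diff has_derivative_partial kd bounded_linear_imp_has_derivative
           bounded_linear_sum bounded_linear_const_mult bounded_linear_vec_nth)
    have P: "partial i ?\<zeta> w = partial i \<kappa> w - partial i \<kappa> z" for i w
      using partial_eqI[OF D[of w], of i] by (simp add: axis_def if_distrib cong: if_cong)
    have "\<bar>?\<zeta> (z + v) - ?\<zeta> z\<bar> \<le> e' * CARD('n) * norm (z + v - z)"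
    proof (rule smooth_mvt_bound)
      show "?\<zeta> differentiable at w" for w using D[of w] differentiable_def by blast
      fix w i assume "w \<in> closed_segment z (z + v)"
      then have "norm (w - z) \<le> norm v"
        using segment_bound(1)[of w z "z + v"] by simp
      then show "\<bar>partial i ?\<zeta> w\<bar> \<le> e'" unfolding P using v by (intro dd) simp
    qed
    then show ?thesis by (simp add: distrib_left sum.distrib algebra_simps)
  qed
  show "\<exists>d>0. \<forall>y. norm (y - x) < d \<longrightarrow>
     norm (conv \<kappa> u y - conv \<kappa> u x - (\<Sum>i\<in>UNIV. conv (partial i \<kappa>) u x * (y - x) $ i)) \<le> e * norm (y - x)"
  proof (intro exI[of _ d0] conjI d0 allI impI)
    fix y assume y: "norm (y - x) < d0"
    define v where "v = y - x"
    have v: "norm v \<le> d0" using y by (simp add: v_def)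
    have v1: "norm v \<le> 1" using v by (simp add: d0_def)
    let ?r = "\<lambda>t. \<kappa> (x - t + v) - \<kappa> (x - t) - (\<Sum>i\<in>UNIV. partial i \<kappa> (x - t) * v $ i)"
    note I1 = conv_alt[OF k u] and I2 = conv_alt[OF test_fn_partial[OF k] u]
    have yx: "y - t = x - t + v" for t by (simp add: v_def)
    have Iy: "integrable lborel (\<lambda>t. u t * \<kappa> (x - t + v))" using I1(2)[of y] by (simp add: yx)
    have eq: "u t * ?r t = u t * \<kappa> (x - t + v) - u t * \<kappa> (x - t) - (\<Sum>i\<in>UNIV. (u t * partial i \<kappa> (x - t)) * v $ i)" for t
      by (simp add: algebra_simps sum_distrib_left)
    have ri: "integrable lborel (\<lambda>t. u t * ?r t)"
      unfolding eq using Iy I1(2) I2(2) by (intro Bochner_Integration.integrable_diff Bochner_Integration.integrable_sum integrable_mult_left) auto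
    have "conv \<kappa> u y - conv \<kappa> u x - (\<Sum>i\<in>UNIV. conv (partial i \<kappa>) u x * v $ i) = (\<integral>t. u t * ?r t \<partial>lborel)"
      unfolding eq I1(1) I2(1) yx
      using Iy I1(2)[of x] I2(2) by (simp add: Bochner_Integration.integral_diff Bochner_Integration.integral_sum)
    moreover have "norm (\<integral>t. u t * ?r t \<partial>lborel) \<le> (\<integral>t. e' * CARD('n) * norm v * (\<bar>u t\<bar> * indicator (cball x (R + 1)) t) \<partial>lborel)"
    proof (rule order_trans[OF integral_norm_bound], rule integral_mono[OF integrable_norm[OF ri]])
      show "integrable lborel (\<lambda>t. e' * CARD('n) * norm v * (\<bar>u t\<bar> * indicator (cball x (R + 1)) t))"
        using Mi by simp
      fix t
      show "norm (u t * ?r t) \<le> e' * CARD('n) * norm v * (\<bar>u t\<bar> * indicator (cball x (R + 1)) t)"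
      proof (cases "t \<in> cball x (R + 1)")
        case True
        have "\<bar>?r t\<bar> * \<bar>u t\<bar> \<le> (e' * CARD('n) * norm v) * \<bar>u t\<bar>" by (intro mult_right_mono rem v) auto
        then show ?thesis using True by (simp add: abs_mult mult_ac)
      next
        case False
        then have 1: "norm (x - t) > R + 1" by (simp add: dist_norm)
        moreover have "norm (x - t) \<le> norm (x - t + v) + norm v"
          by (metis add_diff_cancel_right' norm_triangle_ineq4)
        ultimately have "norm (x - t + v) > R" using v1 by linarith
        then show ?thesis using 1 kz pz False by simp
      qed
    qed
    also have "\<dots> = e' * CARD('n) * norm v * M" by (simp add: M_def)
    also have "\<dots> \<le> e * norm v"
    proof -
      have "M + 1 \<noteq> 0" using M0 by linarith
      then have "e' * CARD('n) * (M + 1) = e" by (simp add: e'_def)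
      moreover have "e' * CARD('n) * M \<le> e' * CARD('n) * (M + 1)" using e' by (intro mult_left_mono) auto
      ultimately have "e' * CARD('n) * M \<le> e" by linarith
      then have "e' * CARD('n) * M * norm v \<le> e * norm v" by (rule mult_right_mono) simp
      then show ?thesis by (simp add: mult_ac)
    qed
    ultimately show "norm (conv \<kappa> u y - conv \<kappa> u x - (\<Sum>i\<in>UNIV. conv (partial i \<kappa>) u x * (y - x) $ i)) \<le> e * norm (y - x)"
      by (simp add: v_def)
  qed
qed

lemma partial_conv:
  assumes "test_fn \<kappa> UNIV" "L2 u" shows "partial i (conv \<kappa> u) = conv (partial i \<kappa>) u"
proof
  fix x
  show "partial i (conv \<kappa> u) x = conv (partial i \<kappa>) u x"
    using partial_eqI[OF conv_has_derivative[OF assms, of x], of i] by (simp add: axis_def if_distrib cong: if_cong)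
qed

text \<open>A partial derivative of a convolution is the convolution with a partial derivative of
  the kernel, again a test function; hence an induction over the order for all kernels at
  once.\<close>

lemma smooth_conv: assumes "test_fn \<kappa> UNIV" "L2 u" shows "smooth_on (conv \<kappa> u) UNIV"
proof -
  have d: "conv \<kappa> u differentiable at x" if "test_fn \<kappa> UNIV" for \<kappa> x
    using conv_has_derivative[OF that assms(2)] differentiable_def by blast
  have c: "continuous_on UNIV (conv \<kappa> u)" if "test_fn \<kappa> UNIV" for \<kappa>
    using d[OF that] differentiable_imp_continuous_within continuous_at_imp_continuous_on by blast
  have "test_fn \<kappa> UNIV \<Longrightarrow> Ck_on k (conv \<kappa> u) UNIV" for k \<kappa>
    by (induction k arbitrary: \<kappa>) (auto simp: c d partial_conv assms(2) test_fn_partial)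
  then show ?thesis using assms(1) by (simp add: smooth_on_def)
qed

lemma mollifier_kernel:
  assumes "\<delta> > 0" obtains \<eta> :: "real^'n \<Rightarrow> real" and B where "test_fn \<eta> UNIV" "kernel \<eta> \<delta> B"
proof -
  obtain \<eta> :: "real^'n \<Rightarrow> real" where t: "test_fn \<eta> UNIV" and p: "\<And>x. \<eta> x \<ge> 0"
    "\<And>x. norm x > \<delta> \<Longrightarrow> \<eta> x = 0" "(\<integral>x. \<eta> x \<partial>lborel) = 1"
    using exists_mollifier[OF assms] by blast
  obtain B where B: "\<And>x. \<bar>\<eta> x\<bar> \<le> B" using test_fn_bounded[OF t] by blast
  have "kernel \<eta> \<delta> B" unfolding kernel_def
    using p B L2_measurable[OF test_fn_L2[OF t]] test_fn_integrable[OF t] by (auto simp: abs_le_iff)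
  then show ?thesis using that t by blast
qed

abbreviation vconv :: "(real^'n \<Rightarrow> real) \<Rightarrow> (real^'n \<Rightarrow> real^'n) \<Rightarrow> real^'n \<Rightarrow> real^'n" where
  "vconv \<kappa> g x \<equiv> \<chi> i. conv \<kappa> (\<lambda>y. g y $ i) x"

lemma sob_conv:
  assumes t: "test_fn \<eta> UNIV" and k: "kernel \<eta> \<delta> B" and s: "sob u g"
  shows "sob (conv \<eta> u) (vconv \<eta> g)" "partial i (conv \<eta> u) = conv \<eta> (\<lambda>y. g y $ i)"
proof -
  show p: "partial i (conv \<eta> u) = conv \<eta> (\<lambda>y. g y $ i)" for i
    unfolding partial_conv[OF t sob_L2[OF s]] using conv_sob_partial[OF t s] by blast
  have "sob (conv \<eta> u) (\<lambda>x. \<chi> i. partial i (conv \<eta> u) x)"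
    by (rule sob_smooth[OF smooth_conv[OF t sob_L2[OF s]] conv_L2[OF k sob_L2[OF s]]])
       (simp add: p conv_L2[OF k] L2_component sob_grad_L2[OF s])
  then show "sob (conv \<eta> u) (vconv \<eta> g)" by (simp add: p)
qed

lemma L2_vec_shift_continuous:
  fixes g :: "'a::euclidean_space \<Rightarrow> real^'n"
  assumes g: "L2 g" and e: "e > 0"
  shows "\<exists>d>0. \<forall>h. norm h \<le> d \<longrightarrow> En (\<lambda>x. g (h + x) - g x) \<le> e"
proof -
  define e' where "e' = e / CARD('n)"
  have e': "e' > 0" using e by (simp add: e'_def)
  have "\<forall>i. \<exists>d>0. \<forall>h. norm h \<le> d \<longrightarrow> En (\<lambda>x. g (h + x) $ i - g x $ i) < e'"
  proof
    show "\<exists>d>0. \<forall>h. norm h \<le> d \<longrightarrow> En (\<lambda>x. g (h + x) $ i - g x $ i) < e'" for i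
      using L2_shift_continuous[OF L2_component[OF g, of i] e'] by metis
  qed
  from choice[OF this] obtain d where d: "\<And>i. d i > 0" "\<And>i h. norm h \<le> d i \<Longrightarrow> En (\<lambda>x. g (h + x) $ i - g x $ i) < e'"
    by blast
  show ?thesis
  proof (intro exI[of _ "Min (range d)"] conjI allI impI)
    show "0 < Min (range d)" using d(1) by simp
    fix h :: 'a assume h: "norm h \<le> Min (range d)"
    have "norm h \<le> d i" for i using order_trans[OF h Min_le[of "range d" "d i"]] by simp
    then have "En (\<lambda>x. g (h + x) - g x) \<le> (\<Sum>i\<in>(UNIV::'n set). e')"
      unfolding En_vec[OF L2_diff[OF L2_shift[OF g] g]] using d(2) by (intro sum_mono) (simp add: less_imp_le)
    then show "En (\<lambda>x. g (h + x) - g x) \<le> e" by (simp add: e'_def)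
  qed
qed

text \<open>One and the same mollifier serves u and all components of g, and its radius can be kept
  below d0 in order to control supports. The tolerance is divided by the dimension because
  \<open>En\<close> of a vector field is the sum over its components.\<close>

lemma mollifier_approx:
  fixes u :: "real^'n \<Rightarrow> real"
  assumes u: "L2 u" and g: "L2 g" and e: "e > 0" and d0: "d0 > 0"
  shows "\<exists>\<eta> \<delta> B. test_fn \<eta> UNIV \<and> kernel \<eta> \<delta> B \<and> \<delta> \<le> d0 \<and>
    En (\<lambda>x. conv \<eta> u x - u x) \<le> e \<and> En (\<lambda>x. vconv \<eta> g x - g x) \<le> e"
proof -
  define e' where "e' = e / CARD('n)"
  have e': "e' > 0" using e by (simp add: e'_def)
  obtain d1 where d1: "d1 > 0" "\<And>h. norm h \<le> d1 \<Longrightarrow> En (\<lambda>x. u (h + x) - u x) < e"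
    using L2_shift_continuous[OF u e] by blast
  obtain d2 where d2: "d2 > 0" "\<And>h. norm h \<le> d2 \<Longrightarrow> En (\<lambda>x. g (h + x) - g x) \<le> e'"
    using L2_vec_shift_continuous[OF g e'] by blast
  have d2i: "En (\<lambda>x. g (h + x) $ i - g x $ i) \<le> e'" if "norm h \<le> d2" for h i
    using En_component_le[OF L2_diff[OF L2_shift[OF g, of h] g], of i] d2(2)[OF that] by simp
  define \<delta> where "\<delta> = min d0 (min d1 d2)"
  have dp: "\<delta> > 0" using d2(1) d0 d1(1) by (simp add: \<delta>_def)
  obtain \<eta> :: "real^'n \<Rightarrow> real" and B where t: "test_fn \<eta> UNIV" and k: "kernel \<eta> \<delta> B"
    using mollifier_kernel[OF dp] by blast
  have "En (\<lambda>x. conv \<eta> u x - u x) \<le> e"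
    by (rule conv_approx(2)[OF k u]) (use d1(2) e in \<open>auto simp: \<delta>_def intro: less_imp_le\<close>)
  moreover have gi: "En (\<lambda>x. conv \<eta> (\<lambda>y. g y $ i) x - g x $ i) \<le> e'" for i
    by (rule conv_approx(2)[OF k L2_component[OF g]]) (use d2i e' in \<open>auto simp: \<delta>_def\<close>)
  have L: "L2 (\<lambda>x. vconv \<eta> g x - g x)"
    by (rule L2_vecI) (simp add: L2_diff conv_L2[OF k] L2_component[OF g])
  have "En (\<lambda>x. vconv \<eta> g x - g x) \<le> e"
  proof -
    have "En (\<lambda>x. vconv \<eta> g x - g x) \<le> (\<Sum>i\<in>(UNIV::'n set). e')"
      unfolding En_vec[OF L] by (intro sum_mono) (simp add: gi)
    then show ?thesis by (simp add: e'_def)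
  qed
  moreover have "\<delta> \<le> d0" by (simp add: \<delta>_def)
  ultimately show ?thesis using t k by blast
qed

text \<open>A mollified gradient is the convolution of the function itself with a derivative of the
  kernel. For the zero function it therefore vanishes, while mollifications of g come arbitrarily
  close to g.\<close>

lemma sob_unique_0:
  fixes g :: "real^'n \<Rightarrow> real^'n"
  assumes s: "sob (\<lambda>x. 0) g" shows "AE x in lborel. g x = 0"
proof -
  have "En g \<le> e" if pos: "e > 0" for e
  proof -
    note L = sob_L2[OF s] sob_grad_L2[OF s]
    obtain \<eta> :: "real^'n \<Rightarrow> real" and \<delta> B where t: "test_fn \<eta> UNIV" and k: "kernel \<eta> \<delta> B"
      and e: "En (\<lambda>x. vconv \<eta> g x - g x) \<le> e"
      using mollifier_approx[OF L pos zero_less_one] by blast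
    have "conv \<eta> (\<lambda>y. g y $ i) x = 0" for i x
      unfolding conv_sob_partial[OF t s, symmetric] by (simp add: conv_def)
    then show ?thesis using e by (simp add: En_def zero_vec_def[symmetric])
  qed
  then have "En g \<le> 0" by (rule dense_ge)
  then have "En g = 0" using En_nonneg[of g] by simp
  then show ?thesis using En_eq_0_AE sob_grad_L2[OF s] by blast
qed

lemma sob_unique:
  assumes "sob u g" "sob u g'" shows "AE x in lborel. g x = g' x"
proof -
  have "sob (\<lambda>x. 0) (\<lambda>x. g x - g' x)" using sob_diff[OF assms] by simp
  from sob_unique_0[OF this] show ?thesis by simp
qed

text \<open>The bridge from the choice operator: any known gradient may replace \<open>wgrad\<close>
  under an integral.\<close>

lemma sob_wgrad:
  assumes "sob u g" shows "sob u (wgrad u)" "AE x in lborel. wgrad u x = g x" "En (wgrad u) = En g"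
proof -
  have "weak_gradient u (wgrad u) \<and> integrable lborel (\<lambda>x. (norm (wgrad u x))\<^sup>2)"
    unfolding wgrad_def by (rule someI[of _ g]) (use assms in \<open>auto simp: sob_def L2_def\<close>)
  then show s: "sob u (wgrad u)" using sob_L2[OF assms] by (auto simp: sob_def L2_def weak_gradient_def)
  show a: "AE x in lborel. wgrad u x = g x" by (rule sob_unique[OF s assms])
  show "En (wgrad u) = En g"
    by (rule En_cong_AE[OF a]) (use sob_grad_L2[OF s] sob_grad_L2[OF assms] in \<open>auto simp: L2_def\<close>)
qed

lemma H1_norm_sob: assumes "sob u g" shows "H1_norm u = sqrt (En g + En u)"
proof -
  note s = sob_wgrad[OF assms]
  have "integrable lborel (\<lambda>x. (norm (wgrad u x))\<^sup>2)" "integrable lborel (\<lambda>x. (u x)\<^sup>2)"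
    using sob_L2[OF s(1)] sob_grad_L2[OF s(1)] by (auto simp: L2_def)
  then show ?thesis unfolding H1_norm_def s(3)[symmetric] by (simp add: En_def)
qed

section \<open>The translation estimate\<close>

text \<open>The increment is the integral over [0,1] of the derivative along the segment;
  Cauchy-Schwarz in that parameter bounds its square by the integral of the squared directional
  derivative.\<close>

lemma smooth_shift_estimate:
  fixes w :: "real^'n \<Rightarrow> real"
  assumes w: "smooth_on w UNIV" and g: "L2 (\<lambda>x. \<chi> i. partial i w x)" and wL: "L2 w"
  shows "En (\<lambda>x. w (h + x) - w x) \<le> (norm h)\<^sup>2 * En (\<lambda>x. \<chi> i. partial i w x)"
proof -
  let ?g = "\<lambda>x. \<chi> i. partial i w x"
  have wd: "w differentiable at x" for x by (rule smooth_on_differentiable[OF w])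
  have pc: "continuous_on UNIV (partial i w)" for i by (rule smooth_on_continuous[OF smooth_on_partial[OF w]])
  have gm[measurable]: "?g \<in> borel_measurable borel" using g by (rule L2_measurable)
  have pw: "ennreal ((norm (w (h + x) - w x))\<^sup>2)
      \<le> (\<integral>\<^sup>+s. ennreal (indicator {0..1} s * ((norm h)\<^sup>2 * (norm (?g (s *\<^sub>R h + x)))\<^sup>2)) \<partial>lborel)" for x
  proof -
    define d where "d s = (\<Sum>i\<in>UNIV. partial i w (s *\<^sub>R h + x) * h $ i)" for s :: real
    have D: "((\<lambda>s. w (s *\<^sub>R h + x)) has_real_derivative d s) (at s)" for s
    proof -
      have 1: "((\<lambda>s. s *\<^sub>R h + x) has_derivative (\<lambda>t. t *\<^sub>R h)) (at s)"
        by (auto intro!: derivative_eq_intros)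
      from has_derivative_compose[OF 1 has_derivative_partial[OF wd]]
      have "((\<lambda>s. w (s *\<^sub>R h + x)) has_derivative (\<lambda>t. \<Sum>i\<in>UNIV. partial i w (s *\<^sub>R h + x) * (t *\<^sub>R h) $ i)) (at s)" .
      moreover have "(\<lambda>t. \<Sum>i\<in>UNIV. partial i w (s *\<^sub>R h + x) * (t *\<^sub>R h) $ i) = (*) (d s)"
        by (rule ext) (simp add: d_def sum_distrib_left mult_ac)
      ultimately show ?thesis by (simp add: has_field_derivative_def)
    qed
    have dc: "continuous_on UNIV d" unfolding d_def
      by (intro continuous_intros continuous_on_compose2[OF pc]) auto
    have FTC: "(\<integral>s. d s * indicator {0..1} s \<partial>lborel) = w (1 *\<^sub>R h + x) - w (0 *\<^sub>R h + x)"
      by (rule integral_FTC_Icc_real) (use D dc in \<open>auto simp: continuous_on_eq_continuous_at\<close>)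
    have L1: "L2 (indicator {0..1::real} :: real \<Rightarrow> real)" and E1: "En (indicator {0..1::real} :: real \<Rightarrow> real) = 1"
      by (auto simp: L2_def En_def indicator_sq)
    have ic: "integrable lborel (\<lambda>s. indicator {0..1} s * f s)" if "continuous_on UNIV f" for f :: "real \<Rightarrow> real"
      using borel_integrable_compact[of "{0..1}" f] that continuous_on_subset by (auto simp: set_integrable_def)
    have Ld: "L2 (\<lambda>s. indicator {0..1} s * d s)"
    proof -
      have "integrable lborel (\<lambda>s. indicator {0..1} s * (d s)\<^sup>2)" by (intro ic continuous_intros dc)
      moreover have "(\<lambda>s. indicator {0..1} s * d s) \<in> borel_measurable borel"
        using ic[OF dc] by (simp add: borel_measurable_integrable)
      ultimately show ?thesis by (simp add: L2_def power_mult_distrib indicator_sq)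
    qed
    have gc: "continuous_on UNIV (\<lambda>s. (norm (?g (s *\<^sub>R h + x)))\<^sup>2)"
      unfolding norm_vec_sq by (auto intro!: continuous_intros continuous_on_compose2[OF pc])
    have dle: "(d s)\<^sup>2 \<le> (norm h)\<^sup>2 * (norm (?g (s *\<^sub>R h + x)))\<^sup>2" for s
    proof -
      have "d s = ?g (s *\<^sub>R h + x) \<bullet> h" by (simp add: d_def inner_vec_def)
      then have "\<bar>d s\<bar> \<le> norm (?g (s *\<^sub>R h + x)) * norm h" using Cauchy_Schwarz_ineq2 by metis
      from power_mono[OF this, of 2] show ?thesis by (simp add: power_mult_distrib mult.commute)
    qed
    have "(w (h + x) - w x)\<^sup>2 = (\<integral>s. indicator {0..1} s * (indicator {0..1} s * d s) \<partial>lborel)\<^sup>2"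
    proof -
      have "(\<integral>s. indicator {0..1} s * (indicator {0..1} s * d s) \<partial>lborel) = (\<integral>s. d s * indicator {0..1} s \<partial>lborel)"
        by (rule Bochner_Integration.integral_cong) (auto simp: indicator_def)
      then show ?thesis using FTC by simp
    qed
    also have "\<dots> \<le> En (indicator {0..1::real} :: real \<Rightarrow> real) * En (\<lambda>s. indicator {0..1} s * d s)"
      by (rule L2_Cauchy_Schwarz[OF L1 Ld])
    also have "\<dots> = (\<integral>s. indicator {0..1} s * (d s)\<^sup>2 \<partial>lborel)"
      by (simp add: E1 En_def power_mult_distrib indicator_sq)
    also have "\<dots> \<le> (\<integral>s. indicator {0..1} s * ((norm h)\<^sup>2 * (norm (?g (s *\<^sub>R h + x)))\<^sup>2) \<partial>lborel)"
      by (intro integral_mono ic continuous_intros dc gc mult_left_mono dle) auto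
    finally have "(w (h + x) - w x)\<^sup>2 \<le> \<dots>" .
    moreover have "(\<integral>\<^sup>+s. ennreal (indicator {0..1} s * ((norm h)\<^sup>2 * (norm (?g (s *\<^sub>R h + x)))\<^sup>2)) \<partial>lborel)
       = ennreal (\<integral>s. indicator {0..1} s * ((norm h)\<^sup>2 * (norm (?g (s *\<^sub>R h + x)))\<^sup>2) \<partial>lborel)"
      by (intro nn_integral_eq_integral ic continuous_intros gc) auto
    ultimately show ?thesis by (simp add: ennreal_leI)
  qed
  have "(\<integral>\<^sup>+x. ennreal ((norm (w (h + x) - w x))\<^sup>2) \<partial>lborel)
     \<le> (\<integral>\<^sup>+x. \<integral>\<^sup>+s. ennreal (indicator {0..1} s * ((norm h)\<^sup>2 * (norm (?g (s *\<^sub>R h + x)))\<^sup>2)) \<partial>lborel \<partial>lborel)"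
    by (rule nn_integral_mono) (rule pw)
  \<comment> \<open>After the exchange the inner integral is taken over a translate of the gradient,
    so its value is the same for every s.\<close>
  also have "\<dots> = (\<integral>\<^sup>+s. \<integral>\<^sup>+x. ennreal (indicator {0..1} s * ((norm h)\<^sup>2 * (norm (?g (s *\<^sub>R h + x)))\<^sup>2)) \<partial>lborel \<partial>lborel)"
    by (rule lborel_pair.Fubini') simp
  also have "\<dots> = (\<integral>\<^sup>+s. ennreal ((norm h)\<^sup>2 * En ?g) * indicator {0..1::real} s \<partial>lborel)"
  proof (rule nn_integral_cong)
    fix s :: real
    have "(\<integral>\<^sup>+x. ennreal (indicator {0..1} s * ((norm h)\<^sup>2 * (norm (?g (s *\<^sub>R h + x)))\<^sup>2)) \<partial>lborel)
       = ennreal (indicator {0..1} s * (norm h)\<^sup>2) * (\<integral>\<^sup>+x. ennreal ((norm (?g (s *\<^sub>R h + x)))\<^sup>2) \<partial>lborel)"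
      by (subst nn_integral_cmult[symmetric]) (auto simp: ennreal_mult[symmetric] mult.assoc)
    also have "\<dots> = ennreal (indicator {0..1} s * (norm h)\<^sup>2) * ennreal (En ?g)"
      using nn_integral_En[OF L2_shift[OF g], of "s *\<^sub>R h"] En_shift[of ?g "s *\<^sub>R h"] by simp
    also have "\<dots> = ennreal ((norm h)\<^sup>2 * En ?g) * indicator {0..1::real} s"
      by (auto simp: indicator_def ennreal_mult En_nonneg)
    finally show "(\<integral>\<^sup>+x. ennreal (indicator {0..1} s * ((norm h)\<^sup>2 * (norm (?g (s *\<^sub>R h + x)))\<^sup>2)) \<partial>lborel)
       = ennreal ((norm h)\<^sup>2 * En ?g) * indicator {0..1::real} s" .
  qed
  also have "\<dots> = ennreal ((norm h)\<^sup>2 * En ?g)" by (subst nn_integral_cmult_indicator) auto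
  finally show ?thesis
    by (rule L2_nnI(2)[rotated]) (use L2_diff[OF L2_shift[OF wL] wL, of h] in \<open>auto simp: L2_def En_nonneg\<close>)
qed

text \<open>Mollification reduces the claim to the smooth case. The constant 8 is the price of the
  squared triangle inequalities on the way.\<close>

lemma sob_shift_estimate:
  fixes u :: "real^'n \<Rightarrow> real"
  assumes s: "sob u g" shows "En (\<lambda>x. u (h + x) - u x) \<le> 8 * (norm h)\<^sup>2 * En g"
proof (rule field_le_epsilon)
  fix e :: real assume e: "e > 0"
  note L = sob_L2[OF s] sob_grad_L2[OF s]
  \<comment> \<open>The denominator collects all error terms: 6 from comparing u with its
    mollification, 8 |h|^2 from replacing the mollified gradient by g.\<close>
  define e' where "e' = e / (6 + 8 * (norm h)\<^sup>2)"
  have p: "6 + 8 * (norm h)\<^sup>2 > 0" by (simp add: add_pos_nonneg)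
  have e': "e' > 0" using e p by (simp add: e'_def)
  obtain \<eta> :: "real^'n \<Rightarrow> real" and \<delta> B where t: "test_fn \<eta> UNIV" and k: "kernel \<eta> \<delta> B"
    and a: "En (\<lambda>x. conv \<eta> u x - u x) \<le> e'" "En (\<lambda>x. vconv \<eta> g x - g x) \<le> e'"
    using mollifier_approx[OF L e' zero_less_one] by blast
  let ?w = "conv \<eta> u" and ?k = "vconv \<eta> g"
  note c = sob_conv[OF t k s]
  have wL: "L2 ?w" and kL: "L2 ?k" using c(1) by (auto simp: sob_def)
  have 1: "En (\<lambda>x. ?w (h + x) - ?w x) \<le> (norm h)\<^sup>2 * En ?k"
    using smooth_shift_estimate[OF smooth_conv[OF t L(1)] _ wL, of h] kL by (simp add: c(2))
  have 2: "En ?k \<le> 2 * En (\<lambda>x. ?k x - g x) + 2 * En g"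
    using En_add_le[OF L2_diff[OF kL L(2)] L(2)] by simp
  have 3: "En (\<lambda>x. u (h + x) - u x) \<le> 2 * En (\<lambda>x. u (h + x) - ?w (h + x)) + 2 * En (\<lambda>x. ?w (h + x) - u x)"
    by (rule En_triangle) (intro L2_shift L wL)+
  have 4: "En (\<lambda>x. u (h + x) - ?w (h + x)) = En (\<lambda>x. ?w x - u x)"
    using En_shift[where f="\<lambda>x. u x - ?w x"] En_minus_commute by metis
  have 5: "En (\<lambda>x. ?w (h + x) - u x) \<le> 2 * En (\<lambda>x. ?w (h + x) - ?w x) + 2 * En (\<lambda>x. ?w x - u x)"
    by (rule En_triangle) (intro L2_shift L wL)+
  have "(norm h)\<^sup>2 * En ?k \<le> (norm h)\<^sup>2 * (2 * e' + 2 * En g)"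
    using 2 a(2) by (intro mult_left_mono) auto
  then have "En (\<lambda>x. u (h + x) - u x) \<le> 6 * e' + 4 * ((norm h)\<^sup>2 * (2 * e' + 2 * En g))"
    using 1 3 4 5 a(1) by linarith
  also have "\<dots> = (6 + 8 * (norm h)\<^sup>2) * e' + 8 * (norm h)\<^sup>2 * En g" by (simp add: algebra_simps)
  also have "(6 + 8 * (norm h)\<^sup>2) * e' = e" using p by (simp add: e'_def)
  finally show "En (\<lambda>x. u (h + x) - u x) \<le> 8 * (norm h)\<^sup>2 * En g + e" by simp
qed

section \<open>Ball averages\<close>

definition ball_kernel :: "real \<Rightarrow> 'a::euclidean_space \<Rightarrow> real" where
  "ball_kernel R h = indicator (cball 0 R) h / measure lborel (cball (0::'a) R)"

lemma kernel_ball_kernel: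
  assumes "R > 0"
  shows "kernel (ball_kernel R :: 'a::euclidean_space \<Rightarrow> real) R (1 / measure lborel (cball (0::'a) R))"
proof -
  have p: "measure lborel (cball (0::'a) R) > 0" using content_cball_pos[OF assms] by simp
  have f: "emeasure lborel (cball (0::'a) R) < \<infinity>" by (rule emeasure_bounded_finite) simp
  have i: "integrable lborel (indicator (cball (0::'a) R) :: 'a \<Rightarrow> real)"
    using f by (simp add: integrable_indicator_iff)
  have ik: "integrable lborel (ball_kernel R :: 'a \<Rightarrow> real)"
    unfolding ball_kernel_def by (rule integrable_divide[OF i])
  have "(\<integral>h. ball_kernel R h \<partial>lborel) = (\<integral>h. indicator (cball (0::'a) R) h \<partial>lborel) / measure lborel (cball (0::'a) R)"
    unfolding ball_kernel_def by simp
  also have "\<dots> = 1" using p by simp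
  finally have 1: "(\<integral>h. ball_kernel R (h::'a) \<partial>lborel) = 1" .
  have m: "(ball_kernel R :: 'a \<Rightarrow> real) \<in> borel_measurable borel"
    using borel_measurable_integrable[OF ik] by simp
  have "0 \<le> ball_kernel R h \<and> ball_kernel R h \<le> 1 / measure lborel (cball (0::'a) R)" for h :: 'a
    using p by (auto simp: ball_kernel_def indicator_def)
  moreover have "ball_kernel R h = 0" if "norm h > R" for h :: 'a
    using that by (simp add: ball_kernel_def)
  ultimately show ?thesis unfolding kernel_def using ik 1 m by blast
qed

lemma sob_conv_approx:
  fixes u \<kappa> :: "real^'n \<Rightarrow> real"
  assumes s: "sob u g" and k: "kernel \<kappa> R B" and R: "R \<ge> 0"
  shows "L2 (\<lambda>x. conv \<kappa> u x - u x)" "En (\<lambda>x. conv \<kappa> u x - u x) \<le> 8 * R\<^sup>2 * En g"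
proof -
  have D: "En (\<lambda>x. u (h + x) - u x) \<le> 8 * R\<^sup>2 * En g" if "norm h \<le> R" for h
  proof -
    have "8 * (norm h)\<^sup>2 * En g \<le> 8 * R\<^sup>2 * En g"
      using that by (intro mult_right_mono mult_left_mono power_mono) (auto simp: En_nonneg)
    then show ?thesis using sob_shift_estimate[OF s, of h] by linarith
  qed
  show "L2 (\<lambda>x. conv \<kappa> u x - u x)" "En (\<lambda>x. conv \<kappa> u x - u x) \<le> 8 * R\<^sup>2 * En g"
    using conv_approx(1,2)[OF k sob_L2[OF s] D] by (auto simp: En_nonneg)
qed

lemma L2_indicator:
  fixes f :: "'a::euclidean_space \<Rightarrow> real"
  assumes "S \<in> sets borel" "L2 f"
  shows "L2 (\<lambda>x. indicator S x * f x)" "En (\<lambda>x. indicator S x * f x) \<le> En f"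
proof -
  have "(indicator S :: 'a \<Rightarrow> real) \<in> borel_measurable lborel" using assms(1) by simp
  from L2_bounded_mult[OF this _ assms(2), of 1]
  show "L2 (\<lambda>x. indicator S x * f x)" "En (\<lambda>x. indicator S x * f x) \<le> En f" by (auto simp: indicator_def)
qed

lemma En_split_indicator:
  fixes f :: "'a::euclidean_space \<Rightarrow> real"
  assumes S: "S \<in> sets borel" and f: "L2 f"
  shows "En f = En (\<lambda>x. indicator S x * f x) + En (\<lambda>x. indicator (- S) x * f x)"
proof -
  have "- S \<in> sets borel" using S by (simp add: borel_comp)
  then have "integrable lborel (\<lambda>x. (indicator S x * f x)\<^sup>2)" "integrable lborel (\<lambda>x. (indicator (- S) x * f x)\<^sup>2)"
    using L2_indicator(1)[OF S f] L2_indicator(1)[OF _ f, of "- S"] by (auto simp: L2_def)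
  then have "En (\<lambda>x. indicator S x * f x) + En (\<lambda>x. indicator (- S) x * f x)
     = (\<integral>x. (indicator S x * f x)\<^sup>2 + (indicator (- S) x * f x)\<^sup>2 \<partial>lborel)"
    by (simp add: En_def)
  also have "\<dots> = En f" unfolding En_def by (rule Bochner_Integration.integral_cong) (auto simp: indicator_def)
  finally show ?thesis by simp
qed

text \<open>On S the function is compared with its average: the squared average is at most
  \<open>B * En u\<close>, so S enters only through its measure, and the error is paid for by the
  gradient. Large balls make B small, as in the Poincare inequality; small balls make the gradient
  term small, as in the tightness argument.\<close>

lemma En_small_set:
  fixes u \<kappa> :: "real^'n \<Rightarrow> real"
  assumes s: "sob u g" and S: "S \<in> sets borel" "emeasure lborel S < \<infinity>" and k: "kernel \<kappa> R B" and R: "R \<ge> 0"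
  shows "En (\<lambda>x. indicator S x * u x) \<le> 2 * B * measure lborel S * En u + 16 * R\<^sup>2 * En g"
proof -
  note u = sob_L2[OF s]
  note c = sob_conv_approx[OF s k R] and cL = conv_L2[OF k u]
  have "En (\<lambda>x. indicator S x * u x) = En (\<lambda>x. indicator S x * conv \<kappa> u x - indicator S x * (conv \<kappa> u x - u x))"
    by (simp add: algebra_simps)
  also have "\<dots> \<le> 2 * En (\<lambda>x. indicator S x * conv \<kappa> u x) + 2 * En (\<lambda>x. indicator S x * (conv \<kappa> u x - u x))"
    by (intro En_diff_le L2_indicator S cL c)
  also have "En (\<lambda>x. indicator S x * (conv \<kappa> u x - u x)) \<le> 8 * R\<^sup>2 * En g"
    using L2_indicator(2)[OF S(1) c(1)] c(2) by linarith
  also have "En (\<lambda>x. indicator S x * conv \<kappa> u x) \<le> (\<integral>x. indicator S x * (B * En u) \<partial>lborel)"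
    unfolding En_def
  proof (rule integral_mono)
    show "integrable lborel (\<lambda>x. (norm (indicator S x * conv \<kappa> u x))\<^sup>2)"
      using L2_indicator(1)[OF S(1) cL] by (simp add: L2_def)
    show "integrable lborel (\<lambda>x. indicator S x * (B * (\<integral>x. (norm (u x))\<^sup>2 \<partial>lborel)))"
      using S by (intro integrable_mult_left) (simp add: integrable_indicator_iff)
    show "(norm (indicator S x * conv \<kappa> u x))\<^sup>2 \<le> indicator S x * (B * (\<integral>x. (norm (u x))\<^sup>2 \<partial>lborel))" for x
      using conv_bound[OF k u, of x] by (auto simp: indicator_def En_def)
  qed
  also have "(\<integral>x. indicator S x * (B * En u) \<partial>lborel) = measure lborel S * (B * En u)" by simp
  finally show ?thesis by (simp add: algebra_simps)
qed

lemma ball_kernel_radius: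
  fixes c :: real assumes "c > 0"
  shows "\<exists>R>0. measure lborel (cball (0::'a::euclidean_space) R) = c"
proof -
  let ?w = "unit_ball_vol (DIM('a))"
  have w: "?w > 0" by (simp add: unit_ball_vol_pos)
  define R where "R = root (DIM('a)) (c / ?w)"
  have "R > 0" using assms w by (simp add: R_def)
  moreover have "R ^ DIM('a) = c / ?w" using assms w unfolding R_def by (intro real_root_pow_pos2) auto
  ultimately show ?thesis using w content_cball[of R "0::'a"] by (intro exI[of _ R]) auto
qed

lemma En_poincare:
  fixes S :: "(real^'n) set"
  assumes S: "S \<in> sets borel" "emeasure lborel S < \<infinity>"
  obtains C where "C \<ge> 0"
    "\<And>u g. sob u g \<Longrightarrow> En u \<le> C * En g + 2 * En (\<lambda>x. indicator (- S) x * u x)"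
proof -
  \<comment> \<open>This volume makes the coefficient of \<open>En u\<close> at most 1/2, so that
    term is absorbed and the gradient coefficient doubles from 16 to 32. The added 1 keeps the
    volume positive when S is a null set.\<close>
  obtain R where R: "R > 0" "measure lborel (cball (0::real^'n) R) = 4 * (measure lborel S + 1)"
    using ball_kernel_radius[of "4 * (measure lborel S + 1)", where 'a="real^'n"]
    by (metis add_nonneg_pos measure_nonneg mult_pos_pos zero_less_numeral zero_less_one)
  show ?thesis
  proof (rule that[of "32 * R\<^sup>2"])
    fix u :: "real^'n \<Rightarrow> real" and g assume s: "sob u g"
    let ?B = "1 / measure lborel (cball (0::real^'n) R)"
    have "En (\<lambda>x. indicator S x * u x) \<le> 2 * ?B * measure lborel S * En u + 16 * R\<^sup>2 * En g"
      by (rule En_small_set[OF s S kernel_ball_kernel[OF R(1)]]) (use R in simp)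
    moreover have "2 * (1 / (4 * (m + 1))) * m \<le> 1/2" if "m \<ge> 0" for m :: real
      using that by (simp add: divide_le_eq)
    from this[OF measure_nonneg[of lborel S]] have "2 * ?B * measure lborel S \<le> 1/2" unfolding R(2) .
    then have "2 * ?B * measure lborel S * En u \<le> 1/2 * En u" by (rule mult_right_mono) (simp add: En_nonneg)
    ultimately show "En u \<le> 32 * R\<^sup>2 * En g + 2 * En (\<lambda>x. indicator (- S) x * u x)"
      using En_split_indicator[OF S(1) sob_L2[OF s]] by linarith
  qed simp
qed

section \<open>Subcritical Sobolev embedding\<close>

text \<open>If |u| > t but the average of u over a ball of radius R is at most t/2, then u is controlled by its
  distance to the average; balancing R against a bound for the p-norm of u gains integrability.\<close>

lemma level_set_estimate:
  fixes u :: "real^'n \<Rightarrow> real"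
  assumes s: "sob u g" and p: "p \<ge> 2" and t: "t > 0" and K: "K > 0"
    and uK: "(\<integral>\<^sup>+x. ennreal (\<bar>u x\<bar> powr p) \<partial>lborel) \<le> ennreal K"
  shows "En (\<lambda>x. indicator {x. \<bar>u x\<bar> > t} x * u x)
    \<le> 32 * (K * 4 powr p / unit_ball_vol (CARD('n))) powr (2 / CARD('n)) * t powr (- 2 * p / CARD('n)) * En g"
proof -
  let ?N = "CARD('n)" and ?w = "unit_ball_vol (CARD('n))"
  have w: "?w > 0" by (simp add: unit_ball_vol_pos)
  then have w0: "?w \<noteq> 0" by linarith
  \<comment> \<open>The volume of the averaging ball. Values of u above t/4 contribute at most
    (t/4)^(1-p) K / c to an average, and this c makes the bound equal to t/4.\<close>
  define c where "c = K * (4 / t) powr p"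
  have c: "c > 0" using K t by (simp add: c_def)
  define R where "R = (c / ?w) powr (1 / ?N)"
  have R: "R > 0" using c w0 by (simp add: R_def)
  have "R ^ ?N = R powr ?N" using R by (simp add: powr_realpow)
  also have "\<dots> = c / ?w" unfolding R_def using c w by (simp add: powr_powr less_imp_le)
  finally have vol: "measure lborel (cball (0::real^'n) R) = c" using w0 R by (simp add: content_cball)
  let ?\<kappa> = "ball_kernel R :: real^'n \<Rightarrow> real"
  have k: "kernel ?\<kappa> R (1 / c)" using kernel_ball_kernel[OF R, where 'a="real^'n"] vol by simp
  note u = sob_L2[OF s] and cv = sob_conv_approx[OF s k less_imp_le[OF R]]
  have um[measurable]: "u \<in> borel_measurable borel" using u by (rule L2_measurable)
  have ip: "integrable lborel (\<lambda>x. \<bar>u x\<bar> powr p)"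
    by (rule integrableI_bounded) (use uK in \<open>auto simp: order_le_less_trans[OF _ ennreal_less_top]\<close>)
  have iK: "(\<integral>x. \<bar>u x\<bar> powr p \<partial>lborel) \<le> K"
  proof -
    have "ennreal (\<integral>x. \<bar>u x\<bar> powr p \<partial>lborel) = (\<integral>\<^sup>+x. ennreal (\<bar>u x\<bar> powr p) \<partial>lborel)"
      by (rule nn_integral_eq_integral[symmetric]) (use ip in auto)
    from ord_eq_le_trans[OF this uK] show ?thesis using K by (simp add: ennreal_le_iff)
  qed
  have avg: "\<bar>conv ?\<kappa> u x\<bar> \<le> t / 2" for x
  proof -
    define a where "a = t / 4"
    have a: "a > 0" using t by (simp add: a_def)
    \<comment> \<open>Values up to a contribute at most a to a mean; larger ones are dominated by
      their p-th power because 1 - p is negative.\<close>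
    have pw: "\<bar>y\<bar> \<le> a + a powr (1 - p) * \<bar>y\<bar> powr p" for y :: real
    proof (cases "\<bar>y\<bar> \<le> a")
      case True then show ?thesis by (simp add: add_increasing2)
    next
      case False
      then have y: "\<bar>y\<bar> > a" "\<bar>y\<bar> > 0" using a by auto
      have "\<bar>y\<bar> = \<bar>y\<bar> powr (1 - p) * \<bar>y\<bar> powr p" using y by (simp flip: powr_add)
      also have "\<dots> \<le> a powr (1 - p) * \<bar>y\<bar> powr p"
        using y a p by (intro mult_right_mono powr_mono2') auto
      finally show ?thesis using a by linarith
    qed
    have ki: "integrable lborel ?\<kappa>" and k1: "(\<integral>h. ?\<kappa> h \<partial>lborel) = 1" and k0: "\<And>h. 0 \<le> ?\<kappa> h" "\<And>h. ?\<kappa> h \<le> 1 / c"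
      using k unfolding kernel_def by blast+
    have [measurable]: "?\<kappa> \<in> borel_measurable borel" using k unfolding kernel_def by blast
    have ir: "integrable lborel (\<lambda>h. \<bar>u (x - h)\<bar> powr p)" and er: "(\<integral>h. \<bar>u (x - h)\<bar> powr p \<partial>lborel) \<le> K"
      unfolding lborel_integral_reflect[OF borel_measurable_integrable[OF ip], of x] by (rule ip iK)+
    have "\<bar>conv ?\<kappa> u x\<bar> \<le> (\<integral>h. \<bar>?\<kappa> h * u (x - h)\<bar> \<partial>lborel)" unfolding conv_def by (rule integral_abs_bound)
    also have "\<dots> \<le> (\<integral>h. a * ?\<kappa> h + a powr (1 - p) * (1 / c) * \<bar>u (x - h)\<bar> powr p \<partial>lborel)"
    proof (rule integral_mono)
      show "integrable lborel (\<lambda>h. \<bar>?\<kappa> h * u (x - h)\<bar>)" using conv_integrable[OF k u] by (rule integrable_abs)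
      show "integrable lborel (\<lambda>h. a * ?\<kappa> h + a powr (1 - p) * (1 / c) * \<bar>u (x - h)\<bar> powr p)"
        using ki ir by simp
      fix h
      have "\<bar>?\<kappa> h * u (x - h)\<bar> \<le> ?\<kappa> h * (a + a powr (1 - p) * \<bar>u (x - h)\<bar> powr p)"
        using k0[of h] pw by (auto simp: abs_mult intro!: mult_left_mono)
      also have "\<dots> = a * ?\<kappa> h + ?\<kappa> h * (a powr (1 - p) * \<bar>u (x - h)\<bar> powr p)" by (simp add: algebra_simps)
      also have "?\<kappa> h * (a powr (1 - p) * \<bar>u (x - h)\<bar> powr p) \<le> (1 / c) * (a powr (1 - p) * \<bar>u (x - h)\<bar> powr p)"
        by (intro mult_right_mono k0) auto
      finally show "\<bar>?\<kappa> h * u (x - h)\<bar> \<le> a * ?\<kappa> h + a powr (1 - p) * (1 / c) * \<bar>u (x - h)\<bar> powr p"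
        by (simp add: mult_ac)
    qed
    also have "\<dots> = a + a powr (1 - p) * (1 / c) * (\<integral>h. \<bar>u (x - h)\<bar> powr p \<partial>lborel)"
      using ki ir k1 by simp
    also have "\<dots> \<le> a + a powr (1 - p) * (1 / c) * K"
      using er c a by (intro add_left_mono mult_left_mono) auto
    also have "a powr (1 - p) * (1 / c) * K = a"
    proof -
      have "(4 / t) powr p = a powr (- p)" using t by (simp add: a_def powr_minus powr_divide divide_simps)
      then have "a powr (1 - p) * (1 / c) * K = a powr (1 - p) * (1 / a powr (- p))"
        using K by (simp add: c_def)
      also have "\<dots> = a powr (1 - p) * a powr p" by (simp add: powr_minus divide_simps)
      also have "\<dots> = a" using a by (simp flip: powr_add)
      finally show ?thesis .
    qed
    finally show ?thesis by (simp add: a_def)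
  qed
  have Sm: "{x. \<bar>u x\<bar> > t} \<in> sets borel" by measurable
  have "En (\<lambda>x. indicator {x. \<bar>u x\<bar> > t} x * u x) \<le> (\<integral>x. 4 * (norm (conv ?\<kappa> u x - u x))\<^sup>2 \<partial>lborel)"
    unfolding En_def
  proof (rule integral_mono)
    show "integrable lborel (\<lambda>x. (norm (indicator {x. \<bar>u x\<bar> > t} x * u x))\<^sup>2)"
      using L2_indicator(1)[OF Sm u] by (simp add: L2_def)
    show "integrable lborel (\<lambda>x. 4 * (norm (conv ?\<kappa> u x - u x))\<^sup>2)" using cv(1) by (simp add: L2_def)
    fix x
    show "(norm (indicator {x. \<bar>u x\<bar> > t} x * u x))\<^sup>2 \<le> 4 * (norm (conv ?\<kappa> u x - u x))\<^sup>2"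
    \<comment> \<open>Where |u| > t, the average is below |u|/2 in modulus, so |u| is at most twice
      its distance to the average; squaring gives the factor 4.\<close>
    proof (cases "\<bar>u x\<bar> > t")
      case True
      moreover have "\<bar>b\<bar> \<le> 2 * \<bar>a - b\<bar>" if "\<bar>b\<bar> > t" "\<bar>a\<bar> \<le> t / 2" for a b
        using that abs_triangle_ineq2_sym[of b a] by argo
      ultimately have "\<bar>u x\<bar> \<le> 2 * \<bar>conv ?\<kappa> u x - u x\<bar>" using avg[of x] by blast
      from power_mono[OF this, of 2] show ?thesis using True by (simp add: power_mult_distrib)
    qed simp
  qed
  also have "\<dots> = 4 * En (\<lambda>x. conv ?\<kappa> u x - u x)" by (simp add: En_def)
  also have "\<dots> \<le> 4 * (8 * R\<^sup>2 * En g)" by (intro mult_left_mono cv(2)) auto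
  also have "R\<^sup>2 = (K * 4 powr p / ?w) powr (2 / ?N) * t powr (- 2 * p / ?N)"
  proof -
    have "R\<^sup>2 = R powr 2" using R by simp
    also have "\<dots> = (c / ?w) powr (2 / ?N)" by (simp add: R_def powr_powr)
    also have "c / ?w = (K * 4 powr p / ?w) * t powr (- p)"
    proof -
      have "(4 / t) powr p = 4 powr p * t powr (- p)" 
        using powr_mult[of 4 "inverse t" p] t by (simp add: inverse_powr powr_minus divide_inverse)
      then show ?thesis unfolding c_def by simp
    qed
    also have "\<dots> powr (2 / ?N) = (K * 4 powr p / ?w) powr (2 / ?N) * (t powr (- p)) powr (2 / ?N)"
      using K w by (intro powr_mult)
    finally show ?thesis by (simp add: powr_powr mult.commute)
  qed
  finally show ?thesis by (simp add: mult_ac)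
qed

text \<open>Boundedness of the embedding of H^1 into L^p, in the form that bounded sets go to
  bounded sets. The \<open>itself\<close> argument fixes the dimension, which p alone does not
  determine.\<close>

definition sob_embeds :: "'n::finite itself \<Rightarrow> real \<Rightarrow> bool" where
  "sob_embeds _ p \<longleftrightarrow> (\<forall>M. \<exists>C. \<forall>(u::real^'n \<Rightarrow> real) g. sob u g \<longrightarrow> En u \<le> M \<longrightarrow> En g \<le> M \<longrightarrow>
     (\<integral>\<^sup>+x. ennreal (\<bar>u x\<bar> powr p) \<partial>lborel) \<le> ennreal C)"

lemma two_pow_powr: "(2 ^ n) powr s = ((2::real) powr s) ^ n"
  by (induction n) (auto simp: powr_mult)

text \<open>For |y| > 1 a single term of the series already suffices: with 2^k < |y| <= 2^(k+1), the
  factor |y|^(r-2) is bounded at the upper end of the interval, whence the exponent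
  \<open>Suc k\<close>, while the condition tests the lower end.\<close>

lemma powr_dyadic_bound:
  fixes y r :: real assumes r: "r \<ge> 2"
  shows "ennreal (\<bar>y\<bar> powr r) \<le> ennreal (y\<^sup>2) + (\<Sum>k. ennreal ((2 powr (r - 2)) ^ Suc k * (if \<bar>y\<bar> > 2 ^ k then y\<^sup>2 else 0)))"
proof (cases "\<bar>y\<bar> \<le> 1")
  case True
  have "\<bar>y\<bar> powr r \<le> y\<^sup>2"
  proof (cases "y = 0")
    case False
    then have "\<bar>y\<bar> powr r \<le> \<bar>y\<bar> powr 2" using True r by (intro powr_mono') auto
    then show ?thesis using False by simp
  qed simp
  then show ?thesis by (intro add_increasing2) (auto intro: ennreal_leI)
next
  case False
  define n where "n = (LEAST n. \<bar>y\<bar> \<le> 2 ^ n)"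
  have ex: "\<exists>n. \<bar>y\<bar> \<le> 2 ^ n" using real_arch_pow[of 2 "\<bar>y\<bar>"] less_imp_le by auto
  have n: "\<bar>y\<bar> \<le> 2 ^ n" unfolding n_def by (rule LeastI_ex[OF ex])
  have "n \<noteq> 0" using n False by (metis power_0)
  then obtain k where k: "n = Suc k" using not0_implies_Suc by blast
  have gt: "\<bar>y\<bar> > 2 ^ k" using not_less_Least[of k "\<lambda>n. \<bar>y\<bar> \<le> 2 ^ n"] k by (simp add: n_def)
  have "\<bar>y\<bar> powr r = \<bar>y\<bar> powr (r - 2) * \<bar>y\<bar> powr 2" using powr_add[of "\<bar>y\<bar>" "r - 2" 2] by simp
  also have "\<dots> \<le> (2 ^ n) powr (r - 2) * \<bar>y\<bar> powr 2"
    using n r by (intro mult_right_mono powr_mono2) auto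
  also have "(2 ^ n) powr (r - 2) = (2 powr (r - 2)) ^ Suc k"
    unfolding k by (rule two_pow_powr)
  also have "\<bar>y\<bar> powr 2 = y\<^sup>2" using False by simp
  finally have "ennreal (\<bar>y\<bar> powr r) \<le> ennreal ((2 powr (r - 2)) ^ Suc k * (if \<bar>y\<bar> > 2 ^ k then y\<^sup>2 else 0))"
    using gt by (simp add: ennreal_leI)
  also have "\<dots> \<le> (\<Sum>k. ennreal ((2 powr (r - 2)) ^ Suc k * (if \<bar>y\<bar> > 2 ^ k then y\<^sup>2 else 0)))"
    using sum_le_suminf[of "\<lambda>k. ennreal ((2 powr (r - 2)) ^ Suc k * (if \<bar>y\<bar> > 2 ^ k then y\<^sup>2 else 0))" "{k}"]
    by (simp only: sum.insert sum.empty finite.intros empty_iff not_False_eq_True add_0_right zero_le summableI)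
  finally show ?thesis by (intro add_increasing) auto
qed

text \<open>By the level-set estimate the part of u above 2^k has L2 energy of order (2^k)^(-2p/N),
  and it enters with weight of order (2^k)^(r-2). The hypothesis on r is exactly the convergence of
  the resulting geometric series, whose ratio is \<open>q\<close>.\<close>

lemma sob_embeds_bootstrap:
  assumes e: "sob_embeds TYPE('n::finite) p" and p: "p \<ge> 2" and r: "r \<ge> 2" "r - 2 < 2 * p / CARD('n)"
  shows "sob_embeds TYPE('n) r"
  unfolding sob_embeds_def
proof
  fix M :: real
  let ?N = "real CARD('n)" and ?w = "unit_ball_vol (CARD('n))"
  obtain K0 where K0: "\<And>(u::real^'n \<Rightarrow> real) g. sob u g \<Longrightarrow> En u \<le> M \<Longrightarrow> En g \<le> M \<Longrightarrow>
     (\<integral>\<^sup>+x. ennreal (\<bar>u x\<bar> powr p) \<partial>lborel) \<le> ennreal K0" using e unfolding sob_embeds_def by blast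
  \<comment> \<open>The maximum supplies the positivity that \<open>level_set_estimate\<close> asks
    for.\<close>
  define K where "K = max K0 1"
  define A where "A = 32 * (K * 4 powr p / ?w) powr (2 / ?N)"
  define b where "b = 2 powr (r - 2)"
  define q where "q = 2 powr (r - 2 - 2 * p / ?N)"
  have q: "0 < q" "q < 1" using r powr_less_mono[of "r - 2 - 2 * p / ?N" 0 2] by (auto simp: q_def)
  have A0: "A \<ge> 0" by (simp add: A_def)
  show "\<exists>C. \<forall>(u::real^'n \<Rightarrow> real) g. sob u g \<longrightarrow> En u \<le> M \<longrightarrow> En g \<le> M \<longrightarrow>
     (\<integral>\<^sup>+x. ennreal (\<bar>u x\<bar> powr r) \<partial>lborel) \<le> ennreal C"
  proof (intro exI[of _ "M + A * M * b * (1 / (1 - q))"] allI impI)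
    fix u :: "real^'n \<Rightarrow> real" and g assume s: "sob u g" and M: "En u \<le> M" "En g \<le> M"
    note u = sob_L2[OF s]
    have M0: "M \<ge> 0" using M En_nonneg order_trans by blast
    have um[measurable]: "u \<in> borel_measurable borel" using u by (rule L2_measurable)
    have uK: "(\<integral>\<^sup>+x. ennreal (\<bar>u x\<bar> powr p) \<partial>lborel) \<le> ennreal K"
      using K0[OF s M] by (rule order_trans) (simp add: K_def ennreal_leI)
    have lev: "(\<integral>\<^sup>+x. ennreal (b ^ Suc k * (if \<bar>u x\<bar> > 2 ^ k then (u x)\<^sup>2 else 0)) \<partial>lborel) \<le> ennreal (A * M * b * q ^ k)" for k
    proof -
      let ?S = "{x. \<bar>u x\<bar> > 2 ^ k}"
      have Sm: "?S \<in> sets borel" by measurable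
      have L: "L2 (\<lambda>x. indicator ?S x * u x)" by (rule L2_indicator(1)[OF Sm u])
      have "(\<integral>\<^sup>+x. ennreal (b ^ Suc k * (if \<bar>u x\<bar> > 2 ^ k then (u x)\<^sup>2 else 0)) \<partial>lborel)
         = (\<integral>\<^sup>+x. ennreal (b ^ Suc k) * ennreal ((norm (indicator ?S x * u x))\<^sup>2) \<partial>lborel)"
        by (rule nn_integral_cong) (auto simp: ennreal_mult[symmetric] b_def)
      also have "\<dots> = ennreal (b ^ Suc k) * ennreal (En (\<lambda>x. indicator ?S x * u x))"
        using L2_measurable[OF L] by (subst nn_integral_cmult) (measurable, simp only: nn_integral_En[OF L])
      also have "\<dots> = ennreal (b ^ Suc k * En (\<lambda>x. indicator ?S x * u x))"
        by (simp add: ennreal_mult b_def En_nonneg)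
      also have "\<dots> \<le> ennreal (A * M * b * q ^ k)"
      proof (rule ennreal_leI)
        have "En (\<lambda>x. indicator ?S x * u x) \<le> A * (2 ^ k) powr (- 2 * p / ?N) * En g"
          using level_set_estimate[OF s p _ _ uK, of "2 ^ k"] by (simp add: A_def K_def)
        also have "\<dots> \<le> A * (2 ^ k) powr (- 2 * p / ?N) * M"
          using M A0 by (intro mult_left_mono) auto
        finally have "b ^ Suc k * En (\<lambda>x. indicator ?S x * u x) \<le> b ^ Suc k * (A * (2 ^ k) powr (- 2 * p / ?N) * M)"
          by (intro mult_left_mono) (auto simp: b_def)
        also have "(2 ^ k) powr (- 2 * p / ?N) = (2 powr (- 2 * p / ?N)) ^ k"
          by (rule two_pow_powr)
        also have "b ^ Suc k * (A * (2 powr (- 2 * p / ?N)) ^ k * M) = A * M * b * (b * 2 powr (- 2 * p / ?N)) ^ k"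
          by (simp add: power_mult_distrib mult_ac)
        also have "b * 2 powr (- 2 * p / ?N) = q" by (simp add: b_def q_def flip: powr_add)
        finally show "b ^ Suc k * En (\<lambda>x. indicator ?S x * u x) \<le> A * M * b * q ^ k" .
      qed
      finally show ?thesis .
    qed
    have "(\<integral>\<^sup>+x. ennreal (\<bar>u x\<bar> powr r) \<partial>lborel)
      \<le> (\<integral>\<^sup>+x. ennreal ((u x)\<^sup>2) + (\<Sum>k. ennreal (b ^ Suc k * (if \<bar>u x\<bar> > 2 ^ k then (u x)\<^sup>2 else 0))) \<partial>lborel)"
      unfolding b_def by (intro nn_integral_mono powr_dyadic_bound r)
    also have "\<dots> = (\<integral>\<^sup>+x. ennreal ((u x)\<^sup>2) \<partial>lborel)
       + (\<integral>\<^sup>+x. (\<Sum>k. ennreal (b ^ Suc k * (if \<bar>u x\<bar> > 2 ^ k then (u x)\<^sup>2 else 0))) \<partial>lborel)"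
      by (rule nn_integral_add) measurable
    also have "(\<integral>\<^sup>+x. (\<Sum>k. ennreal (b ^ Suc k * (if \<bar>u x\<bar> > 2 ^ k then (u x)\<^sup>2 else 0))) \<partial>lborel)
       = (\<Sum>k. \<integral>\<^sup>+x. ennreal (b ^ Suc k * (if \<bar>u x\<bar> > 2 ^ k then (u x)\<^sup>2 else 0)) \<partial>lborel)"
      by (rule nn_integral_suminf) measurable
    also have "\<dots> \<le> (\<Sum>k. ennreal (A * M * b * q ^ k))" by (intro suminf_le lev) auto
    also have "\<dots> = ennreal (A * M * b * (1 / (1 - q)))"
    proof (rule suminf_ennreal_eq)
      show "(\<lambda>k. A * M * b * q ^ k) sums (A * M * b * (1 / (1 - q)))"
        using q by (intro sums_mult geometric_sums) auto
      show "0 \<le> A * M * b * q ^ k" for k using A0 M0 q by (auto simp: b_def intro!: mult_nonneg_nonneg)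
    qed
    also have "(\<integral>\<^sup>+x. ennreal ((u x)\<^sup>2) \<partial>lborel) = ennreal (En u)" using nn_integral_En[OF u] by simp
    also have "ennreal (En u) + ennreal (A * M * b * (1 / (1 - q))) = ennreal (En u + A * M * b * (1 / (1 - q)))"
      using A0 M0 q by (intro ennreal_plus[symmetric]) (auto simp: b_def En_nonneg)
    also have "\<dots> \<le> ennreal (M + A * M * b * (1 / (1 - q)))" using M by (intro ennreal_leI) simp
    finally show "(\<integral>\<^sup>+x. ennreal (\<bar>u x\<bar> powr r) \<partial>lborel) \<le> ennreal (M + A * M * b * (1 / (1 - q)))"
      by simp
  qed
qed

section \<open>Interpolation between L2 and a higher exponent\<close>

lemma powr_interpolate:
  fixes y :: real assumes "2 \<le> r" "r \<le> q" "t > 0"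
  shows "\<bar>y\<bar> powr r \<le> t powr (r - 2) * y\<^sup>2 + t powr (r - q) * \<bar>y\<bar> powr q"
proof (cases "y = 0")
  case False
  show ?thesis
  proof (cases "\<bar>y\<bar> \<le> t")
    case True
    have "\<bar>y\<bar> powr r = \<bar>y\<bar> powr (r - 2) * \<bar>y\<bar> powr 2" using powr_add[of "\<bar>y\<bar>" "r - 2" 2] by simp
    also have "\<dots> \<le> t powr (r - 2) * \<bar>y\<bar> powr 2" using assms True by (intro mult_right_mono powr_mono2) auto
    also have "\<bar>y\<bar> powr 2 = y\<^sup>2" using False by simp
    finally show ?thesis by (simp add: add_increasing2)
  next
    case g: False
    have "\<bar>y\<bar> powr r = \<bar>y\<bar> powr (r - q) * \<bar>y\<bar> powr q" using False by (simp flip: powr_add)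
    also have "\<dots> \<le> t powr (r - q) * \<bar>y\<bar> powr q" using assms g by (intro mult_right_mono powr_mono2') auto
    finally show ?thesis by (simp add: add_increasing)
  qed
qed simp

lemma nn_integral_powr_interpolate:
  fixes u :: "'a::euclidean_space \<Rightarrow> real"
  assumes rq: "2 \<le> r" "r \<le> q" "t > 0" and u: "L2 u" and C: "C \<ge> 0"
    and uC: "(\<integral>\<^sup>+x. ennreal (\<bar>u x\<bar> powr q) \<partial>lborel) \<le> ennreal C"
  shows "(\<integral>\<^sup>+x. ennreal (\<bar>u x\<bar> powr r) \<partial>lborel) \<le> ennreal (t powr (r - 2) * En u + t powr (r - q) * C)"
proof -
  have um[measurable]: "u \<in> borel_measurable borel" using u by (rule L2_measurable)
  have "(\<integral>\<^sup>+x. ennreal (\<bar>u x\<bar> powr r) \<partial>lborel)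
     \<le> (\<integral>\<^sup>+x. ennreal (t powr (r - 2)) * ennreal ((norm (u x))\<^sup>2) + ennreal (t powr (r - q)) * ennreal (\<bar>u x\<bar> powr q) \<partial>lborel)"
  proof (rule nn_integral_mono)
    fix x
    show "ennreal (\<bar>u x\<bar> powr r) \<le> ennreal (t powr (r - 2)) * ennreal ((norm (u x))\<^sup>2) + ennreal (t powr (r - q)) * ennreal (\<bar>u x\<bar> powr q)"
      using powr_interpolate[OF rq, of "u x"] by (simp add: ennreal_leI flip: ennreal_mult ennreal_plus)
  qed
  also have "\<dots> = ennreal (t powr (r - 2)) * ennreal (En u) + ennreal (t powr (r - q)) * (\<integral>\<^sup>+x. ennreal (\<bar>u x\<bar> powr q) \<partial>lborel)"
    by (simp add: nn_integral_add nn_integral_cmult nn_integral_En[OF u, simplified])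
  also have "\<dots> \<le> ennreal (t powr (r - 2)) * ennreal (En u) + ennreal (t powr (r - q)) * ennreal C"
    by (intro add_left_mono mult_left_mono uC) auto
  also have "\<dots> = ennreal (t powr (r - 2) * En u + t powr (r - q) * C)"
    using C by (simp add: En_nonneg flip: ennreal_mult ennreal_plus)
  finally show ?thesis .
qed

text \<open>The exponents follow the recursion p -> 2 + theta p with theta below 2/N, starting from
  the trivial case p = 2. The fixed point 2/(1 - theta) tends to 2N/(N-2) as theta tends to 2/N, so
  a subcritical r is passed after finitely many steps, and interpolation with L2 returns to
  r.\<close>

lemma sob_embeds_subcritical:
  assumes N: "CARD('n::finite) \<ge> 3" and r: "2 \<le> r" "r < 2 * real CARD('n) / (real CARD('n) - 2)"
  shows "sob_embeds TYPE('n) r"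
proof -
  let ?N = "real CARD('n)"
  have N3: "?N \<ge> 3" using N by simp
  have "1 - 2 / r < 2 / ?N" using r N3 by (simp add: field_simps)
  moreover have "0 < 2 / ?N" using N3 by simp
  \<comment> \<open>The inequality 1 - 2/r < theta says that the fixed point 2/(1 - theta) exceeds
    r.\<close>
  ultimately obtain \<theta> where th: "max 0 (1 - 2 / r) < \<theta>" "\<theta> < 2 / ?N"
    using dense[of "max 0 (1 - 2 / r)" "2 / ?N"] by auto
  have th1: "\<theta> > 0" "\<theta> < 1"
  proof -
    have "2 / ?N \<le> 2 / 3" using N3 by (intro divide_left_mono) auto
    then show "\<theta> > 0" "\<theta> < 1" using th by auto
  qed
  define P where "P = 2 / (1 - \<theta>)"
  have P: "P > r" using th th1 r by (simp add: P_def field_simps)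
  \<comment> \<open>Closed form of the recursion; its value at 0 is 2.\<close>
  define p where "p k = P - (P - 2) * \<theta> ^ k" for k :: nat
  have Pf: "P = 2 + \<theta> * P" using th1 by (simp add: P_def field_simps)
  have pS: "p (Suc k) = 2 + \<theta> * p k" for k
  proof -
    have "p (Suc k) = P - \<theta> * ((P - 2) * \<theta> ^ k)" by (simp add: p_def algebra_simps)
    also have "\<dots> = 2 + \<theta> * P - \<theta> * ((P - 2) * \<theta> ^ k)" using Pf by simp
    finally show ?thesis by (simp add: p_def algebra_simps)
  qed
  have p2: "p k \<ge> 2" for k
  proof (induction k)
    case 0 show ?case by (simp add: p_def)
  next
    case (Suc k) then show ?case using th1 by (simp add: pS)
  qed
  have emb: "sob_embeds TYPE('n) (p k)" for k
  proof (induction k)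
    case 0
    have "(\<integral>\<^sup>+x. ennreal (\<bar>u x\<bar> powr 2) \<partial>lborel) \<le> ennreal M" if "sob u g" "En u \<le> M" for M and u :: "real^'n \<Rightarrow> real" and g
      using nn_integral_En[OF sob_L2[OF that(1)]] that(2) by (simp add: ennreal_leI)
    then show ?case unfolding sob_embeds_def p_def by auto
  next
    case (Suc k)
    have "\<theta> * p k < 2 / ?N * p k" using th(2) p2[of k] by (intro mult_strict_right_mono) auto
    then show ?case using p2[of "Suc k"] by (intro sob_embeds_bootstrap[OF Suc p2]) (auto simp: pS)
  qed
  have "(\<lambda>k. p k) \<longlonglongrightarrow> P - (P - 2) * 0"
    unfolding p_def using th1 by (intro tendsto_intros LIMSEQ_power_zero) auto
  then have "eventually (\<lambda>k. p k > r) sequentially" using P by (intro order_tendstoD(1)) auto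
  then obtain k where k: "p k > r" by (auto simp: eventually_sequentially)
  show ?thesis unfolding sob_embeds_def
  proof
    fix M :: real
    obtain C where C: "\<And>(u::real^'n \<Rightarrow> real) g. sob u g \<Longrightarrow> En u \<le> M \<Longrightarrow> En g \<le> M \<Longrightarrow>
     (\<integral>\<^sup>+x. ennreal (\<bar>u x\<bar> powr p k) \<partial>lborel) \<le> ennreal C" using emb[of k] unfolding sob_embeds_def by blast
    show "\<exists>C. \<forall>(u::real^'n \<Rightarrow> real) g. sob u g \<longrightarrow> En u \<le> M \<longrightarrow> En g \<le> M \<longrightarrow>
      (\<integral>\<^sup>+x. ennreal (\<bar>u x\<bar> powr r) \<partial>lborel) \<le> ennreal C"
    proof (intro exI[of _ "M + max C 0"] allI impI)
      fix u :: "real^'n \<Rightarrow> real" and g assume s: "sob u g" and M: "En u \<le> M" "En g \<le> M"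
      have le: "(\<integral>\<^sup>+x. ennreal (\<bar>u x\<bar> powr p k) \<partial>lborel) \<le> ennreal (max C 0)"
        using C[OF s M] by (rule order_trans) (auto intro: ennreal_leI)
      have "(\<integral>\<^sup>+x. ennreal (\<bar>u x\<bar> powr r) \<partial>lborel) \<le> ennreal (1 powr (r - 2) * En u + 1 powr (r - p k) * max C 0)"
        by (rule nn_integral_powr_interpolate[OF r(1) _ _ sob_L2[OF s] _ le]) (use k in auto)
      also have "\<dots> \<le> ennreal (M + max C 0)" using M by (intro ennreal_leI) simp
      finally show "(\<integral>\<^sup>+x. ennreal (\<bar>u x\<bar> powr r) \<partial>lborel) \<le> ennreal (M + max C 0)" .
    qed
  qed
qed

lemma tendsto_0_if_ennreal:
  fixes f :: "'a \<Rightarrow> ennreal"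
  assumes "\<And>e::real. e > 0 \<Longrightarrow> eventually (\<lambda>n. f n \<le> ennreal e) F" shows "(f \<longlongrightarrow> 0) F"
proof (rule order_tendstoI)
  fix a :: ennreal assume "0 < a"
  then obtain e where e: "0 < e" "e < a" using dense by blast
  then obtain r where r: "e = ennreal r" "r > 0" by (cases e) auto
  show "eventually (\<lambda>n. f n < a) F" using assms[OF r(2)] by eventually_elim (use e r in auto)
qed simp

text \<open>A bound in L^q, with q strictly between r and the critical exponent, controls the values
  above a height t; the vanishing L2 norm takes care of those below.\<close>

lemma sob_L2_to_Lr:
  fixes w :: "nat \<Rightarrow> real^'n \<Rightarrow> real"
  assumes N: "CARD('n) \<ge> 3" and r: "2 \<le> r" "r < 2 * real CARD('n) / (real CARD('n) - 2)"
    and s: "\<And>n. sob (w n) (k n)" and M: "\<And>n. En (w n) \<le> M" "\<And>n. En (k n) \<le> M"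
    and lim: "(\<lambda>n. En (w n)) \<longlonglongrightarrow> 0"
  shows "(\<lambda>n. \<integral>\<^sup>+x. ennreal (\<bar>w n x\<bar> powr r) \<partial>lborel) \<longlonglongrightarrow> 0"
proof -
  obtain q where q: "r < q" "q < 2 * real CARD('n) / (real CARD('n) - 2)" using dense[OF r(2)] by blast
  have "sob_embeds TYPE('n) q" by (rule sob_embeds_subcritical[OF N _ q(2)]) (use q r in simp)
  then obtain C0 where C0: "\<And>(u::real^'n \<Rightarrow> real) g. sob u g \<Longrightarrow> En u \<le> M \<Longrightarrow> En g \<le> M \<Longrightarrow>
     (\<integral>\<^sup>+x. ennreal (\<bar>u x\<bar> powr q) \<partial>lborel) \<le> ennreal C0" unfolding sob_embeds_def by blast
  define C where "C = max C0 1"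
  have C1: "C \<ge> 1" by (simp add: C_def)
  have C: "(\<integral>\<^sup>+x. ennreal (\<bar>w n x\<bar> powr q) \<partial>lborel) \<le> ennreal C" for n
    using C0[OF s M] by (rule order_trans) (auto simp: C_def intro: ennreal_leI)
  show ?thesis
  proof (rule tendsto_0_if_ennreal)
    fix e :: real assume e: "e > 0"
    \<comment> \<open>Since r < q, raising t shrinks the L^q contribution; this height makes it
      exactly e/2.\<close>
    define t where "t = (e / (2 * C)) powr (1 / (r - q))"
    have t: "t > 0" using e C1 by (simp add: t_def)
    have tC: "t powr (r - q) * C = e / 2" using e C1 q(1) by (simp add: t_def powr_powr)
    have "eventually (\<lambda>n. En (w n) < e / (2 * t powr (r - 2))) sequentially"
      using lim by (rule order_tendstoD(2)) (use e t in simp)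
    then show "eventually (\<lambda>n. (\<integral>\<^sup>+x. ennreal (\<bar>w n x\<bar> powr r) \<partial>lborel) \<le> ennreal e) sequentially"
    proof eventually_elim
      case (elim n)
      then have "t powr (r - 2) * En (w n) \<le> e / 2" using t by (simp add: field_simps)
      then have "t powr (r - 2) * En (w n) + t powr (r - q) * C \<le> e" using tC by linarith
      moreover have "(\<integral>\<^sup>+x. ennreal (\<bar>w n x\<bar> powr r) \<partial>lborel) \<le> ennreal (t powr (r - 2) * En (w n) + t powr (r - q) * C)"
        by (rule nn_integral_powr_interpolate[OF r(1) less_imp_le[OF q(1)] t sob_L2[OF s] _ C]) (use C1 in simp)
      ultimately show ?case using ennreal_leI order_trans by blast
    qed
  qed
qed

section \<open>Compactness in L2\<close>

text \<open>Ball averages of a bounded sequence are uniformly bounded and equi-Lipschitz, so a diagonal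
  subsequence of them converges everywhere; averages over small balls are L2-close to the functions.\<close>

lemma rellich:
  fixes v :: "nat \<Rightarrow> real^'n \<Rightarrow> real"
  assumes s: "\<And>n. sob (v n) (g n)" and M: "\<And>n. En (v n) \<le> M" "\<And>n. En (g n) \<le> M"
    and tight: "\<And>e. e > 0 \<Longrightarrow> \<exists>\<rho> n0. \<forall>n\<ge>n0. En (\<lambda>x. indicator (- cball 0 \<rho>) x * v n x) \<le> e"
  obtains s v0 where "strict_mono (s :: nat \<Rightarrow> nat)" "L2 v0" "(\<lambda>n. En (\<lambda>x. v (s n) x - v0 x)) \<longlonglongrightarrow> 0"
proof -
  have M0: "M \<ge> 0" using M(1)[of 0] En_nonneg[of "v 0"] by linarith
  define R :: "nat \<Rightarrow> real" where "R m = 1 / Suc m" for m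
  have R: "R m > 0" for m by (simp add: R_def)
  define \<kappa> where "\<kappa> m = (ball_kernel (R m) :: real^'n \<Rightarrow> real)" for m
  define B where "B m = 1 / measure lborel (cball (0::real^'n) (R m))" for m
  have k: "kernel (\<kappa> m) (R m) (B m)" for m unfolding \<kappa>_def B_def by (rule kernel_ball_kernel[OF R])
  have B0: "B m \<ge> 0" for m by (simp add: B_def)
  define a where "a m n = conv (\<kappa> m) (v n)" for m n
  have a_bound: "(a m n x)\<^sup>2 \<le> B m * M" for m n x
    unfolding a_def using conv_bound[OF k sob_L2[OF s], of m n x] mult_left_mono[OF M(1)[of n] B0[of m]]
    by linarith
  have a_lip: "(a m n x - a m n y)\<^sup>2 \<le> 8 * B m * M * (norm (x - y))\<^sup>2" for m n x y
  proof -
    have "(a m n x - a m n y)\<^sup>2 \<le> B m * En (\<lambda>z. v n ((x - y) + z) - v n z)"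
      unfolding a_def by (rule conv_diff_bound[OF k sob_L2[OF s]])
    also have "\<dots> \<le> B m * (8 * (norm (x - y))\<^sup>2 * En (g n))"
      by (intro mult_left_mono sob_shift_estimate[OF s] B0)
    also have "\<dots> \<le> B m * (8 * (norm (x - y))\<^sup>2 * M)"
      by (intro mult_left_mono M B0) auto
    finally show ?thesis by (simp add: mult_ac)
  qed
  have a_approx: "L2 (\<lambda>x. a m n x - v n x)" "En (\<lambda>x. a m n x - v n x) \<le> 8 * (R m)\<^sup>2 * M" for m n
  proof -
    show "L2 (\<lambda>x. a m n x - v n x)" unfolding a_def by (rule sob_conv_approx(1)[OF s k less_imp_le[OF R]])
    have "En (\<lambda>x. a m n x - v n x) \<le> 8 * (R m)\<^sup>2 * En (g n)"
      unfolding a_def by (rule sob_conv_approx(2)[OF s k less_imp_le[OF R]])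
    also have "\<dots> \<le> 8 * (R m)\<^sup>2 * M" by (intro mult_left_mono M) auto
    finally show "En (\<lambda>x. a m n x - v n x) \<le> 8 * (R m)\<^sup>2 * M" .
  qed
  have aL: "L2 (a m n)" for m n unfolding a_def by (rule conv_L2[OF k sob_L2[OF s]])
  obtain D :: "(real^'n) set" where D: "countable D" "\<And>X. open X \<Longrightarrow> X \<noteq> {} \<Longrightarrow> \<exists>d\<in>D. d \<in> X"
    using countable_dense_setE by blast
  \<comment> \<open>Division by c brings all averages into [-1,1], the common bound used in
    \<open>function_convergent_subsequence\<close>; the summand 1 keeps c positive.\<close>
  define c where "c m = 1 + sqrt (B m * M)" for m
  have c: "c m > 0" for m using B0[of m] M0 by (simp add: c_def add_pos_nonneg)
  have abs_le: "\<bar>a m n x\<bar> \<le> c m" for m n x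
  proof -
    have "\<bar>a m n x\<bar> = sqrt ((a m n x)\<^sup>2)" by simp
    also have "\<dots> \<le> sqrt (B m * M)" by (rule real_sqrt_le_mono[OF a_bound])
    finally show ?thesis by (simp add: c_def)
  qed
  \<comment> \<open>A single extraction over the countable set of pairs (scale, point) handles all
    scales at the same time.\<close>
  have cnt: "countable ((UNIV :: nat set) \<times> D)" using D(1) by simp
  have "\<And>n y. y \<in> UNIV \<times> D \<Longrightarrow> norm (case y of (m, x) \<Rightarrow> a m n x / c m) \<le> 1"
    using abs_le c by (auto simp: divide_le_eq less_imp_le)
  then obtain s where sm: "strict_mono (s :: nat \<Rightarrow> nat)"
    and cs: "\<And>y. y \<in> (UNIV :: nat set) \<times> D \<Longrightarrow> \<exists>l. (\<lambda>n. case y of (m, x) \<Rightarrow> a m (s n) x / c m) \<longlonglongrightarrow> l"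
    using function_convergent_subsequence[OF cnt, where f="\<lambda>n y. case y of (m, x) \<Rightarrow> a m n x / c m" and M=1] by blast
  have convD: "convergent (\<lambda>n. a m (s n) x)" if xD: "x \<in> D" for m x
  proof -
    obtain l where "(\<lambda>n. a m (s n) x / c m) \<longlonglongrightarrow> l" using cs[of "(m, x)"] xD by auto
    then have "(\<lambda>n. a m (s n) x / c m * c m) \<longlonglongrightarrow> l * c m" by (intro tendsto_intros)
    then show ?thesis using c[of m] by (auto simp: convergent_def)
  qed
  have conv: "convergent (\<lambda>n. a m (s n) x)" for m x
  proof (rule Cauchy_convergent, rule metric_CauchyI)
    fix e :: real assume e: "e > 0"
    define L where "L = sqrt (8 * B m * M) + 1"
    have L: "L > 0" using B0[of m] M0 by (simp add: L_def add_nonneg_pos)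
    have "e / (3 * L) > 0" using e L by simp
    then obtain q where q: "q \<in> D" "norm (x - q) < e / (3 * L)"
      using D(2)[of "ball x (e / (3 * L))"] unfolding mem_ball dist_norm by (metis ball_eq_empty not_le open_ball)
    have lip: "\<bar>a m n x - a m n q\<bar> < e / 3" for n
    proof -
      have "\<bar>a m n x - a m n q\<bar> = sqrt ((a m n x - a m n q)\<^sup>2)" by simp
      also have "\<dots> \<le> sqrt (8 * B m * M * (norm (x - q))\<^sup>2)" by (rule real_sqrt_le_mono[OF a_lip])
      also have "\<dots> = sqrt (8 * B m * M) * norm (x - q)" by (simp add: real_sqrt_mult)
      also have "\<dots> \<le> L * norm (x - q)" by (rule mult_right_mono) (auto simp: L_def)
      also have "\<dots> < L * (e / (3 * L))" by (rule mult_strict_left_mono[OF q(2) L])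
      also have "\<dots> = e / 3" using L by simp
      finally show ?thesis .
    qed
    have "Cauchy (\<lambda>n. a m (s n) q)" by (rule convergent_Cauchy[OF convD[OF q(1)]])
    then obtain N where N: "\<And>i j. i \<ge> N \<Longrightarrow> j \<ge> N \<Longrightarrow> dist (a m (s i) q) (a m (s j) q) < e / 3"
      using metric_CauchyD[of "\<lambda>n. a m (s n) q" "e / 3"] e by auto
    show "\<exists>N. \<forall>i\<ge>N. \<forall>j\<ge>N. dist (a m (s i) x) (a m (s j) x) < e"
    proof (intro exI[of _ N] allI impI)
      fix i j assume "i \<ge> N" "j \<ge> N"
      then show "dist (a m (s i) x) (a m (s j) x) < e"
        using N[of i j] lip[of "s i"] lip[of "s j"] unfolding dist_real_def by linarith
    qed
  qed
  define b where "b m x = lim (\<lambda>n. a m (s n) x)" for m x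
  have lim: "(\<lambda>n. a m (s n) x) \<longlonglongrightarrow> b m x" for m x
    using conv unfolding b_def by (simp add: convergent_LIMSEQ_iff)
  have am[measurable]: "a m n \<in> borel_measurable borel" for m n by (rule L2_measurable[OF aL])
  have bm[measurable]: "b m \<in> borel_measurable borel" for m unfolding b_def by (rule borel_measurable_lim_metric) simp
  have b_le: "\<bar>b m x\<bar> \<le> c m" for m x
    by (rule LIMSEQ_le_const2[OF tendsto_rabs[OF lim]]) (use abs_le in auto)
  have ms: "(\<lambda>x. indicator (cball 0 \<rho>) x * h x) \<in> borel_measurable borel" if "h \<in> borel_measurable borel"
    for \<rho> and h :: "real^'n \<Rightarrow> real"
    using that by (intro borel_measurable_times borel_measurable_indicator) auto
  \<comment> \<open>The uniform bound \<open>c m\<close> is a majorant on balls, so pointwise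
    convergence of the averages becomes L2 convergence there; the region outside is left to
    \<open>tight\<close>.\<close>
  have loc: "(\<lambda>n. En (\<lambda>x. indicator (cball 0 \<rho>) x * (a m (s n) x - b m x))) \<longlonglongrightarrow> 0" for m \<rho>
  proof -
    have "(\<lambda>n. \<integral>x. (norm (indicator (cball 0 \<rho>) x * (a m (s n) x - b m x)))\<^sup>2 \<partial>lborel) \<longlonglongrightarrow> (\<integral>x. 0 \<partial>(lborel :: (real^'n) measure))"
    proof (rule integral_dominated_convergence[where w="\<lambda>x. (2 * c m)\<^sup>2 * indicator (cball 0 \<rho>) x"])
      show "integrable lborel (\<lambda>x::real^'n. (2 * c m)\<^sup>2 * indicator (cball 0 \<rho>) x :: real)"
        using emeasure_bounded_finite[OF bounded_cball, of "0::real^'n" \<rho>]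
        by (intro integrable_mult_right) (auto simp: integrable_indicator_iff)
      show "AE x in lborel. (\<lambda>n. (norm (indicator (cball 0 \<rho>) x * (a m (s n) x - b m x)))\<^sup>2) \<longlonglongrightarrow> 0"
      proof (rule AE_I2)
        fix x :: "real^'n"
        have "(\<lambda>n. (norm (indicator (cball 0 \<rho>) x * (a m (s n) x - b m x)))\<^sup>2) \<longlonglongrightarrow>
          (norm (indicator (cball 0 \<rho>) x * (b m x - b m x)))\<^sup>2" by (intro tendsto_intros lim)
        then show "(\<lambda>n. (norm (indicator (cball 0 \<rho>) x * (a m (s n) x - b m x)))\<^sup>2) \<longlonglongrightarrow> 0" by simp
      qed
      have "(a m (s n) x - b m x)\<^sup>2 \<le> (2 * c m)\<^sup>2" for n x
      proof -
        have "\<bar>a m (s n) x - b m x\<bar> \<le> 2 * c m" using abs_le[of m "s n" x] b_le[of m x] by linarith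
        from power_mono[OF this, of 2] show ?thesis by simp
      qed
      then show "AE x in lborel. norm ((norm (indicator (cball 0 \<rho>) x * (a m (s n) x - b m x)))\<^sup>2) \<le> (2 * c m)\<^sup>2 * indicator (cball 0 \<rho>) x" for n
        by (auto simp: indicator_def)
    next
      show "(\<lambda>x. (norm (indicator (cball 0 \<rho>) x * (a m (s n) x - b m x)))\<^sup>2) \<in> borel_measurable lborel" for n
        using ms by simp
    qed simp
    then show ?thesis by (simp add: En_def)
  qed
  have bloc: "L2 (\<lambda>x. indicator (cball 0 \<rho>) x * b m x)" for m \<rho>
  proof -
    have "integrable lborel (\<lambda>x::real^'n. (c m)\<^sup>2 * indicator (cball 0 \<rho>) x :: real)"
      using emeasure_bounded_finite[OF bounded_cball, of "0::real^'n" \<rho>]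
      by (intro integrable_mult_right) (auto simp: integrable_indicator_iff)
    then have "integrable lborel (\<lambda>x. (indicator (cball 0 \<rho>) x * b m x)\<^sup>2)"
    proof (rule Bochner_Integration.integrable_bound)
      have "(b m x)\<^sup>2 \<le> (c m)\<^sup>2" for x using power_mono[OF b_le[of m x], of 2] by simp
      then show "AE x in lborel. norm ((indicator (cball 0 \<rho>) x * b m x)\<^sup>2) \<le> norm ((c m)\<^sup>2 * indicator (cball 0 \<rho>) x)"
        by (auto simp: indicator_def)
    qed (use ms[OF bm] in simp)
    then show ?thesis using ms[OF bm] by (simp add: L2_def)
  qed
  have cauchy: "\<exists>N. \<forall>i\<ge>N. \<forall>j\<ge>N. En (\<lambda>x. v (s i) x - v (s j) x) < e" if e: "e > 0" for e
  proof -
    \<comment> \<open>The budget: inside the ball each index is within 2 e/32 + 2 e/64 = 3e/32 of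
      \<open>b m\<close>, so a pair costs at most 4 times that; outside, a pair costs at most 4
      e/16. The total 5e/8 is below e.\<close>
    obtain \<rho> n0 where \<rho>: "\<And>n. n \<ge> n0 \<Longrightarrow> En (\<lambda>x. indicator (- cball 0 \<rho>) x * v n x) \<le> e / 16"
      using tight[of "e / 16"] e by auto
    let ?S = "cball (0::real^'n) \<rho>"
    have S: "?S \<in> sets borel" "- ?S \<in> sets borel" by auto
    have "(\<lambda>m. R m) \<longlonglongrightarrow> 0" unfolding R_def using LIMSEQ_inverse_real_of_nat by (simp add: inverse_eq_divide)
    then have "(\<lambda>m. 8 * (R m)\<^sup>2 * M) \<longlonglongrightarrow> 8 * 0\<^sup>2 * M" by (intro tendsto_intros)
    then have "eventually (\<lambda>m. 8 * (R m)\<^sup>2 * M < e / 32) sequentially" using e by (intro order_tendstoD(2)) auto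
    then obtain m where m: "8 * (R m)\<^sup>2 * M < e / 32" by (auto simp: eventually_sequentially)
    have "eventually (\<lambda>n. En (\<lambda>x. indicator ?S x * (a m (s n) x - b m x)) < e / 64) sequentially"
      using loc by (rule order_tendstoD(2)) (use e in simp)
    then obtain N where N: "\<And>n. n \<ge> N \<Longrightarrow> En (\<lambda>x. indicator ?S x * (a m (s n) x - b m x)) < e / 64"
      by (auto simp: eventually_sequentially)
    have near: "En (\<lambda>x. indicator ?S x * v (s i) x - indicator ?S x * b m x) < 3 * e / 32" if "i \<ge> N" for i
    proof -
      have "En (\<lambda>x. indicator ?S x * v (s i) x - indicator ?S x * b m x) \<le>
          2 * En (\<lambda>x. indicator ?S x * v (s i) x - indicator ?S x * a m (s i) x)
        + 2 * En (\<lambda>x. indicator ?S x * a m (s i) x - indicator ?S x * b m x)"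
        by (intro En_triangle L2_indicator S sob_L2[OF s] aL bloc)
      moreover have "En (\<lambda>x. indicator ?S x * v (s i) x - indicator ?S x * a m (s i) x) \<le> 8 * (R m)\<^sup>2 * M"
      proof -
        have "En (\<lambda>x. indicator ?S x * v (s i) x - indicator ?S x * a m (s i) x)
          = En (\<lambda>x. indicator ?S x * (a m (s i) x - v (s i) x))"
          by (subst En_minus_commute) (simp add: right_diff_distrib)
        then show ?thesis using L2_indicator(2)[OF S(1) a_approx(1)[of m "s i"]] a_approx(2)[of m "s i"] by linarith
      qed
      moreover have "En (\<lambda>x. indicator ?S x * a m (s i) x - indicator ?S x * b m x) < e / 64"
        using N[OF that] by (simp add: right_diff_distrib)
      ultimately show ?thesis using m e by linarith
    qed
    show ?thesis
    proof (intro exI[of _ "max N n0"] allI impI)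
      fix i j assume ij: "i \<ge> max N n0" "j \<ge> max N n0"
      have L: "L2 (\<lambda>x. v (s i) x - v (s j) x)" by (intro L2_diff sob_L2[OF s])
      have sge: "s i \<ge> n0" "s j \<ge> n0" using seq_suble[OF sm, of i] seq_suble[OF sm, of j] ij by auto
      have 1: "En (\<lambda>x. indicator ?S x * v (s i) x - indicator ?S x * v (s j) x) \<le>
         2 * En (\<lambda>x. indicator ?S x * v (s i) x - indicator ?S x * b m x) + 2 * En (\<lambda>x. indicator ?S x * b m x - indicator ?S x * v (s j) x)"
        by (intro En_triangle L2_indicator S sob_L2[OF s] bloc)
      have 2: "En (\<lambda>x. indicator ?S x * b m x - indicator ?S x * v (s j) x) = En (\<lambda>x. indicator ?S x * v (s j) x - indicator ?S x * b m x)"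
        by (rule En_minus_commute)
      have 3: "En (\<lambda>x. indicator (- ?S) x * v (s i) x - indicator (- ?S) x * v (s j) x) \<le>
         2 * En (\<lambda>x. indicator (- ?S) x * v (s i) x) + 2 * En (\<lambda>x. indicator (- ?S) x * v (s j) x)"
        by (intro En_diff_le L2_indicator S sob_L2[OF s])
      show "En (\<lambda>x. v (s i) x - v (s j) x) < e"
        unfolding En_split_indicator[OF S(1) L] right_diff_distrib
        using 1 2 3 near[of i] near[of j] \<rho>[OF sge(1)] \<rho>[OF sge(2)] ij e by linarith
    qed
  qed
  show ?thesis
    by (rule L2_complete[OF sob_L2[OF s] cauchy]) (assumption, rule that[OF sm])
qed

section \<open>Weak limits through midpoint hulls\<close>

definition pot :: "('a::euclidean_space \<Rightarrow> real) \<Rightarrow> ('a \<Rightarrow> real) \<Rightarrow> real" where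
  "pot V u = (\<integral>x. V x * (u x)\<^sup>2 \<partial>lborel)"

text \<open>The set of iterated midpoints replaces the convex hull: the parallelogram identity only
  involves midpoints.\<close>

inductive_set midhull :: "(('a \<Rightarrow> real) \<times> ('a \<Rightarrow> real^'n)) set \<Rightarrow> (('a \<Rightarrow> real) \<times> ('a \<Rightarrow> real^'n)) set"
  for S where
  base: "p \<in> S \<Longrightarrow> p \<in> midhull S"
| mid: "(u, g) \<in> midhull S \<Longrightarrow> (w, k) \<in> midhull S \<Longrightarrow>
    ((\<lambda>x. 1/2 * u x + 1/2 * w x), (\<lambda>x. (1/2) *\<^sub>R g x + (1/2) *\<^sub>R k x)) \<in> midhull S"

lemma midhull_mono: assumes "S \<subseteq> T" shows "midhull S \<subseteq> midhull T"
proof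
  fix p assume "p \<in> midhull S"
  then show "p \<in> midhull T"
  proof (induction p rule: midhull.induct)
    case (base p) then show ?case using assms by (auto intro: midhull.base)
  next
    case (mid u g w k) then show ?case by (intro midhull.mid)
  qed
qed

section \<open>The energy space, as pairs of function and gradient\<close>

locale potential =
  fixes V :: "real^'n \<Rightarrow> real"
  assumes V0: "V x \<ge> 0" and Vm: "V \<in> borel_measurable borel"
begin

definition Xpair :: "(real^'n \<Rightarrow> real) \<Rightarrow> (real^'n \<Rightarrow> real^'n) \<Rightarrow> bool" where
  "Xpair u g \<longleftrightarrow> sob u g \<and> integrable lborel (\<lambda>x. V x * (u x)\<^sup>2)"

text \<open>The potential energy is the squared L2 norm of sqrt(V) u, so completeness, the
  parallelogram identity and Fatou's lemma for L2 apply to it unchanged.\<close>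

lemma sqrtV_L2: assumes "Xpair u g" shows "L2 (\<lambda>x. sqrt (V x) * u x)" "En (\<lambda>x. sqrt (V x) * u x) = pot V u"
  using assms V0 Vm L2_measurable[OF sob_L2[of u g]]
  by (auto simp: Xpair_def L2_def En_def pot_def power_mult_distrib)

lemma sqrtV_L2_iff:
  assumes "u \<in> borel_measurable borel"
  shows "L2 (\<lambda>x. sqrt (V x) * u x) \<longleftrightarrow> integrable lborel (\<lambda>x. V x * (u x)\<^sup>2)"
  using assms V0 Vm by (auto simp: L2_def power_mult_distrib)

lemma Xpair_lincomb:
  assumes "Xpair u g" "Xpair w k"
  shows "Xpair (\<lambda>x. a * u x + b * w x) (\<lambda>x. a *\<^sub>R g x + b *\<^sub>R k x)"
proof -
  have s: "sob (\<lambda>x. a * u x + b * w x) (\<lambda>x. a *\<^sub>R g x + b *\<^sub>R k x)"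
    using assms by (auto simp: Xpair_def intro: sob_lincomb)
  have "L2 (\<lambda>x. a * (sqrt (V x) * u x) + b * (sqrt (V x) * w x))"
    by (intro L2_add L2_cmult sqrtV_L2[OF assms(1)] sqrtV_L2[OF assms(2)])
  then have "L2 (\<lambda>x. sqrt (V x) * (a * u x + b * w x))" by (simp add: algebra_simps)
  then show ?thesis using s sqrtV_L2_iff[OF L2_measurable[OF sob_L2[OF s]]] by (simp add: Xpair_def)
qed

lemma Xpair_diff: "Xpair u g \<Longrightarrow> Xpair w k \<Longrightarrow> Xpair (\<lambda>x. u x - w x) (\<lambda>x. g x - k x)"
  using Xpair_lincomb[of u g w k 1 "-1"] by simp

lemma Xsp_iff: "Xsp V u \<longleftrightarrow> (\<exists>g. Xpair u g)"
  by (auto simp: Xsp_def H1_iff_sob Xpair_def)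

definition Q :: "(real^'n \<Rightarrow> real) \<Rightarrow> (real^'n \<Rightarrow> real^'n) \<Rightarrow> real" where
  "Q u g = En g + pot V u"

lemma pot_nonneg: "pot V u \<ge> 0" by (simp add: pot_def V0)

lemma Q_nonneg: "Q u g \<ge> 0" by (simp add: Q_def En_nonneg pot_nonneg)

lemma mu_norm_Xpair:
  assumes "Xpair u g" shows "mu_norm \<mu> V u = sqrt (En g + \<mu> * pot V u)"
proof -
  have s: "sob u g" using assms by (simp add: Xpair_def)
  have "integrable lborel (\<lambda>x. (norm (wgrad u x))\<^sup>2)" using sob_grad_L2[OF sob_wgrad(1)[OF s]] by (simp add: L2_def)
  moreover have "integrable lborel (\<lambda>x. \<mu> * (V x * (u x)\<^sup>2))" using assms by (simp add: Xpair_def)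
  ultimately show ?thesis
    unfolding mu_norm_def sob_wgrad(3)[OF s, symmetric] by (simp add: En_def pot_def mult.assoc)
qed

lemma X_norm_Xpair: "Xpair u g \<Longrightarrow> X_norm V u = sqrt (Q u g)"
  by (simp add: X_norm_def mu_norm_Xpair Q_def)

text \<open>Solved for the difference and written with the midpoint instead of the sum: a lower
  bound on the energy of midpoints makes two almost minimal pairs close to each other.\<close>

lemma Q_parallelogram:
  assumes "Xpair u g" "Xpair w k"
  shows "Q (\<lambda>x. u x - w x) (\<lambda>x. g x - k x) =
    2 * Q u g + 2 * Q w k - 4 * Q (\<lambda>x. 1/2 * u x + 1/2 * w x) (\<lambda>x. (1/2) *\<^sub>R g x + (1/2) *\<^sub>R k x)"
proof -
  note L = sob_grad_L2[of u g] sob_grad_L2[of w k]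
  have Lg: "L2 g" "L2 k" using assms L by (auto simp: Xpair_def)
  note Lv = sqrtV_L2[OF assms(1)] sqrtV_L2[OF assms(2)]
  have "En (\<lambda>x. g x - k x) = 2 * En g + 2 * En k - En (\<lambda>x. g x + k x)"
    using En_parallelogram[OF Lg] by linarith
  also have "En (\<lambda>x. g x + k x) = 4 * En (\<lambda>x. (1/2) *\<^sub>R g x + (1/2) *\<^sub>R k x)"
    using En_scaleR[of "1/2" "\<lambda>x. g x + k x"] by (simp add: scaleR_add_right power2_eq_square)
  finally have 1: "En (\<lambda>x. g x - k x) = 2 * En g + 2 * En k - 4 * En (\<lambda>x. (1/2) *\<^sub>R g x + (1/2) *\<^sub>R k x)" .
  note X1 = Xpair_diff[OF assms] and X2 = Xpair_lincomb[OF assms, of "1/2" "1/2"]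
  have "En (\<lambda>x. sqrt (V x) * u x - sqrt (V x) * w x) + En (\<lambda>x. sqrt (V x) * u x + sqrt (V x) * w x)
     = 2 * pot V u + 2 * pot V w"
    using En_parallelogram[OF Lv(1) Lv(3)] Lv(2,4) by linarith
  moreover have "En (\<lambda>x. sqrt (V x) * u x - sqrt (V x) * w x) = pot V (\<lambda>x. u x - w x)"
    using sqrtV_L2(2)[OF X1] by (simp add: right_diff_distrib)
  moreover have "En (\<lambda>x. sqrt (V x) * u x + sqrt (V x) * w x) = 4 * pot V (\<lambda>x. 1/2 * u x + 1/2 * w x)"
  proof -
    have "pot V (\<lambda>x. 1/2 * u x + 1/2 * w x) = En (\<lambda>x. 1/2 * (sqrt (V x) * u x + sqrt (V x) * w x))"
      using sqrtV_L2(2)[OF X2] by (simp add: algebra_simps)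
    then show ?thesis unfolding En_cmult by (simp add: power2_eq_square)
  qed
  ultimately show ?thesis using 1 by (simp add: Q_def)
qed

lemma Q_triangle:
  assumes "Xpair u g" "Xpair w k" "Xpair z l"
  shows "Q (\<lambda>x. u x - z x) (\<lambda>x. g x - l x) \<le> 2 * Q (\<lambda>x. u x - w x) (\<lambda>x. g x - k x) + 2 * Q (\<lambda>x. w x - z x) (\<lambda>x. k x - l x)"
proof -
  note X = Xpair_diff[OF assms(1,2)] Xpair_diff[OF assms(2,3)] Xpair_diff[OF assms(1,3)]
  have "En (\<lambda>x. g x - l x) \<le> 2 * En (\<lambda>x. g x - k x) + 2 * En (\<lambda>x. k x - l x)"
    by (rule En_triangle) (use assms sob_grad_L2 in \<open>auto simp: Xpair_def\<close>)
  moreover have "pot V (\<lambda>x. u x - z x) \<le> 2 * pot V (\<lambda>x. u x - w x) + 2 * pot V (\<lambda>x. w x - z x)"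
    using En_triangle[OF sqrtV_L2(1)[OF assms(1)] sqrtV_L2(1)[OF assms(2)] sqrtV_L2(1)[OF assms(3)]]
      sqrtV_L2(2)[OF X(1)] sqrtV_L2(2)[OF X(2)] sqrtV_L2(2)[OF X(3)]
    by (simp add: right_diff_distrib)
  ultimately show ?thesis by (simp add: Q_def)
qed

lemma midhull_Xpair:
  assumes "\<And>u g. (u, g) \<in> S \<Longrightarrow> Xpair u g" "p \<in> midhull S"
  shows "Xpair (fst p) (snd p)"
  using assms(2)
proof (induction p rule: midhull.induct)
  case (base p) then show ?case using assms(1)[of "fst p" "snd p"] by simp
next
  case (mid u g w k) then show ?case using Xpair_lincomb[of u g w k "1/2" "1/2"] by simp
qed

lemma midhull_En_le:
  assumes "\<And>u g. (u, g) \<in> S \<Longrightarrow> Xpair u g" "L2 u0" "\<And>u g. (u, g) \<in> S \<Longrightarrow> En (\<lambda>x. u x - u0 x) \<le> C" "p \<in> midhull S"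
  shows "En (\<lambda>x. fst p x - u0 x) \<le> C"
  using assms(4)
proof (induction p rule: midhull.induct)
  case (base p) then show ?case using assms(3)[of "fst p" "snd p"] by simp
next
  case (mid u g w k)
  have "L2 u" "L2 w" using midhull_Xpair[OF assms(1) mid(1)] midhull_Xpair[OF assms(1) mid(2)] sob_L2
    by (auto simp: Xpair_def)
  from En_midpoint_diff_le[OF this assms(2), of C] mid show ?case by simp
qed

text \<open>A minimizing sequence of the energy over the hulls of the tails is Cauchy by the parallelogram
  identity.\<close>

lemma hull_limit:
  assumes X: "\<And>n. Xpair (u n) (g n)" and M: "\<And>n. Q (u n) (g n) \<le> M"
    and u0: "L2 u0" and lim: "(\<lambda>n. En (\<lambda>x. u n x - u0 x)) \<longlonglongrightarrow> 0"
  shows "\<exists>g0 w k. Xpair u0 g0 \<and> (\<forall>n. (w n, k n) \<in> midhull (range (\<lambda>i. (u i, g i)))) \<and>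
    (\<lambda>n. Q (\<lambda>x. w n x - u0 x) (\<lambda>x. k n x - g0 x)) \<longlonglongrightarrow> 0"
proof -
  define T where "T n = (\<lambda>i. (u i, g i)) ` {n..}" for n :: nat
  have TX: "Xpair a b" if "(a, b) \<in> T n" for a b n using that X by (auto simp: T_def)
  have Tm: "m \<le> n \<Longrightarrow> midhull (T n) \<subseteq> midhull (T m)" for m n
    by (intro midhull_mono) (auto simp: T_def)
  define E where "E n = (\<lambda>p. Q (fst p) (snd p)) ` midhull (T n)" for n
  have bdd: "bdd_below (E n)" for n unfolding E_def by (rule bdd_belowI[of _ 0]) (auto simp: Q_nonneg)
  have inT: "(u n, g n) \<in> midhull (T n)" for n by (rule midhull.base) (auto simp: T_def)
  have ne: "E n \<noteq> {}" for n using inT by (auto simp: E_def)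
  \<comment> \<open>The hulls of the tails shrink, so these infima increase, and they are bounded by
    M; their convergence drives the Cauchy estimate.\<close>
  define d where "d n = Inf (E n)" for n
  have dM: "d n \<le> M" for n
    unfolding d_def by (rule order_trans[OF cInf_lower[OF _ bdd] M[of n]]) (use inT[of n] in \<open>force simp: E_def\<close>)
  have dle: "d n \<le> Q (fst p) (snd p)" if "p \<in> midhull (T n)" for n p
    unfolding d_def by (rule cInf_lower[OF _ bdd]) (use that in \<open>auto simp: E_def\<close>)
  have dmono: "incseq d" unfolding incseq_def d_def
  proof (intro allI impI)
    fix m n :: nat assume "m \<le> n"
    then have "E n \<subseteq> E m" using Tm by (auto simp: E_def)
    then show "Inf (E m) \<le> Inf (E n)" by (intro cInf_superset_mono ne bdd)
  qed
  obtain dl where dl: "d \<longlonglongrightarrow> dl" "\<And>n. d n \<le> dl"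
    using incseq_convergent[OF dmono, of M] dM by auto
  define \<sigma> where "\<sigma> n = inverse (real (Suc n))" for n
  have sp: "\<sigma> n > 0" for n by (simp add: \<sigma>_def)
  have "\<exists>p \<in> midhull (T n). Q (fst p) (snd p) < d n + \<sigma> n" for n
  proof -
    have "\<exists>y\<in>E n. y < d n + \<sigma> n" unfolding d_def using cInf_lessD[OF ne, of n "Inf (E n) + \<sigma> n"] sp by auto
    then show ?thesis by (auto simp: E_def)
  qed
  then obtain p where p: "\<And>n. p n \<in> midhull (T n)" "\<And>n. Q (fst (p n)) (snd (p n)) < d n + \<sigma> n" by metis
  define w k where "w n = fst (p n)" and "k n = snd (p n)" for n
  have wk: "(w n, k n) \<in> midhull (T n)" for n using p(1) by (simp add: w_def k_def)
  have wX: "Xpair (w n) (k n)" for n using midhull_Xpair[OF TX p(1)] by (simp add: w_def k_def)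
  have wQ: "Q (w n) (k n) < d n + \<sigma> n" for n using p(2) by (simp add: w_def k_def)
  have QC1: "Q (\<lambda>x. w n x - w m x) (\<lambda>x. k n x - k m x) \<le> 4 * (dl - d n) + 4 * \<sigma> n" if "n \<le> m" for n m
  proof -
    \<comment> \<open>For n <= m both elements lie in the hull of the earlier tail, so their
      midpoint has energy at least \<open>d n\<close>.\<close>
    have "(w m, k m) \<in> midhull (T n)" using wk[of m] Tm[OF that] by auto
    from dle[OF midhull.mid[OF wk[of n] this]]
    have "d n \<le> Q (\<lambda>x. 1/2 * w n x + 1/2 * w m x) (\<lambda>x. (1/2) *\<^sub>R k n x + (1/2) *\<^sub>R k m x)" by simp
    moreover have "\<sigma> m \<le> \<sigma> n" using that by (simp add: \<sigma>_def le_imp_inverse_le)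
    moreover have "2 * a + 2 * b - 4 * c \<le> 4 * (l - x) + 4 * s"
      if "x \<le> c" "t \<le> s" "a < x + s" "b < y + t" "y \<le> l" "x \<le> l" for a b c l x y s t :: real
      using that by argo
    ultimately show ?thesis
      unfolding Q_parallelogram[OF wX wX] using wQ[of n] wQ[of m] dl(2)[of m] dl(2)[of n] by blast
  qed
  have QC: "\<exists>N. \<forall>m\<ge>N. \<forall>n\<ge>N. Q (\<lambda>x. w m x - w n x) (\<lambda>x. k m x - k n x) < e" if e: "e > 0" for e
  proof -
    have "(\<lambda>n. 4 * (dl - d n) + 4 * \<sigma> n) \<longlonglongrightarrow> 4 * (dl - dl) + 4 * 0"
      unfolding \<sigma>_def by (intro tendsto_intros dl(1) LIMSEQ_inverse_real_of_nat)
    then have "eventually (\<lambda>n. 4 * (dl - d n) + 4 * \<sigma> n < e / 4) sequentially"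
      using e by (intro order_tendstoD(2)) auto
    then obtain N where N: "4 * (dl - d N) + 4 * \<sigma> N < e / 4"
      by (auto simp: eventually_sequentially)
    show ?thesis
    proof (intro exI[of _ N] allI impI)
      fix m n assume mn: "m \<ge> N" "n \<ge> N"
      have "Q (\<lambda>x. w m x - w n x) (\<lambda>x. k m x - k n x) \<le>
        2 * Q (\<lambda>x. w m x - w N x) (\<lambda>x. k m x - k N x) + 2 * Q (\<lambda>x. w N x - w n x) (\<lambda>x. k N x - k n x)"
        by (rule Q_triangle[OF wX wX wX])
      moreover have "Q (\<lambda>x. w m x - w N x) (\<lambda>x. k m x - k N x) = Q (\<lambda>x. w N x - w m x) (\<lambda>x. k N x - k m x)"
        unfolding Q_def pot_def using En_minus_commute[of "k m" "k N"] by (simp add: power2_commute)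
      ultimately show "Q (\<lambda>x. w m x - w n x) (\<lambda>x. k m x - k n x) < e"
        using QC1[OF mn(1)] QC1[OF mn(2)] N by linarith
    qed
  qed
  have wL: "L2 (w n)" and kL: "L2 (k n)" for n
    using wX[of n] sob_L2[of "w n" "k n"] sob_grad_L2[of "w n" "k n"] by (auto simp: Xpair_def)
  \<comment> \<open>Here it matters that w n comes from the n-th tail: late tails lie in small L2
    balls around u0, and midpoints stay in these balls, so the minimisers have the same L2 limit as
    the original sequence.\<close>
  have wlim: "(\<lambda>n. En (\<lambda>x. w n x - u0 x)) \<longlonglongrightarrow> 0"
  proof (rule LIMSEQ_I)
    fix e :: real assume e: "e > 0"
    have "eventually (\<lambda>n. En (\<lambda>x. u n x - u0 x) < e / 2) sequentially"
      using lim by (rule order_tendstoD(2)) (use e in simp)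
    then obtain N where N: "\<And>n. n \<ge> N \<Longrightarrow> En (\<lambda>x. u n x - u0 x) < e / 2" by (auto simp: eventually_sequentially)
    have "En (\<lambda>x. w n x - u0 x) \<le> e / 2" if "n \<ge> N" for n
      unfolding w_def by (rule midhull_En_le[OF TX u0 _ p(1)]) (use N that in \<open>auto simp: T_def intro: less_imp_le\<close>)
    then show "\<exists>no. \<forall>n\<ge>no. norm (En (\<lambda>x. w n x - u0 x) - 0) < e"
      using e by (intro exI[of _ N]) (auto simp: En_nonneg dest!: spec intro: le_less_trans[of _ "e / 2"])
  qed
  obtain g0 where g0: "L2 g0" and klim: "(\<lambda>n. En (\<lambda>x. k n x - g0 x)) \<longlonglongrightarrow> 0"
  proof (rule L2_complete[OF kL])
    fix e :: real assume "e > 0"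
    then obtain N where "\<forall>m\<ge>N. \<forall>n\<ge>N. Q (\<lambda>x. w m x - w n x) (\<lambda>x. k m x - k n x) < e" using QC by blast
    moreover have "En (\<lambda>x. k m x - k n x) \<le> Q (\<lambda>x. w m x - w n x) (\<lambda>x. k m x - k n x)" for m n
      by (simp add: Q_def pot_nonneg)
    ultimately show "\<exists>N. \<forall>m\<ge>N. \<forall>n\<ge>N. En (\<lambda>x. k m x - k n x) < e"
      using le_less_trans by blast
  qed (rule that)
  have s0: "sob u0 g0" by (rule sob_limit[OF _ u0 g0 wlim klim]) (use wX in \<open>auto simp: Xpair_def\<close>)
  \<comment> \<open>The potential part only yields some L2 limit of sqrt(V) w; it is identified with
    sqrt(V) u0 through nested a.e. convergent subsequences.\<close>
  obtain z where z: "L2 z" and zlim: "(\<lambda>n. En (\<lambda>x. sqrt (V x) * w n x - z x)) \<longlonglongrightarrow> 0"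
  proof (rule L2_complete[OF sqrtV_L2(1)[OF wX]])
    fix e :: real assume "e > 0"
    then obtain N where N: "\<forall>m\<ge>N. \<forall>n\<ge>N. Q (\<lambda>x. w m x - w n x) (\<lambda>x. k m x - k n x) < e" using QC by blast
    have "En (\<lambda>x. sqrt (V x) * w m x - sqrt (V x) * w n x) \<le> Q (\<lambda>x. w m x - w n x) (\<lambda>x. k m x - k n x)" for m n
      using sqrtV_L2(2)[OF Xpair_diff[OF wX wX], of m n] En_nonneg[of "\<lambda>x. k m x - k n x"]
      by (simp add: Q_def right_diff_distrib)
    then show "\<exists>N. \<forall>m\<ge>N. \<forall>n\<ge>N. En (\<lambda>x. sqrt (V x) * w m x - sqrt (V x) * w n x) < e"
      using N le_less_trans by blast
  qed (rule that)
  have u0m[measurable]: "u0 \<in> borel_measurable borel" using u0 by (rule L2_measurable)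
  have zeq: "AE x in lborel. z x = sqrt (V x) * u0 x"
  proof -
    obtain r1 where r1: "strict_mono (r1 :: nat \<Rightarrow> nat)" "AE x in lborel. (\<lambda>n. w (r1 n) x) \<longlonglongrightarrow> u0 x"
      using L2_AE_subseq[OF wL u0 wlim] by blast
    have "(\<lambda>n. En (\<lambda>x. sqrt (V x) * w (r1 n) x - z x)) \<longlonglongrightarrow> 0"
      using LIMSEQ_subseq_LIMSEQ[OF zlim r1(1)] by (simp add: o_def)
    then obtain r2 where r2: "strict_mono (r2 :: nat \<Rightarrow> nat)"
      "AE x in lborel. (\<lambda>n. sqrt (V x) * w (r1 (r2 n)) x) \<longlonglongrightarrow> z x"
      using L2_AE_subseq[OF sqrtV_L2(1)[OF wX] z, of r1] by blast
    show ?thesis using r1(2) r2(2)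
    proof eventually_elim
      case (elim x)
      have "(\<lambda>n. w (r1 (r2 n)) x) \<longlonglongrightarrow> u0 x"
        using LIMSEQ_subseq_LIMSEQ[OF elim(1) r2(1)] by (simp add: o_def)
      then have "(\<lambda>n. sqrt (V x) * w (r1 (r2 n)) x) \<longlonglongrightarrow> sqrt (V x) * u0 x" by (intro tendsto_intros)
      then show ?case using elim(2) LIMSEQ_unique by blast
    qed
  qed
  note Vm[measurable]
  have zL: "L2 (\<lambda>x. sqrt (V x) * u0 x)" by (rule L2_cong_AE[OF zeq _ z]) simp
  then have X0: "Xpair u0 g0" using s0 sqrtV_L2_iff[OF u0m] by (simp add: Xpair_def)
  have "En (\<lambda>x. sqrt (V x) * w n x - z x) = pot V (\<lambda>x. w n x - u0 x)" for n
  proof -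
    have "En (\<lambda>x. sqrt (V x) * w n x - z x) = En (\<lambda>x. sqrt (V x) * (w n x - u0 x))"
      using zeq L2_measurable[OF z] L2_measurable[OF wL, of n]
      by (intro En_cong_AE) (auto simp: right_diff_distrib)
    then show ?thesis using sqrtV_L2(2)[OF Xpair_diff[OF wX X0]] by simp
  qed
  then have plim: "(\<lambda>n. pot V (\<lambda>x. w n x - u0 x)) \<longlonglongrightarrow> 0" using zlim by simp
  have Qlim: "(\<lambda>n. Q (\<lambda>x. w n x - u0 x) (\<lambda>x. k n x - g0 x)) \<longlonglongrightarrow> 0"
    unfolding Q_def using tendsto_add[OF klim plim] by simp
  have "(w n, k n) \<in> midhull (range (\<lambda>i. (u i, g i)))" for n
    using wk[of n] midhull_mono[of "T n" "range (\<lambda>i. (u i, g i))"] by (auto simp: T_def)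
  then show ?thesis using X0 Qlim by blast
qed

section \<open>Bounded functionals on the energy space\<close>

lemma X_dual_bounded_tendsto:
  assumes f: "X_dual V f" and X: "\<And>n. Xpair (w n) (k n)" "Xpair u0 g0"
    and lim: "(\<lambda>n. Q (\<lambda>x. w n x - u0 x) (\<lambda>x. k n x - g0 x)) \<longlonglongrightarrow> 0"
  shows "(\<lambda>n. f (w n)) \<longlonglongrightarrow> f u0"
proof -
  obtain C where C: "\<And>u. Xsp V u \<Longrightarrow> \<bar>f u\<bar> \<le> C * X_norm V u" using f unfolding X_dual_def by blast
  have le: "\<bar>f (w n) - f u0\<bar> \<le> C * sqrt (Q (\<lambda>x. w n x - u0 x) (\<lambda>x. k n x - g0 x))" for n
  proof -
    note D = Xpair_diff[OF X(1)[of n] X(2)]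
    have "f (\<lambda>x. 1 * w n x + (-1) * u0 x) = 1 * f (w n) + (-1) * f u0"
      using f X Xsp_iff unfolding X_dual_def by blast
    then have "f (\<lambda>x. w n x - u0 x) = f (w n) - f u0" by simp
    then show ?thesis using C[of "\<lambda>x. w n x - u0 x"] D X_norm_Xpair[OF D] Xsp_iff by auto
  qed
  have "(\<lambda>n. C * sqrt (Q (\<lambda>x. w n x - u0 x) (\<lambda>x. k n x - g0 x))) \<longlonglongrightarrow> C * sqrt 0"
    by (intro tendsto_intros lim)
  then have "(\<lambda>n. C * sqrt (Q (\<lambda>x. w n x - u0 x) (\<lambda>x. k n x - g0 x))) \<longlonglongrightarrow> 0" by simp
  then have "(\<lambda>n. f (w n) - f u0) \<longlonglongrightarrow> 0"
    by (rule Lim_null_comparison[rotated]) (use le in simp)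
  then show ?thesis by (simp add: LIM_zero_iff)
qed

lemma X_dual_hull_ge:
  assumes f: "X_dual V f" and X: "\<And>u g. (u, g) \<in> S \<Longrightarrow> Xpair u g" and ge: "\<And>u g. (u, g) \<in> S \<Longrightarrow> c \<le> f u"
    and p: "p \<in> midhull S"
  shows "c \<le> f (fst p)"
  using p
proof (induction p rule: midhull.induct)
  case (base p) then show ?case using ge[of "fst p" "snd p"] by simp
next
  case (mid u g w k)
  have "Xsp V u" "Xsp V w"
    using midhull_Xpair[OF X mid(1)] midhull_Xpair[OF X mid(2)] Xsp_iff by auto
  then have "f (\<lambda>x. 1/2 * u x + 1/2 * w x) = 1/2 * f u + 1/2 * f w"
    using f unfolding X_dual_def by blast
  then show ?case using mid by simp
qed

lemma X_dual_uminus: "X_dual V f \<Longrightarrow> X_dual V (\<lambda>u. - f u)"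
  unfolding X_dual_def by (auto simp: algebra_simps)

text \<open>One-sided, because midpoints preserve a half space f >= c but not the complement of an
  interval; the other side follows from applying it to -f. The conclusion concerns the whole
  sequence, so weak convergence costs no further subsequence.\<close>

lemma X_dual_not_frequently_ge:
  assumes f: "X_dual V f" and X: "\<And>n. Xpair (u n) (g n)" and M: "\<And>n. Q (u n) (g n) \<le> M"
    and u0: "L2 u0" and lim: "(\<lambda>n. En (\<lambda>x. u n x - u0 x)) \<longlonglongrightarrow> 0" and e: "e > 0"
  shows "eventually (\<lambda>n. f (u n) < f u0 + e) sequentially"
proof (rule ccontr)
  assume "\<not> ?thesis"
  then have "\<forall>N. \<exists>n>N. f (u n) \<ge> f u0 + e"
    unfolding eventually_sequentially by (metis Suc_le_eq not_less)
  then have inf: "infinite {n. f (u n) \<ge> f u0 + e}" by (auto simp: infinite_nat_iff_unbounded)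
  define r where "r = enumerate {n. f (u n) \<ge> f u0 + e}"
  have r: "strict_mono r" "\<And>n. f (u (r n)) \<ge> f u0 + e"
    using strict_mono_enumerate[OF inf] enumerate_in_set[OF inf] by (auto simp: r_def)
  have "(\<lambda>n. En (\<lambda>x. u (r n) x - u0 x)) \<longlonglongrightarrow> 0"
    using LIMSEQ_subseq_LIMSEQ[OF lim r(1)] by (simp add: o_def)
  then obtain g0 w k where X0: "Xpair u0 g0" and h: "\<And>n. (w n, k n) \<in> midhull (range (\<lambda>i. (u (r i), g (r i))))"
    and Ql: "(\<lambda>n. Q (\<lambda>x. w n x - u0 x) (\<lambda>x. k n x - g0 x)) \<longlonglongrightarrow> 0"
    using hull_limit[of "\<lambda>n. u (r n)" "\<lambda>n. g (r n)" M u0, OF X M u0] by blast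
  have RX: "Xpair a b" if "(a, b) \<in> range (\<lambda>i. (u (r i), g (r i)))" for a b using that X by auto
  have wX: "Xpair (w n) (k n)" for n using midhull_Xpair[OF RX h, of n] by simp
  have "f u0 + e \<le> f (w n)" for n
    using X_dual_hull_ge[OF f RX _ h, of "f u0 + e" n] r(2) by auto
  then have "f u0 + e \<le> f u0"
    using LIMSEQ_le_const[OF X_dual_bounded_tendsto[OF f wX X0 Ql]] by blast
  then show False using e by simp
qed

lemma weak_conv:
  assumes X: "\<And>n. Xpair (u n) (g n)" and M: "\<And>n. Q (u n) (g n) \<le> M"
    and u0: "L2 u0" and lim: "(\<lambda>n. En (\<lambda>x. u n x - u0 x)) \<longlonglongrightarrow> 0"
  shows "weak_conv_X V u u0"
  unfolding weak_conv_X_def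
proof (intro conjI allI impI)
  show "Xsp V (u n)" for n using X Xsp_iff by blast
  show "Xsp V u0" using hull_limit[OF X M u0 lim] Xsp_iff by blast
  fix f assume f: "X_dual V f"
  show "(\<lambda>n. f (u n)) \<longlonglongrightarrow> f u0"
  proof (rule order_tendstoI)
    fix a assume a: "a < f u0"
    show "eventually (\<lambda>n. a < f (u n)) sequentially"
      using X_dual_not_frequently_ge[OF X_dual_uminus[OF f] X M u0 lim, of "f u0 - a"] a by simp
  next
    fix a assume a: "a > f u0"
    show "eventually (\<lambda>n. f (u n) < a) sequentially"
      using X_dual_not_frequently_ge[OF f X M u0 lim, of "a - f u0"] a by simp
  qed
qed

end

section \<open>Functions vanishing outside a smooth domain\<close>

text \<open>Membership in H^1_0 with an explicit gradient of the limit and the two energies kept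
  apart; in this form it passes to sums and limits without evaluating \<open>wgrad\<close>.\<close>

definition approx0 :: "(real^'n) set \<Rightarrow> (real^'n \<Rightarrow> real) \<Rightarrow> (real^'n \<Rightarrow> real^'n) \<Rightarrow> bool" where
  "approx0 \<Omega> u g \<longleftrightarrow> sob u g \<and> (\<forall>e>0. \<exists>\<phi>. test_fn \<phi> \<Omega> \<and>
     En (\<lambda>x. \<phi> x - u x) \<le> e \<and> En (\<lambda>x. (\<chi> i. partial i \<phi> x) - g x) \<le> e)"

lemma sob_test_fn: assumes t: "test_fn \<phi> U" shows "sob \<phi> (\<lambda>x. \<chi> i. partial i \<phi> x)"
  by (intro sob_smooth test_fn_smooth[OF t] test_fn_L2[OF t] test_fn_L2[OF test_fn_partial[OF t]])

lemma approx0_H10_ext: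
  assumes a: "approx0 \<Omega> u g" shows "H10_ext \<Omega> u"
proof -
  have s: "sob u g" using a by (simp add: approx0_def)
  have "\<forall>k. \<exists>\<phi>. test_fn \<phi> \<Omega> \<and> En (\<lambda>x. \<phi> x - u x) \<le> 1 / Suc k \<and> En (\<lambda>x. (\<chi> i. partial i \<phi> x) - g x) \<le> 1 / Suc k"
    using a unfolding approx0_def by (auto dest!: spec[of _ "1 / real (Suc _)"])
  from choice[OF this] obtain \<phi> where \<phi>: "\<And>k. test_fn (\<phi> k) \<Omega>" "\<And>k. En (\<lambda>x. \<phi> k x - u x) \<le> 1 / Suc k"
    "\<And>k. En (\<lambda>x. (\<chi> i. partial i (\<phi> k) x) - g x) \<le> 1 / Suc k" by blast
  have n: "H1_norm (\<lambda>x. \<phi> k x - u x) = sqrt (En (\<lambda>x. (\<chi> i. partial i (\<phi> k) x) - g x) + En (\<lambda>x. \<phi> k x - u x))" for k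
    by (rule H1_norm_sob[OF sob_diff[OF sob_test_fn[OF \<phi>(1)] s]])
  have le: "H1_norm (\<lambda>x. \<phi> k x - u x) \<le> sqrt (2 * inverse (Suc k))" for k
    unfolding n using \<phi>(2)[of k] \<phi>(3)[of k] by (intro real_sqrt_le_mono) (simp add: inverse_eq_divide)
  have nn: "0 \<le> H1_norm (\<lambda>x. \<phi> k x - u x)" for k unfolding n by (simp add: En_nonneg)
  have "(\<lambda>k. sqrt (2 * inverse (Suc k))) \<longlonglongrightarrow> sqrt (2 * 0)" by (intro tendsto_intros LIMSEQ_inverse_real_of_nat)
  then have lim0: "(\<lambda>k. sqrt (2 * inverse (Suc k))) \<longlonglongrightarrow> 0" by simp
  have "(\<lambda>k. H1_norm (\<lambda>x. \<phi> k x - u x)) \<longlonglongrightarrow> 0"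
  proof (rule Lim_null_comparison[OF _ lim0], intro always_eventually allI)
    show "norm (H1_norm (\<lambda>x. \<phi> k x - u x)) \<le> sqrt (2 * inverse (Suc k))" for k
      using le[of k] nn[of k] unfolding real_norm_def abs_of_nonneg[OF nn] by blast
  qed
  moreover have "H1 u" using s H1_iff_sob by blast
  ultimately show ?thesis using \<phi>(1) unfolding H10_ext_def by blast
qed

lemma test_fn_add: assumes "test_fn f U" "test_fn g U" shows "test_fn (\<lambda>x. f x + g x) U"
proof -
  obtain K where K: "compact K" "K \<subseteq> U" "\<And>x. x \<notin> K \<Longrightarrow> f x = 0" using test_fn_support[OF assms(1)] by blast
  obtain L where L: "compact L" "L \<subseteq> U" "\<And>x. x \<notin> L \<Longrightarrow> g x = 0" using test_fn_support[OF assms(2)] by blast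
  show ?thesis
    by (rule test_fnI[of _ "K \<union> L"]) (use K L assms test_fn_smooth in \<open>auto intro!: smooth_on_add compact_Un\<close>)
qed

lemma approx0_add:
  assumes "approx0 \<Omega> u g" "approx0 \<Omega> w k"
  shows "approx0 \<Omega> (\<lambda>x. u x + w x) (\<lambda>x. g x + k x)"
  unfolding approx0_def
proof (intro conjI allI impI)
  have s: "sob u g" "sob w k" using assms by (auto simp: approx0_def)
  then show "sob (\<lambda>x. u x + w x) (\<lambda>x. g x + k x)" by (rule sob_add)
  fix e :: real assume "e > 0"
  then have e4: "e / 4 > 0" by simp
  obtain \<phi> where p: "test_fn \<phi> \<Omega>" "En (\<lambda>x. \<phi> x - u x) \<le> e / 4" "En (\<lambda>x. (\<chi> i. partial i \<phi> x) - g x) \<le> e / 4"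
    using assms(1) e4 unfolding approx0_def by blast
  obtain \<psi> where q: "test_fn \<psi> \<Omega>" "En (\<lambda>x. \<psi> x - w x) \<le> e / 4" "En (\<lambda>x. (\<chi> i. partial i \<psi> x) - k x) \<le> e / 4"
    using assms(2) e4 unfolding approx0_def by blast
  note P = sob_diff[OF sob_test_fn[OF p(1)] s(1)] and W = sob_diff[OF sob_test_fn[OF q(1)] s(2)]
  have 1: "En (\<lambda>x. (\<phi> x - u x) + (\<psi> x - w x)) \<le> e"
    using En_add_le[OF sob_L2[OF P] sob_L2[OF W]] p(2) q(2) by argo
  have 2: "En (\<lambda>x. ((\<chi> i. partial i \<phi> x) - g x) + ((\<chi> i. partial i \<psi> x) - k x)) \<le> e"
    using En_add_le[OF sob_grad_L2[OF P] sob_grad_L2[OF W]] p(3) q(3) by argo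
  have pd: "(\<chi> i. partial i (\<lambda>x. \<phi> x + \<psi> x) x) = (\<chi> i. partial i \<phi> x) + (\<chi> i. partial i \<psi> x)" for x
    using partial_add[OF smooth_on_differentiable[OF test_fn_smooth[OF p(1)]] smooth_on_differentiable[OF test_fn_smooth[OF q(1)]]]
    by (simp add: vec_eq_iff)
  show "\<exists>\<phi>. test_fn \<phi> \<Omega> \<and> En (\<lambda>x. \<phi> x - (u x + w x)) \<le> e \<and> En (\<lambda>x. (\<chi> i. partial i \<phi> x) - (g x + k x)) \<le> e"
    using test_fn_add[OF p(1) q(1)] 1 2 by (intro exI[of _ "\<lambda>x. \<phi> x + \<psi> x"]) (simp add: pd algebra_simps)
qed

lemma approx0_limit:
  assumes s: "sob u g"
    and a: "\<And>e. e > 0 \<Longrightarrow> \<exists>w k. approx0 \<Omega> w k \<and> En (\<lambda>x. w x - u x) \<le> e \<and> En (\<lambda>x. k x - g x) \<le> e"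
  shows "approx0 \<Omega> u g"
  unfolding approx0_def
proof (intro conjI allI impI s)
  fix e :: real assume "e > 0"
  then have e4: "e / 4 > 0" by simp
  obtain w k where wk: "approx0 \<Omega> w k" "En (\<lambda>x. w x - u x) \<le> e / 4" "En (\<lambda>x. k x - g x) \<le> e / 4"
    using a[OF e4] by blast
  then obtain \<phi> where p: "test_fn \<phi> \<Omega>" "En (\<lambda>x. \<phi> x - w x) \<le> e / 4" "En (\<lambda>x. (\<chi> i. partial i \<phi> x) - k x) \<le> e / 4"
    using e4 unfolding approx0_def by blast
  have sw: "sob w k" using wk by (simp add: approx0_def)
  note sp = sob_test_fn[OF p(1)]
  have "En (\<lambda>x. \<phi> x - u x) \<le> e"
    using En_triangle[OF sob_L2[OF sp] sob_L2[OF sw] sob_L2[OF s]] p(2) wk(2) by argo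
  moreover have "En (\<lambda>x. (\<chi> i. partial i \<phi> x) - g x) \<le> e"
    using En_triangle[OF sob_grad_L2[OF sp] sob_grad_L2[OF sw] sob_grad_L2[OF s]] p(3) wk(3) by argo
  ultimately show "\<exists>\<phi>. test_fn \<phi> \<Omega> \<and> En (\<lambda>x. \<phi> x - u x) \<le> e \<and> En (\<lambda>x. (\<chi> i. partial i \<phi> x) - g x) \<le> e"
    using p(1) by blast
qed

lemma approx0_compact_support:
  fixes u :: "real^'n \<Rightarrow> real"
  assumes s: "sob u g" and K: "compact K" "K \<subseteq> \<Omega>" "open \<Omega>" and z: "AE x in lborel. x \<notin> K \<longrightarrow> u x = 0"
  shows "approx0 \<Omega> u g"
  unfolding approx0_def
proof (intro conjI allI impI s)
  fix e :: real assume e: "e > 0"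
  obtain \<epsilon> where \<epsilon>: "\<epsilon> > 0" "(\<Union>x\<in>K. ball x \<epsilon>) \<subseteq> \<Omega>"
    using compact_subset_open_imp_ball_epsilon_subset[OF K(1,3,2)] by blast
  \<comment> \<open>Mollifying at a radius of at most d enlarges the support to the sum of K and a
    ball of radius d; half of eps keeps this set inside Omega.\<close>
  define d where "d = \<epsilon> / 2"
  have d: "d > 0" using \<epsilon> by (simp add: d_def)
  define K' where "K' = {x + y | x y. x \<in> K \<and> y \<in> cball (0::real^'n) d}"
  have K': "compact K'" unfolding K'_def by (intro compact_sums K compact_cball)
  have K'\<Omega>: "K' \<subseteq> \<Omega>"
  proof
    fix z assume "z \<in> K'"
    then obtain x y where "z = x + y" "x \<in> K" "norm y \<le> d" by (auto simp: K'_def)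
    then have "z \<in> ball x \<epsilon>" "x \<in> K" using \<epsilon>(1) by (auto simp: dist_norm d_def)
    then show "z \<in> \<Omega>" using \<epsilon>(2) by blast
  qed
  obtain \<eta> :: "real^'n \<Rightarrow> real" and \<delta> B where t: "test_fn \<eta> UNIV" and k: "kernel \<eta> \<delta> B" and \<delta>: "\<delta> \<le> d"
    and a: "En (\<lambda>x. conv \<eta> u x - u x) \<le> e" "En (\<lambda>x. vconv \<eta> g x - g x) \<le> e"
    using mollifier_approx[OF sob_L2[OF s] sob_grad_L2[OF s] e d] by blast
  have "conv \<eta> u x = 0" if x: "x \<notin> K'" for x
  proof -
    have "AE y in lborel. u y * \<eta> (x - y) = 0"
      using z
    proof eventually_elim
      case (elim y)
      show ?case
      proof (cases "y \<in> K")
        case True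
        then have "\<not> norm (x - y) \<le> d" using x
          by (auto simp: K'_def)
        then have "norm (x - y) > \<delta>" using \<delta> by linarith
        then have "\<eta> (x - y) = 0" using k unfolding kernel_def by blast
        then show ?thesis by simp
      qed (use elim in simp)
    qed
    then have "(\<integral>y. u y * \<eta> (x - y) \<partial>lborel) = 0" by (rule integral_eq_zero_AE)
    then show ?thesis using conv_alt(1)[OF t sob_L2[OF s]] by simp
  qed
  then have "test_fn (conv \<eta> u) \<Omega>"
    by (rule test_fnI[OF smooth_conv[OF t sob_L2[OF s]] K' K'\<Omega>])
  then show "\<exists>\<phi>. test_fn \<phi> \<Omega> \<and> En (\<lambda>x. \<phi> x - u x) \<le> e \<and> En (\<lambda>x. (\<chi> i. partial i \<phi> x) - g x) \<le> e"
    using a by (intro exI[of _ "conv \<eta> u"]) (simp add: sob_conv(2)[OF t k s])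
qed

text \<open>The translate u(x - t nu) is supported in K + t nu, a compact subset of Omega, and is
  therefore reached by mollification. As t tends to 0, it converges to u together with its gradient,
  since translation is continuous in L2.\<close>

lemma approx0_push_inside:
  fixes u :: "real^'n \<Rightarrow> real"
  assumes s: "sob u g" and K: "compact K" "open \<Omega>" and z: "AE x in lborel. x \<notin> K \<longrightarrow> u x = 0"
    and t0: "t0 > 0" "\<And>y t. y \<in> K \<Longrightarrow> 0 < t \<Longrightarrow> t < t0 \<Longrightarrow> y + t *\<^sub>R \<nu> \<in> \<Omega>"
  shows "approx0 \<Omega> u g"
proof (rule approx0_limit[OF s])
  fix e :: real assume e: "e > 0"
  note L = sob_L2[OF s] sob_grad_L2[OF s]
  obtain d1 where d1: "d1 > 0" "\<And>h. norm h \<le> d1 \<Longrightarrow> En (\<lambda>x. u (h + x) - u x) < e"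
    using L2_shift_continuous[OF L(1) e] by blast
  obtain d2 where d2: "d2 > 0" "\<And>h. norm h \<le> d2 \<Longrightarrow> En (\<lambda>x. g (h + x) - g x) \<le> e"
    using L2_vec_shift_continuous[OF L(2) e] by blast
  \<comment> \<open>Halving t0 keeps t strictly below it; the 1 in the denominator covers nu = 0,
    the direction used at interior points.\<close>
  define t where "t = min (t0 / 2) (min d1 d2 / (norm \<nu> + 1))"
  have n1: "norm \<nu> + 1 > 0" by (simp add: add_nonneg_pos)
  have t: "0 < t" "t < t0" using t0(1) d1(1) d2(1) n1 by (auto simp: t_def min_less_iff_disj)
  have "t \<le> min d1 d2 / (norm \<nu> + 1)" unfolding t_def by (rule min.cobounded2)
  then have "t * (norm \<nu> + 1) \<le> min d1 d2" using n1 by (simp only: pos_le_divide_eq)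
  moreover have "norm (- t *\<^sub>R \<nu>) \<le> t * (norm \<nu> + 1)" using t by (simp add: algebra_simps)
  ultimately have h: "norm (- t *\<^sub>R \<nu>) \<le> d1" "norm (- t *\<^sub>R \<nu>) \<le> d2" by linarith+
  let ?h = "- t *\<^sub>R \<nu>" and ?K = "(+) (t *\<^sub>R \<nu>) ` K"
  have "approx0 \<Omega> (\<lambda>x. u (?h + x)) (\<lambda>x. g (?h + x))"
  proof (rule approx0_compact_support[OF sob_shift[OF s] _ _ K(2)])
    show "compact ?K" using compact_translation[OF K(1)] .
    show "?K \<subseteq> \<Omega>" using t0(2)[OF _ t] by (auto simp: add.commute)
    have "AE x in lborel. ?h + x \<notin> K \<longrightarrow> u (?h + x) = 0" by (rule lborel_AE_shift[OF z])
    then show "AE x in lborel. x \<notin> ?K \<longrightarrow> u (?h + x) = 0"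
    proof eventually_elim
      case (elim x)
      have "x = t *\<^sub>R \<nu> + (?h + x)" by simp
      then show ?case using elim by (metis image_eqI)
    qed
  qed
  moreover have "En (\<lambda>x. u (?h + x) - u x) \<le> e" using d1(2)[OF h(1)] by simp
  moreover have "En (\<lambda>x. g (?h + x) - g x) \<le> e" by (rule d2(2)[OF h(2)])
  ultimately show "\<exists>w k. approx0 \<Omega> w k \<and> En (\<lambda>x. w x - u x) \<le> e \<and> En (\<lambda>x. k x - g x) \<le> e" by blast
qed

text \<open>Mollifying the indicator of the ball of radius 3r/4 at scale r/4 leaves the value 1 up
  to r/2 and the value 0 beyond r.\<close>

lemma exists_cutoff:
  fixes x :: "real^'n" assumes r: "r > 0"
  shows "\<exists>\<eta>. test_fn \<eta> UNIV \<and> (\<forall>y\<in>ball x (r / 2). \<eta> y = 1) \<and> (\<forall>y. y \<notin> cball x r \<longrightarrow> \<eta> y = 0)"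
proof -
  obtain m :: "real^'n \<Rightarrow> real" and B where t: "test_fn m UNIV" and k: "kernel m (r / 4) B"
    using mollifier_kernel[of "r / 4"] r by (metis divide_pos_pos zero_less_numeral)
  have ms: "m h = 0" if "norm h > r / 4" for h using k that unfolding kernel_def by blast
  have m1: "(\<integral>h. m h \<partial>lborel) = 1" using k unfolding kernel_def by blast
  let ?I = "indicator (cball x (3 * r / 4)) :: real^'n \<Rightarrow> real"
  have Im: "?I \<in> borel_measurable borel" by (intro borel_measurable_indicator) auto
  have IL: "L2 ?I"
    using emeasure_bounded_finite[OF bounded_cball, of x "3 * r / 4"] Im
    by (simp add: L2_def integrable_indicator_iff indicator_sq)
  let ?\<eta> = "conv m ?I"
  have one: "?\<eta> y = 1" if y: "y \<in> ball x (r / 2)" for y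
  proof -
    have mI: "m h * ?I (y - h) = m h" for h
    proof (cases "norm h > r / 4")
      case False
      have "dist x (y - h) \<le> dist x y + norm h"
        using norm_triangle_ineq[of "x - y" h] by (simp add: dist_norm algebra_simps)
      then have "dist x (y - h) \<le> 3 * r / 4" using y False by simp
      then show ?thesis by simp
    qed (simp add: ms)
    show ?thesis unfolding conv_def by (simp only: mI m1)
  qed
  have zero: "?\<eta> y = 0" if y: "y \<notin> cball x r" for y
  proof -
    have mI: "m h * ?I (y - h) = 0" for h
    proof (cases "norm h > r / 4")
      case False
      have "dist x y \<le> dist x (y - h) + norm h"
        using norm_triangle_ineq[of "x - (y - h)" "- h"] by (simp add: dist_norm algebra_simps)
      then have "dist x (y - h) > 3 * r / 4" using y False by simp
      then show ?thesis by simp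
    qed (simp add: ms)
    show ?thesis unfolding conv_def by (simp only: mI) simp
  qed
  have "test_fn ?\<eta> UNIV" by (rule test_fnI[OF smooth_conv[OF t IL] compact_cball _ zero]) auto
  then show ?thesis using one zero by blast
qed

text \<open>Near a boundary point the direction opposite to the gradient of the defining function points
  strictly inwards; near an interior point the direction 0 does the job.\<close>

lemma smooth_boundary_push:
  fixes \<Omega> :: "(real^'n) set"
  assumes sb: "smooth_boundary \<Omega>" and op: "open \<Omega>" and x: "x \<in> closure \<Omega>"
  shows "\<exists>r \<nu> t0. r > 0 \<and> t0 > 0 \<and> (\<forall>y\<in>closure \<Omega> \<inter> cball x r. \<forall>t. 0 < t \<longrightarrow> t < t0 \<longrightarrow> y + t *\<^sub>R \<nu> \<in> \<Omega>)"
proof (cases "x \<in> \<Omega>")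
  case True
  then obtain r where "r > 0" "cball x r \<subseteq> \<Omega>" using op open_contains_cball by blast
  then show ?thesis by (intro exI[of _ r] exI[of _ 0] exI[of _ 1]) auto
next
  case False
  then have fr: "x \<in> frontier \<Omega>" using x op by (simp add: frontier_def interior_open)
  from sb[unfolded smooth_boundary_def, rule_format, OF fr]
  obtain U \<rho> where U: "open U" "x \<in> U" and sm: "smooth_on \<rho> U" and nz: "\<forall>y\<in>U. \<exists>i. partial i \<rho> y \<noteq> 0"
    and eq: "\<Omega> \<inter> U = {y\<in>U. \<rho> y < 0}" by (elim exE conjE)
  have "Ck_on (Suc 0) \<rho> U" using sm unfolding smooth_on_def by blast
  then have df: "\<And>y. y \<in> U \<Longrightarrow> \<rho> differentiable at y" and pc: "\<And>i. continuous_on U (partial i \<rho>)"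
    and rc: "continuous_on U \<rho>" by auto
  define \<nu> :: "real^'n" where "\<nu> = (\<chi> i. - partial i \<rho> x)"
  \<comment> \<open>The derivative of the defining function in the direction nu; at x it is minus
    the squared length of the gradient, and by continuity it stays negative nearby.\<close>
  define G where "G y = (\<Sum>i\<in>UNIV. partial i \<rho> y * \<nu> $ i)" for y
  have Gc: "continuous_on U G" unfolding G_def by (intro continuous_intros pc)
  obtain j where j: "partial j \<rho> x \<noteq> 0" using nz U(2) by blast
  have "(\<Sum>i\<in>UNIV. (partial i \<rho> x)\<^sup>2) > 0" using j by (intro sum_pos2[of _ j]) auto
  then have Gx: "G x < 0" by (simp add: G_def \<nu>_def sum_negf power2_eq_square)
  have "isCont G x" using Gc U by (simp add: continuous_on_eq_continuous_at)
  then have "eventually (\<lambda>y. G y < 0) (nhds x)"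
    using Gx by (intro order_tendstoD(2)[of G "G x"]) (simp add: isCont_def tendsto_at_iff_tendsto_nhds)
  moreover have "eventually (\<lambda>y. y \<in> U) (nhds x)" using U by (rule eventually_nhds_in_open)
  ultimately have "eventually (\<lambda>y. G y < 0 \<and> y \<in> U) (nhds x)" by (rule eventually_conj)
  then obtain d where d: "d > 0" "\<And>y. dist y x < d \<Longrightarrow> G y < 0 \<and> y \<in> U"
    unfolding eventually_nhds_metric by blast
  define r where "r = d / 2"
  have r: "r > 0" using d by (simp add: r_def)
  have n1: "norm \<nu> + 1 > 0" by (simp add: add_nonneg_pos)
  define t0 where "t0 = r / (norm \<nu> + 1)"
  have t0: "t0 > 0" using r n1 by (simp add: t0_def)
  have "y + t *\<^sub>R \<nu> \<in> \<Omega>" if y: "y \<in> closure \<Omega>" "y \<in> cball x r" and t: "0 < t" "t < t0" for y t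
  proof -
    have in_ball: "dist (y + \<tau> *\<^sub>R \<nu>) x < d" if "0 \<le> \<tau>" "\<tau> \<le> t" for \<tau>
    proof -
      have "\<tau> * norm \<nu> \<le> t * (norm \<nu> + 1)" using that t by (intro mult_mono) auto
      also have "\<dots> < t0 * (norm \<nu> + 1)" using t(2) n1 by (rule mult_strict_right_mono)
      also have "\<dots> = r" using n1 by (simp add: t0_def)
      finally have 1: "\<tau> * norm \<nu> < r" .
      have "dist (y + \<tau> *\<^sub>R \<nu>) x \<le> dist x y + norm (\<tau> *\<^sub>R \<nu>)"
        using norm_triangle_ineq[of "y - x" "\<tau> *\<^sub>R \<nu>"] by (simp add: dist_norm algebra_simps norm_minus_commute)
      then show ?thesis using 1 y(2) that(1) by (simp add: r_def)
    qed
    have yU: "y \<in> U" using d(2) in_ball[of 0] t by simp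
    \<comment> \<open>A point with positive value would have a neighbourhood free of Omega and could
      not lie in the closure. The strict decrease along nu then turns this weak inequality into a
      strict one.\<close>
    have "\<rho> y \<le> 0"
    proof (rule ccontr)
      assume "\<not> \<rho> y \<le> 0"
      then have pos: "\<rho> y > 0" by simp
      have "isCont \<rho> y" using rc U(1) yU by (simp add: continuous_on_eq_continuous_at)
      then have "eventually (\<lambda>z. \<rho> z > 0) (nhds y)"
        using pos by (intro order_tendstoD(1)[of \<rho> "\<rho> y"]) (simp add: isCont_def tendsto_at_iff_tendsto_nhds)
      then have "eventually (\<lambda>z. \<rho> z > 0 \<and> z \<in> U) (nhds y)"
        by (rule eventually_conj[OF _ eventually_nhds_in_open[OF U(1) yU]])
      then obtain \<delta> where \<delta>: "\<delta> > 0" "\<And>z. dist z y < \<delta> \<Longrightarrow> \<rho> z > 0 \<and> z \<in> U"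
        unfolding eventually_nhds_metric by blast
      obtain z where z: "z \<in> \<Omega>" "dist z y < \<delta>" using y(1) \<delta>(1) closure_approachable by blast
      then have "z \<in> \<Omega> \<inter> U" "\<rho> z > 0" using \<delta>(2) by auto
      then show False using eq by auto
    qed
    moreover have "\<rho> (y + t *\<^sub>R \<nu>) < \<rho> (y + 0 *\<^sub>R \<nu>)"
    proof (rule DERIV_neg_imp_decreasing[OF t(1), where f="\<lambda>\<tau>. \<rho> (y + \<tau> *\<^sub>R \<nu>)"])
      fix \<tau> :: real assume \<tau>: "0 \<le> \<tau>" "\<tau> \<le> t"
      note dG = d(2)[OF in_ball[OF \<tau>]]
      have 1: "((\<lambda>\<tau>. y + \<tau> *\<^sub>R \<nu>) has_derivative (\<lambda>s. s *\<^sub>R \<nu>)) (at \<tau>)"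
        by (auto intro!: derivative_eq_intros)
      from has_derivative_compose[OF 1 has_derivative_partial[OF df[OF conjunct2[OF dG]]]]
      have "((\<lambda>\<tau>. \<rho> (y + \<tau> *\<^sub>R \<nu>)) has_derivative (\<lambda>s. \<Sum>i\<in>UNIV. partial i \<rho> (y + \<tau> *\<^sub>R \<nu>) * (s *\<^sub>R \<nu>) $ i)) (at \<tau>)" .
      moreover have "(\<lambda>s. \<Sum>i\<in>UNIV. partial i \<rho> (y + \<tau> *\<^sub>R \<nu>) * (s *\<^sub>R \<nu>) $ i) = (*) (G (y + \<tau> *\<^sub>R \<nu>))"
        by (rule ext) (simp add: G_def sum_distrib_left sum_distrib_right mult_ac)
      ultimately have "((\<lambda>\<tau>. \<rho> (y + \<tau> *\<^sub>R \<nu>)) has_real_derivative G (y + \<tau> *\<^sub>R \<nu>)) (at \<tau>)"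
        by (simp add: has_field_derivative_def)
      then show "\<exists>D. ((\<lambda>\<tau>. \<rho> (y + \<tau> *\<^sub>R \<nu>)) has_real_derivative D) (at \<tau>) \<and> D < 0" using dG by blast
    qed
    moreover have "y + t *\<^sub>R \<nu> \<in> U" using d(2)[OF in_ball[of t]] t by simp
    ultimately have "y + t *\<^sub>R \<nu> \<in> {y \<in> U. \<rho> y < 0}" by simp
    then show ?thesis using eq by blast
  qed
  then show ?thesis using r t0 by (intro exI[of _ r] exI[of _ \<nu>] exI[of _ t0]) auto
qed

text \<open>In place of a partition of unity, one cutoff at a time is split off: the cut-off part
  lives near one centre and is pushed inwards, while the rest vanishes where the cutoff is 1 and so
  is supported in the remaining balls.\<close>

lemma H10_ext_if_vanishing_outside:
  fixes u :: "real^'n \<Rightarrow> real"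
  assumes s: "sob u g" and sb: "smooth_boundary \<Omega>" and op: "open \<Omega>" and bd: "bounded \<Omega>"
    and z: "AE x in lborel. x \<notin> closure \<Omega> \<longrightarrow> u x = 0"
  shows "H10_ext \<Omega> u"
proof -
  have "\<exists>r \<nu> t0. x \<in> closure \<Omega> \<longrightarrow> r > 0 \<and> t0 > 0 \<and> (\<forall>y\<in>closure \<Omega> \<inter> cball x r. \<forall>t. 0 < t \<longrightarrow> t < t0 \<longrightarrow> y + t *\<^sub>R \<nu> \<in> \<Omega>)" for x
    using smooth_boundary_push[OF sb op] by blast
  then obtain r \<nu> t0 where push: "\<And>x. x \<in> closure \<Omega> \<Longrightarrow> r x > 0 \<and> t0 x > 0 \<and>
    (\<forall>y\<in>closure \<Omega> \<inter> cball x (r x). \<forall>t. 0 < t \<longrightarrow> t < t0 x \<longrightarrow> y + t *\<^sub>R \<nu> x \<in> \<Omega>)" by metis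
  have cl: "compact (closure \<Omega>)" using bd by simp
  \<comment> \<open>Supports are tracked by the half-radius balls, on which a cutoff equals 1,
    whereas pushing is available on the full balls, outside which it vanishes.\<close>
  have main: "approx0 \<Omega> u g"
    if "finite F" "F \<subseteq> closure \<Omega>" "sob u g"
      "AE y in lborel. y \<notin> closure \<Omega> \<inter> (\<Union>x\<in>F. ball x (r x / 2)) \<longrightarrow> u y = 0" for F u g
    using that
  proof (induction F arbitrary: u g rule: finite_induct)
    case empty
    \<comment> \<open>With no balls left, u vanishes a.e., which is the compactly supported case
      with empty K.\<close>
    show ?case by (rule approx0_compact_support[OF empty(2) compact_empty _ op]) (use empty in auto)
  next
    case (insert x F)
    have x: "x \<in> closure \<Omega>" using insert by auto
    note p = push[OF x]
    obtain \<eta> where \<eta>: "test_fn \<eta> UNIV" "\<And>y. y \<in> ball x (r x / 2) \<Longrightarrow> \<eta> y = 1" "\<And>y. y \<notin> cball x (r x) \<Longrightarrow> \<eta> y = 0"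
      using exists_cutoff[of "r x" x] p by blast
    define w k where "w y = \<eta> y * u y" and "k y = \<eta> y *\<^sub>R g y + u y *\<^sub>R (\<chi> i. partial i \<eta> y)" for y
    have sw: "sob w k" unfolding w_def k_def by (rule sob_mult_test[OF insert.prems(2) \<eta>(1)])
    have 1: "approx0 \<Omega> w k"
    proof (rule approx0_push_inside[OF sw _ op])
      show "compact (closure \<Omega> \<inter> cball x (r x))" by (rule compact_Int[OF cl compact_cball])
      show "AE y in lborel. y \<notin> closure \<Omega> \<inter> cball x (r x) \<longrightarrow> w y = 0"
        using insert.prems(3) by eventually_elim (use \<eta>(3) in \<open>auto simp: w_def\<close>)
      show "t0 x > 0" using p by blast
      show "y + t *\<^sub>R \<nu> x \<in> \<Omega>" if "y \<in> closure \<Omega> \<inter> cball x (r x)" "0 < t" "t < t0 x" for y t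
        using p that by blast
    qed
    have 2: "approx0 \<Omega> (\<lambda>y. u y - w y) (\<lambda>y. g y - k y)"
    proof (rule insert.IH)
      show "F \<subseteq> closure \<Omega>" using insert by auto
      show "sob (\<lambda>y. u y - w y) (\<lambda>y. g y - k y)" by (rule sob_diff[OF insert.prems(2) sw])
      show "AE y in lborel. y \<notin> closure \<Omega> \<inter> (\<Union>x\<in>F. ball x (r x / 2)) \<longrightarrow> u y - w y = 0"
        using insert.prems(3) by eventually_elim (use \<eta>(2) in \<open>auto simp: w_def\<close>)
    qed
    show ?case using approx0_add[OF 1 2] by simp
  qed
  have "closure \<Omega> \<subseteq> (\<Union>x\<in>closure \<Omega>. ball x (r x / 2))" using push by force
  then obtain F where F: "F \<subseteq> closure \<Omega>" "finite F" "closure \<Omega> \<subseteq> (\<Union>x\<in>F. ball x (r x / 2))"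
    using compactE_image[OF cl, of "closure \<Omega>" "\<lambda>x. ball x (r x / 2)"] by auto
  have "AE y in lborel. y \<notin> closure \<Omega> \<inter> (\<Union>x\<in>F. ball x (r x / 2)) \<longrightarrow> u y = 0"
    using z by eventually_elim (use F(3) in auto)
  from main[OF F(2,1) s this] show ?thesis by (rule approx0_H10_ext)
qed

section \<open>Deep potential wells\<close>

lemma measure_minus_cball_tendsto:
  fixes A :: "'a::euclidean_space set"
  assumes A: "A \<in> sets borel" "emeasure lborel A < \<infinity>"
  shows "(\<lambda>n. measure lborel (A - cball 0 (real n))) \<longlonglongrightarrow> 0"
proof -
  have "(\<lambda>n. measure lborel (A - cball 0 (real n))) \<longlonglongrightarrow> measure lborel (\<Inter>n. A - cball 0 (real n))"
  proof (rule Lim_measure_decseq)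
    show "range (\<lambda>n. A - cball 0 (real n)) \<subseteq> sets lborel" using A(1) by auto
    show "decseq (\<lambda>n. A - cball 0 (real n))" unfolding decseq_def by auto
    have "emeasure lborel (A - cball 0 (real n)) \<le> emeasure lborel A" for n
      using A(1) by (intro emeasure_mono) auto
    then show "emeasure lborel (A - cball 0 (real n)) \<noteq> \<infinity>" for n
      using A(2) by (metis infinity_ennreal_def leD top.not_eq_extremum)
  qed
  moreover have "(\<Inter>n. A - cball 0 (real n)) = {}"
  proof -
    have "\<exists>n. x \<in> cball 0 (real n)" for x :: 'a using real_arch_simple[of "norm x"] by simp
    then show ?thesis by blast
  qed
  ultimately show ?thesis by (simp only: measure_empty)
qed

context potential
begin

text \<open>Chebyshev: u^2 <= V u^2 / c wherever V >= c.\<close>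

lemma outside_sublevel_En_le:
  assumes X: "Xpair u g" and c: "c > 0"
  shows "En (\<lambda>x. indicator (- {x. V x < c}) x * u x) \<le> pot V u / c"
proof -
  note Vm[measurable]
  have S: "- {x. V x < c} \<in> sets borel" by (intro borel_comp) measurable
  have s: "sob u g" using X by (simp add: Xpair_def)
  have "En (\<lambda>x. indicator (- {x. V x < c}) x * u x) \<le> (\<integral>x. V x * (u x)\<^sup>2 / c \<partial>lborel)"
    unfolding En_def
  proof (rule integral_mono)
    show "integrable lborel (\<lambda>x. (norm (indicator (- {x. V x < c}) x * u x))\<^sup>2)"
      using L2_indicator(1)[OF S sob_L2[OF s]] by (simp add: L2_def)
    show "integrable lborel (\<lambda>x. V x * (u x)\<^sup>2 / c)" using X by (simp add: Xpair_def)
    fix x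
    show "(norm (indicator (- {x. V x < c}) x * u x))\<^sup>2 \<le> V x * (u x)\<^sup>2 / c"
    proof (cases "V x < c")
      case True
      then show ?thesis using V0[of x] c by simp
    next
      case False
      then have "c * (u x)\<^sup>2 \<le> V x * (u x)\<^sup>2" by (intro mult_right_mono) auto
      then show ?thesis using False c by (simp add: pos_le_divide_eq mult.commute)
    qed
  qed
  then show ?thesis by (simp add: pot_def)
qed

text \<open>The X-norm has no L2 term of its own. Where V >= c the potential controls u, and on the
  remaining set of finite measure the Poincare inequality does.\<close>

lemma L2_bound:
  assumes c: "c > 0" "emeasure lborel {x. V x < c} < \<infinity>"
  shows "\<exists>C\<ge>0. \<forall>u g. Xpair u g \<longrightarrow> En u \<le> C * Q u g"
proof -
  note Vm[measurable]
  have S: "{x. V x < c} \<in> sets borel" by measurable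
  obtain C where C: "C \<ge> 0" "\<And>u g. sob u g \<Longrightarrow> En u \<le> C * En g + 2 * En (\<lambda>x. indicator (- {x. V x < c}) x * u x)"
    using En_poincare[OF S c(2)] by blast
  show ?thesis
  proof (intro exI[of _ "C + 2 / c"] conjI allI impI)
    show "C + 2 / c \<ge> 0" using C(1) c(1) by simp
    fix u g assume X: "Xpair u g"
    have "En u \<le> C * En g + 2 * (pot V u / c)"
      using C(2)[of u g] outside_sublevel_En_le[OF X c(1)] X by (simp add: Xpair_def)
    also have "\<dots> \<le> C * (En g + pot V u) + 2 / c * (En g + pot V u)"
      using C(1) c(1) En_nonneg[of g] pot_nonneg[of u] by (auto simp: distrib_left intro!: add_mono)
    finally show "En u \<le> (C + 2 / c) * Q u g" by (simp add: Q_def distrib_right)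
  qed
qed

text \<open>Outside a large ball, the part where V >= c is controlled by the vanishing potential
  energy and the part where V < c by \<open>En_small_set\<close>, since a set of finite measure has
  little mass far away.\<close>

lemma tightness:
  fixes u :: "nat \<Rightarrow> real^'n \<Rightarrow> real"
  assumes c: "c > 0" "emeasure lborel {x. V x < c} < \<infinity>"
    and X: "\<And>n. Xpair (u n) (g n)" and M: "\<And>n. En (u n) \<le> M" "\<And>n. En (g n) \<le> M"
    and pl: "(\<lambda>n. pot V (u n)) \<longlonglongrightarrow> 0" and e: "e > 0"
  shows "\<exists>\<rho> n0. \<forall>n\<ge>n0. En (\<lambda>x. indicator (- cball 0 \<rho>) x * u n x) \<le> e"
proof -
  note Vm[measurable]
  let ?A = "{x. V x < c}"
  have A: "?A \<in> sets borel" by measurable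
  have M0: "M \<ge> 0" using M(1)[of 0] En_nonneg[of "u 0"] by linarith
  \<comment> \<open>R comes first and makes the gradient term \<open>16 * R\<^sup>2 * M\<close> at
    most e/4. It determines B, and only then is the ball taken so large that the measure term falls
    below e/4.\<close>
  define R where "R = sqrt (e / (64 * (M + 1)))"
  have R: "R > 0" using e M0 by (simp add: R_def)
  have R2: "16 * R\<^sup>2 * M \<le> e / 4"
  proof -
    have "M + 1 \<noteq> 0" using M0 by linarith
    moreover have "R\<^sup>2 = e / 64 / (M + 1)" using e M0 by (simp add: R_def)
    ultimately have "R\<^sup>2 * (M + 1) = e / 64" using nonzero_eq_divide_eq by blast
    moreover have "R\<^sup>2 * M \<le> R\<^sup>2 * (M + 1)" by (intro mult_left_mono) auto
    ultimately show ?thesis by argo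
  qed
  define B where "B = 1 / measure lborel (cball (0::real^'n) R)"
  have B0: "B \<ge> 0" by (simp add: B_def)
  have k: "kernel (ball_kernel R :: real^'n \<Rightarrow> real) R B" unfolding B_def by (rule kernel_ball_kernel[OF R])
  have "(\<lambda>n. 2 * B * measure lborel (?A - cball 0 (real n)) * M) \<longlonglongrightarrow> 2 * B * 0 * M"
    by (intro tendsto_intros measure_minus_cball_tendsto[OF A c(2)])
  then have "eventually (\<lambda>n. 2 * B * measure lborel (?A - cball 0 (real n)) * M < e / 4) sequentially"
    using e by (intro order_tendstoD(2)) auto
  then obtain m where m: "2 * B * measure lborel (?A - cball 0 (real m)) * M < e / 4"
    by (auto simp: eventually_sequentially)
  have "eventually (\<lambda>n. pot V (u n) < c * e / 2) sequentially"
    using pl by (rule order_tendstoD(2)) (use c e in simp)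
  then obtain n0 where n0: "\<And>n. n \<ge> n0 \<Longrightarrow> pot V (u n) < c * e / 2" by (auto simp: eventually_sequentially)
  show ?thesis
  proof (intro exI[of _ "real m"] exI[of _ n0] allI impI)
    fix n assume n: "n \<ge> n0"
    have s: "sob (u n) (g n)" using X by (simp add: Xpair_def)
    let ?S = "?A - cball 0 (real m)" and ?w = "\<lambda>x. indicator (- cball 0 (real m)) x * u n x"
    have Sb: "?S \<in> sets borel" using A by auto
    have Sf: "emeasure lborel ?S < \<infinity>"
      using emeasure_mono[of ?S ?A lborel] A c(2) by (auto simp: order_le_less_trans)
    have nA: "- ?A \<in> sets borel" using A by (rule borel_comp)
    have cb: "- cball (0::real^'n) (real m) \<in> sets borel" by auto
    have wL: "L2 ?w" by (rule L2_indicator(1)[OF cb sob_L2[OF s]])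
    have "En ?w = En (\<lambda>x. indicator ?A x * ?w x) + En (\<lambda>x. indicator (- ?A) x * ?w x)"
      by (rule En_split_indicator[OF A wL])
    also have "(\<lambda>x. indicator ?A x * ?w x) = (\<lambda>x. indicator ?S x * u n x)"
      by (rule ext) (auto simp: indicator_def)
    also have "En (\<lambda>x. indicator ?S x * u n x) \<le> e / 2"
    proof -
      have "En (\<lambda>x. indicator ?S x * u n x) \<le> 2 * B * measure lborel ?S * En (u n) + 16 * R\<^sup>2 * En (g n)"
        by (rule En_small_set[OF s Sb Sf k less_imp_le[OF R]])
      also have "\<dots> \<le> 2 * B * measure lborel ?S * M + 16 * R\<^sup>2 * M"
        using B0 by (intro add_mono mult_left_mono M) auto
      also have "\<dots> \<le> e / 2" using m R2 by argo
      finally show ?thesis .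
    qed
    also have "(\<lambda>x. indicator (- ?A) x * ?w x) = (\<lambda>x. indicator (- cball 0 (real m)) x * (indicator (- ?A) x * u n x))"
      by (rule ext) simp
    also have "En \<dots> \<le> En (\<lambda>x. indicator (- ?A) x * u n x)"
      by (rule L2_indicator(2)[OF cb L2_indicator(1)[OF nA sob_L2[OF s]]])
    also have "\<dots> \<le> pot V (u n) / c" by (rule outside_sublevel_En_le[OF X c(1)])
    also have "\<dots> \<le> e / 2" using n0[OF n] c(1) by (simp add: pos_divide_le_eq mult.commute)
    finally show "En ?w \<le> e" by simp
  qed
qed

text \<open>Along an a.e. convergent subsequence Fatou gives sqrt(V) u0 zero energy, so this product
  vanishes a.e.\<close>

lemma limit_vanishes:
  assumes X: "\<And>n. Xpair (u n) (g n)" and u0: "L2 u0" and lim: "(\<lambda>n. En (\<lambda>x. u n x - u0 x)) \<longlonglongrightarrow> 0"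
    and pl: "(\<lambda>n. pot V (u n)) \<longlonglongrightarrow> 0"
  shows "AE x in lborel. V x \<noteq> 0 \<longrightarrow> u0 x = 0"
proof -
  note Vm[measurable] and L2_measurable[OF u0, measurable]
  have uL: "L2 (u n)" for n using X[of n] sob_L2[of "u n" "g n"] by (simp add: Xpair_def)
  obtain r where r: "strict_mono (r :: nat \<Rightarrow> nat)" "AE x in lborel. (\<lambda>n. u (r n) x) \<longlonglongrightarrow> u0 x"
    using L2_AE_subseq[OF uL u0 lim] by blast
  have a: "AE x in lborel. (\<lambda>n. sqrt (V x) * u (r n) x) \<longlonglongrightarrow> sqrt (V x) * u0 x"
    using r(2) by eventually_elim (intro tendsto_intros)
  have prl: "(\<lambda>n. pot V (u (r n))) \<longlonglongrightarrow> 0" using LIMSEQ_subseq_LIMSEQ[OF pl r(1)] by (simp add: o_def)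
  have m: "(\<lambda>x. sqrt (V x) * u0 x) \<in> borel_measurable lborel" by measurable
  have z: "L2 (\<lambda>x. sqrt (V x) * u0 x) \<and> En (\<lambda>x. sqrt (V x) * u0 x) \<le> e" if e: "e > 0" for e
  proof -
    have "eventually (\<lambda>n. pot V (u (r n)) < e) sequentially" using prl e by (rule order_tendstoD(2))
    then obtain K where K: "\<And>n. n \<ge> K \<Longrightarrow> pot V (u (r n)) < e" by (auto simp: eventually_sequentially)
    have le: "En (\<lambda>x. sqrt (V x) * u (r n) x) \<le> e" if "n \<ge> K" for n
      using sqrtV_L2(2)[OF X] K[OF that] by simp
    show ?thesis using L2_fatou[OF sqrtV_L2(1)[OF X] m a le] by blast
  qed
  have "En (\<lambda>x. sqrt (V x) * u0 x) \<le> 0" by (rule dense_ge) (use z in blast)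
  then have "En (\<lambda>x. sqrt (V x) * u0 x) = 0" using En_nonneg[of "\<lambda>x. sqrt (V x) * u0 x"] by linarith
  then have "AE x in lborel. sqrt (V x) * u0 x = 0" using En_eq_0_AE z zero_less_one by blast
  then show ?thesis by eventually_elim auto
qed

end

theorem theorem3p1:
  fixes V :: "real^'n \<Rightarrow> real"
    and \<mu> :: "nat \<Rightarrow> real"
    and v :: "nat \<Rightarrow> real^'n \<Rightarrow> real"
    and c0 :: real
  assumes "CARD('n) \<ge> 3"
    and "V_hyps V"
    and "\<forall>n. \<mu> n > 0"
    and "filterlim \<mu> at_top sequentially"
    and "\<forall>n. Xsp V (v n)"
    and "c0 > 0"
    and "\<forall>n. mu_norm (\<mu> n) V (v n) \<le> c0"
  shows "\<exists>s v0. strict_mono s \<and> H10_ext (interior {x. V x = 0}) v0 \<and>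
           weak_conv_X V (v \<circ> s) v0 \<and>
           (\<forall>r. 2 \<le> r \<and> r < 2 * real CARD('n) / (real CARD('n) - 2) \<longrightarrow> Lr_conv r (v \<circ> s) v0)"
proof -
  let ?\<Omega> = "interior {x. V x = 0}"
  have Vnn: "\<And>x. V x \<ge> 0" and Vc: "continuous_on UNIV V" and \<Omega>: "bounded ?\<Omega>" "smooth_boundary ?\<Omega>" "closure ?\<Omega> = {x. V x = 0}"
    using assms(2) unfolding V_hyps_def Let_def by auto
  obtain c where c: "c > 0" "emeasure lborel {x. V x < c} < \<infinity>"
    using assms(2) unfolding V_hyps_def by blast
  interpret potential V
    by unfold_locales (rule Vnn, rule borel_measurable_continuous_onI[OF Vc])
  have "\<forall>n. \<exists>g. Xpair (v n) g" using assms(5) Xsp_iff by blast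
  from choice[OF this] obtain g where vX: "\<And>n. Xpair (v n) (g n)" by blast
  have en: "En (g n) + \<mu> n * pot V (v n) \<le> c0\<^sup>2" for n
    using spec[OF assms(7), of n] unfolding mu_norm_Xpair[OF vX] by (rule sqrt_le_D)
  have "eventually (\<lambda>n. \<mu> n \<ge> 1) sequentially" using assms(4) by (simp add: filterlim_at_top)
  then obtain n1 where n1: "\<And>n. n \<ge> n1 \<Longrightarrow> \<mu> n \<ge> 1" by (auto simp: eventually_sequentially)
  \<comment> \<open>From n1 on the mu-norm dominates the X-norm, so the shifted sequence has
    X-energy at most c0^2.\<close>
  define u h where "u n = v (n + n1)" and "h n = g (n + n1)" for n
  have X: "Xpair (u n) (h n)" for n by (simp add: u_def h_def vX)
  have pot_le: "pot V (u n) \<le> c0\<^sup>2 * inverse (\<mu> (n + n1))" for n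
  proof -
    have "\<mu> (n + n1) * pot V (v (n + n1)) \<le> c0\<^sup>2" using en[of "n + n1"] En_nonneg[of "g (n + n1)"] by linarith
    then show ?thesis using assms(3) by (simp add: u_def field_simps)
  qed
  have Qle: "Q (u n) (h n) \<le> c0\<^sup>2" for n
  proof -
    have "1 * pot V (v (n + n1)) \<le> \<mu> (n + n1) * pot V (v (n + n1))"
      by (intro mult_right_mono n1 pot_nonneg) simp
    then show ?thesis using en[of "n + n1"] by (simp add: Q_def u_def h_def)
  qed
  have pl: "(\<lambda>n. pot V (u n)) \<longlonglongrightarrow> 0"
  proof (rule Lim_null_comparison)
    show "eventually (\<lambda>n. norm (pot V (u n)) \<le> c0\<^sup>2 * inverse (\<mu> (n + n1))) sequentially"
      using pot_le pot_nonneg by simp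
    have "(\<lambda>n. inverse (\<mu> (n + n1))) \<longlonglongrightarrow> 0"
      using tendsto_inverse_0_at_top[OF assms(4)] by (rule LIMSEQ_ignore_initial_segment)
    then have "(\<lambda>n. c0\<^sup>2 * inverse (\<mu> (n + n1))) \<longlonglongrightarrow> c0\<^sup>2 * 0" by (intro tendsto_intros)
    then show "(\<lambda>n. c0\<^sup>2 * inverse (\<mu> (n + n1))) \<longlonglongrightarrow> 0" by simp
  qed
  obtain C where C: "C \<ge> 0" "\<And>u g. Xpair u g \<Longrightarrow> En u \<le> C * Q u g" using L2_bound[OF c] by blast
  \<comment> \<open>One constant for both energies: C c0^2 bounds the functions and c0^2 the
    gradients.\<close>
  define M where "M = (C + 1) * c0\<^sup>2"
  have uM: "En (u n) \<le> M" for n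
  proof -
    have "En (u n) \<le> C * c0\<^sup>2" using C(2)[OF X[of n]] mult_left_mono[OF Qle[of n] C(1)] by linarith
    then show ?thesis by (simp add: M_def distrib_right add_increasing2)
  qed
  have hM: "En (h n) \<le> M" for n
  proof -
    have "En (h n) \<le> c0\<^sup>2" using Qle[of n] pot_nonneg[of "u n"] by (simp add: Q_def)
    then show ?thesis using C(1) by (simp add: M_def distrib_right add_increasing)
  qed
  have us: "sob (u n) (h n)" for n using X by (simp add: Xpair_def)
  obtain s v0 where s: "strict_mono (s :: nat \<Rightarrow> nat)" and v0: "L2 v0"
    and lim: "(\<lambda>n. En (\<lambda>x. u (s n) x - v0 x)) \<longlonglongrightarrow> 0"
    using rellich[OF us uM hM tightness[OF c X uM hM pl]] by blast
  have wc: "weak_conv_X V (\<lambda>n. u (s n)) v0" by (rule weak_conv[OF X Qle v0 lim])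
  obtain g0 where g0: "Xpair v0 g0" using hull_limit[OF X Qle v0 lim] by blast
  then have sv0: "sob v0 g0" by (simp add: Xpair_def)
  have pls: "(\<lambda>n. pot V (u (s n))) \<longlonglongrightarrow> 0" using LIMSEQ_subseq_LIMSEQ[OF pl s] by (simp add: o_def)
  \<comment> \<open>By (V3) the complement of the closure of Omega is exactly the set where V does
    not vanish.\<close>
  have "AE x in lborel. x \<notin> closure ?\<Omega> \<longrightarrow> v0 x = 0"
    using limit_vanishes[OF X v0 lim pls] by (simp add: \<Omega>(3))
  then have H: "H10_ext ?\<Omega> v0"
    by (rule H10_ext_if_vanishing_outside[OF sv0 \<Omega>(2) open_interior \<Omega>(1)])
  have Lr: "Lr_conv r (\<lambda>n. u (s n)) v0" if r: "2 \<le> r" "r < 2 * real CARD('n) / (real CARD('n) - 2)" for r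
    unfolding Lr_conv_def
  proof (intro conjI allI)
    show "u (s n) \<in> borel_measurable lborel" for n using sob_L2[OF us] by (simp add: L2_def)
    show "v0 \<in> borel_measurable lborel" using v0 by (simp add: L2_def)
    \<comment> \<open>A difference has at most twice the sum of the two energies; including both
      limit energies gives one bound for functions and gradients.\<close>
    let ?M = "2 * M + 2 * (En v0 + En g0)"
    show "(\<lambda>n. \<integral>\<^sup>+x. ennreal (\<bar>u (s n) x - v0 x\<bar> powr r) \<partial>lborel) \<longlonglongrightarrow> 0"
    proof (rule sob_L2_to_Lr[OF assms(1) r sob_diff[OF us sv0] _ _ lim, where M = ?M])
      show "En (\<lambda>x. u (s n) x - v0 x) \<le> ?M" for n
        using En_diff_le[OF sob_L2[OF us[of "s n"]] v0] uM[of "s n"] En_nonneg[of g0] by argo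
      show "En (\<lambda>x. h (s n) x - g0 x) \<le> ?M" for n
        using En_diff_le[OF sob_grad_L2[OF us[of "s n"]] sob_grad_L2[OF sv0]] hM[of "s n"] En_nonneg[of v0] by argo
    qed
  qed
  have eq: "v \<circ> (\<lambda>n. s n + n1) = (\<lambda>n. u (s n))" by (auto simp: u_def)
  \<comment> \<open>Adding n1 to the index turns a subsequence of the shifted sequence into one of
    v.\<close>
  have "strict_mono (\<lambda>n. s n + n1)" using s by (simp add: strict_mono_def)
  then show ?thesis
    using H wc Lr unfolding eq[symmetric] by (intro exI[of _ "\<lambda>n. s n + n1"] exI[of _ v0]) simp
qed

end
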